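(* Consider a random matrix $G\in\mathbb{R}^{n_1\times n_2}$ whose elements are drawn from the i.i.d. standard normal distribution. Let $f_i$, $i=1,\dots,n_1$, be the non-increasingly ordered elements of a vector $f\in\mathbb{R}_+^{n_1}$. Suppose $n_1,n_2\to\infty$ and $s:=\frac{n_1}{n_2}\in(0,1]$. Then $$S:=\mathbb{E}\,\frac1{n_1}\sum_{i=1}^{n_1}\Big(\sigma_i\big(\tfrac{G}{\sqrt{n_2}}\big)-f_i\Big)_+^2\;\le\;\frac1{n_1}\sum_{i=1}^{n_1}\int_{l_b(s)}^{u_b(s)}(u-f_i)_+^2\,\frac{\sqrt{(u_b(s)^2-u^2)(u^2-l_b(s)^2)}}{\pi u s}\,du=:S_{ap}.$$
   Context: $\sigma_i(A)$ denotes the $i$-th singular value of the matrix $A$, with singular values sorted in non-increasing order; $(a)_+=\max\{a,0\}$, and $(a)_+^2$ is its square; $l_b(s)=1-\sqrt s$ and $u_b(s)=1+\sqrt s$; $\mathbb{E}$ is expectation over $G$. *)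

theory Defs
  imports "HOL-Probability.Probability" "Jordan_Normal_Form.Char_Poly"
begin

(* Indices are 0-based throughout: sigma_i and f_i of the usual 1-based numbering are
   singular_value A (i - 1) and desc_entry f (i - 1). *)

(* For A with n rows and m columns this gives the singular values for i < min n m: the
   eigenvalues of A A^T, counted with multiplicity, are their squares, followed by zeros
   if m < n. *)
definition singular_value :: "real mat \<Rightarrow> nat \<Rightarrow> real" where
  "singular_value A i =
     rev (sorted_list_of_multiset (image_mset sqrt (proots (char_poly (A * transpose_mat A))))) ! i"

definition desc_entry :: "real vec \<Rightarrow> nat \<Rightarrow> real" where
  "desc_entry v i = rev (sort (list_of_vec v)) ! i"

definition pos_part :: "real \<Rightarrow> real" where
  "pos_part a = max a 0"

definition std_gaussian_matrix :: "'a measure \<Rightarrow> nat \<Rightarrow> nat \<Rightarrow> ('a \<Rightarrow> real mat) \<Rightarrow> bool" where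
  "std_gaussian_matrix M n1 n2 G \<longleftrightarrow>
     prob_space M \<and>
     (\<forall>\<omega>\<in>space M. G \<omega> \<in> carrier_mat n1 n2) \<and>
     prob_space.indep_vars M (\<lambda>_. borel) (\<lambda>(i, j) \<omega>. G \<omega> $$ (i, j)) ({..<n1} \<times> {..<n2}) \<and>
     (\<forall>i<n1. \<forall>j<n2. distributed M lborel (\<lambda>\<omega>. G \<omega> $$ (i, j)) std_normal_density)"

definition l_b :: "real \<Rightarrow> real" where
  "l_b s = 1 - sqrt s"

definition u_b :: "real \<Rightarrow> real" where
  "u_b s = 1 + sqrt s"

definition S_exact :: "'a measure \<Rightarrow> nat \<Rightarrow> nat \<Rightarrow> ('a \<Rightarrow> real mat) \<Rightarrow> real vec \<Rightarrow> real" where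
  "S_exact M n1 n2 G f =
     prob_space.expectation M (\<lambda>\<omega>. 1 / real n1 *
       (\<Sum>i<n1. (pos_part (singular_value ((1 / sqrt (real n2)) \<cdot>\<^sub>m G \<omega>) i - desc_entry f i))\<^sup>2))"

(* For s = 1 the lower limit is u = 0, where the junk value x / 0 = 0 affects one point only. *)
definition S_ap :: "nat \<Rightarrow> nat \<Rightarrow> real vec \<Rightarrow> real" where
  "S_ap n1 n2 f = (let s = real n1 / real n2 in
     1 / real n1 * (\<Sum>i<n1. LBINT u:{l_b s..u_b s}.
       (pos_part (u - desc_entry f i))\<^sup>2 *
       (sqrt (((u_b s)\<^sup>2 - u\<^sup>2) * (u\<^sup>2 - (l_b s)\<^sup>2)) / (pi * u * s))))"

end

theory Submission
  imports Defs "Jordan_Normal_Form.Schur_Decomposition"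
begin

text \<open>Rearrangement: since \<open>x \<mapsto> (x)\<^sub>+\<^sup>2\<close> is convex, pairing both sequences in decreasing order gives at
  most the average over all pairs, so it suffices to bound \<open>\<sum>\<^sub>j (\<sigma>\<^sub>j - c)\<^sub>+\<^sup>2\<close> for a fixed \<open>c \<ge> 0\<close>.
  As a function of \<open>x = \<sigma>\<^sup>2\<close> the summand is \<open>x\<close> times a continuous function, hence it is bounded above on
  \<open>[0, \<infinity>)\<close> by a polynomial without constant term that is almost sharp on \<open>[0, 4]\<close>, which contains the
  support of every Marchenko-Pastur law with \<open>s \<le> 1\<close>.  This leaves the moments
  \<open>\<tau>\<^sub>p = tr (G G\<^sup>T / n\<^sub>2)\<^sup>p / n\<^sub>1\<close>.  Gaussian integration by parts expresses the expectation of a product of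
  \<open>\<tau>\<close>s by products of total degree one less, up to terms of order \<open>1 / n\<^sub>2\<close>.  By induction on the total degree
  such an expectation is asymptotically the product of the \<open>\<mu>\<^sub>p\<close> with
  \<open>\<mu>\<^sub>p\<^sub>+\<^sub>1 = \<mu>\<^sub>p + s \<sum>\<^sub>a\<^sub><\<^sub>p \<mu>\<^sub>a \<mu>\<^sub>p\<^sub>-\<^sub>a\<close>, uniformly in \<open>s \<in> (0, 1]\<close>; no separate concentration
  argument is needed.  The Marchenko-Pastur integrals satisfy a linear three-term recursion by partial
  integration, and their generating function turns it into the same quadratic recursion.\<close>

section \<open>Gaussian integration by parts\<close>

text \<open>Polynomials in the entries are plain real functions; \<open>poly_deriv e I\<close>
  relates such a function to its formal derivative in the variable \<open>e\<close>. Traces obtain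
  their derivatives from sum and product rules alone, so integration by parts has to be checked for
  monomials only.

  The recursion for a single expected trace does not close: integration by parts produces products
  of two traces, and differentiating a product merges factors again. Hence the induction runs over
  expectations of arbitrary products, indexed by multisets, and factorisation in the limit comes out
  of it.

  The other obstacle is uniformity. The ratio \<open>s\<close> and the vector \<open>f\<close> may
  vary with \<open>k\<close> without converging, and the number of thresholds \<open>f_i\<close>
  grows. So differences to the limit moments are estimated, bounds hold for all \<open>s\<close> in
  (0,1], and thresholds are rounded down to a grid of fixed mesh. The law lives on [0,2] in
  \<open>u\<close>, so a threshold above 2 can be treated as 2, and finitely many polynomials serve
  all \<open>i\<close> and \<open>k\<close>. The missing constant term keeps all averages at
  positive powers of \<open>u\<close>, which absorb the factor \<open>1/u\<close> of the
  density.\<close>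

inductive poly_deriv :: "'i \<Rightarrow> 'i set \<Rightarrow> (('i \<Rightarrow> real) \<Rightarrow> real) \<Rightarrow> (('i \<Rightarrow> real) \<Rightarrow> real) \<Rightarrow> bool"
  for e I where
  const: "poly_deriv e I (\<lambda>_. c) (\<lambda>_. 0)"
| var: "i \<in> I \<Longrightarrow> poly_deriv e I (\<lambda>x. x i) (\<lambda>_. if i = e then 1 else 0)"
| add: "poly_deriv e I F F' \<Longrightarrow> poly_deriv e I H H' \<Longrightarrow> poly_deriv e I (\<lambda>x. F x + H x) (\<lambda>x. F' x + H' x)"
| mult: "poly_deriv e I F F' \<Longrightarrow> poly_deriv e I H H' \<Longrightarrow>
    poly_deriv e I (\<lambda>x. F x * H x) (\<lambda>x. F' x * H x + F x * H' x)"

lemma poly_deriv_sum: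
  assumes "finite A" "\<And>a. a \<in> A \<Longrightarrow> poly_deriv e I (F a) (F' a)"
  shows "poly_deriv e I (\<lambda>x. \<Sum>a\<in>A. F a x) (\<lambda>x. \<Sum>a\<in>A. F' a x)"
  using assms by (induction A rule: finite_induct) (auto intro: poly_deriv.intros)

fun mon_deriv :: "'i \<Rightarrow> 'i list \<Rightarrow> ('i \<Rightarrow> real) \<Rightarrow> real" where
  "mon_deriv e [] x = 0"
| "mon_deriv e (i # l) x = (if i = e then 1 else 0) * prod_list (map x l) + x i * mon_deriv e l x"

lemma mon_deriv_append:
  "mon_deriv e (l @ l') x = mon_deriv e l x * prod_list (map x l') + prod_list (map x l) * mon_deriv e l' x"
  by (induction l) (auto simp: algebra_simps)

lemma sum_list_product:
  fixes f :: "'b \<Rightarrow> real"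
  shows "sum_list (map f ps) * sum_list (map g qs) = (\<Sum>(p, q)\<leftarrow>List.product ps qs. f p * g q)"
  by (induction ps) (auto simp: algebra_simps sum_list_const_mult o_def)

text \<open>Common normal form: one list of coefficient-monomial pairs represents \<open>F\<close>
  and \<open>F'\<close> at once, a monomial being a list of variables with repetition. A product of
  polynomials concatenates monomials, and \<open>mon_deriv_append\<close> is then the Leibniz rule.
  Equal monomials are never collected.\<close>

lemma poly_deriv_monomials:
  assumes "poly_deriv e I F F'"
  obtains ps where "\<forall>(c, l) \<in> set ps. set l \<subseteq> I"
    "F = (\<lambda>x. \<Sum>(c, l)\<leftarrow>ps. c * prod_list (map x l))" "F' = (\<lambda>x. \<Sum>(c, l)\<leftarrow>ps. c * mon_deriv e l x)"
  using assms
proof (induction arbitrary: thesis)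
  case (const c)
  show ?case by (rule const[of "[(c, [])]"]) auto
next
  case (var i)
  show ?case by (rule var(2)[of "[(1, [i])]"]) (use var in auto)
next
  case (add F F' H H')
  obtain ps where ps: "\<forall>(c, l) \<in> set ps. set l \<subseteq> I"
    "F = (\<lambda>x. \<Sum>(c, l)\<leftarrow>ps. c * prod_list (map x l))" "F' = (\<lambda>x. \<Sum>(c, l)\<leftarrow>ps. c * mon_deriv e l x)"
    by (rule add.IH(1))
  obtain qs where qs: "\<forall>(c, l) \<in> set qs. set l \<subseteq> I"
    "H = (\<lambda>x. \<Sum>(c, l)\<leftarrow>qs. c * prod_list (map x l))" "H' = (\<lambda>x. \<Sum>(c, l)\<leftarrow>qs. c * mon_deriv e l x)"
    by (rule add.IH(2))
  show ?case by (rule add.prems[of "ps @ qs"]) (use ps qs in auto)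
next
  case (mult F F' H H')
  obtain ps where ps: "\<forall>(c, l) \<in> set ps. set l \<subseteq> I"
    "F = (\<lambda>x. \<Sum>(c, l)\<leftarrow>ps. c * prod_list (map x l))" "F' = (\<lambda>x. \<Sum>(c, l)\<leftarrow>ps. c * mon_deriv e l x)"
    by (rule mult.IH(1))
  obtain qs where qs: "\<forall>(c, l) \<in> set qs. set l \<subseteq> I"
    "H = (\<lambda>x. \<Sum>(c, l)\<leftarrow>qs. c * prod_list (map x l))" "H' = (\<lambda>x. \<Sum>(c, l)\<leftarrow>qs. c * mon_deriv e l x)"
    by (rule mult.IH(2))
  let ?rs = "map (\<lambda>((c, l), (c', l')). (c * c', l @ l')) (List.product ps qs)"
  show ?case
  proof (rule mult.prems[of ?rs])
    show "\<forall>(c, l)\<in>set ?rs. set l \<subseteq> I" using ps(1) qs(1) by fastforce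
    show "(\<lambda>x. F x * H x) = (\<lambda>x. \<Sum>(c, l)\<leftarrow>?rs. c * prod_list (map x l))"
      unfolding ps qs sum_list_product
      by (intro ext arg_cong[where f = sum_list]) (auto simp: o_def)
    show "(\<lambda>x. F' x * H x + F x * H' x) = (\<lambda>x. \<Sum>(c, l)\<leftarrow>?rs. c * mon_deriv e l x)"
      unfolding ps qs sum_list_product sum_list_addf[symmetric]
      by (intro ext arg_cong[where f = sum_list]) (auto simp: o_def mon_deriv_append algebra_simps)
  qed
qed

text \<open>Passes from lists to exponents, the form in which independence factorises expectations.
  Where \<open>count_list l e - 1\<close> truncates, the coefficient \<open>count_list l e\<close>
  is zero.\<close>

lemma mon_deriv_count:
  assumes "finite I" "set l \<subseteq> I" "e \<in> I"
  shows "mon_deriv e l x = real (count_list l e) * x e ^ (count_list l e - 1) * (\<Prod>i\<in>I - {e}. x i ^ count_list l i)"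
    and "prod_list (map x l) = (\<Prod>i\<in>I. x i ^ count_list l i)"
proof -
  have *: "prod_list (map x l) = (\<Prod>i\<in>I. x i ^ count_list l i)" if "set l \<subseteq> I" for l
    using that
  proof (induction l)
    case (Cons a l)
    then have a: "a \<in> I" by simp
    have "(\<Prod>i\<in>I. x i ^ count_list (a # l) i) = (\<Prod>i\<in>I. (if i = a then x a else 1) * x i ^ count_list l i)"
      by (intro prod.cong) auto
    also have "\<dots> = x a * (\<Prod>i\<in>I. x i ^ count_list l i)"
      using a assms(1) by (simp add: prod.distrib)
    finally show ?case using Cons by simp
  qed simp
  then show "prod_list (map x l) = (\<Prod>i\<in>I. x i ^ count_list l i)" using assms(2) .
  show "mon_deriv e l x = real (count_list l e) * x e ^ (count_list l e - 1) * (\<Prod>i\<in>I - {e}. x i ^ count_list l i)"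
    using assms(2)
  proof (induction l)
    case (Cons a l)
    have l: "set l \<subseteq> I" and a: "a \<in> I" using Cons.prems by auto
    show ?case
    proof (cases "a = e")
      case True
      have "mon_deriv e (a # l) x = prod_list (map x l) + x e * mon_deriv e l x" using True by simp
      also have "prod_list (map x l) = x e ^ count_list l e * (\<Prod>i\<in>I - {e}. x i ^ count_list l i)"
        unfolding *[OF l] using assms by (simp add: prod.remove)
      also have "x e * mon_deriv e l x = real (count_list l e) * x e ^ count_list l e * (\<Prod>i\<in>I - {e}. x i ^ count_list l i)"
        unfolding Cons.IH[OF l] by (cases "count_list l e") auto
      also have "(\<Prod>i\<in>I - {e}. x i ^ count_list l i) = (\<Prod>i\<in>I - {e}. x i ^ count_list (a # l) i)"
        using True by (intro prod.cong) auto
      finally show ?thesis using True by (simp add: algebra_simps)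
    next
      case False
      have "(\<Prod>i\<in>I - {e}. x i ^ count_list (a # l) i) = (\<Prod>i\<in>I - {e}. (if i = a then x a else 1) * x i ^ count_list l i)"
        by (intro prod.cong) auto
      also have "\<dots> = x a * (\<Prod>i\<in>I - {e}. x i ^ count_list l i)"
        using a False assms(1) by (simp add: prod.distrib)
      finally show ?thesis using False Cons.IH[OF l] by simp
    qed
  qed simp
qed

text \<open>Integration by parts for one Gaussian variable and the monomial \<open>x ^ k\<close>,
  read off from the closed formulas for the moments. For even \<open>k\<close> both sides vanish, by
  odd moments or, on the right for \<open>k = 0\<close>, by the coefficient.\<close>

lemma std_normal_moment_rec:
  "(LBINT x. std_normal_density x * x ^ Suc k) = real k * (LBINT x. std_normal_density x * x ^ (k - 1))"
proof (cases "even k")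
  case True
  then obtain j where j: "k = 2 * j" by (elim evenE)
  have "j = 0 \<or> (\<exists>i. k - 1 = 2 * i + 1)" using j by (cases j) auto
  then show ?thesis using integral_std_normal_moment_odd j by auto
next
  case False
  then obtain j where j: "k = 2 * j + 1" by (elim oddE)
  have "Suc k = 2 * Suc j" "k - 1 = 2 * j" using j by auto
  then have "(LBINT x. std_normal_density x * x ^ Suc k) = fact (2 * Suc j) / (2 ^ Suc j * fact (Suc j))"
    "(LBINT x. std_normal_density x * x ^ (k - 1)) = fact (2 * j) / (2 ^ j * fact j)"
    using integral_std_normal_moment_even[of "Suc j"] integral_std_normal_moment_even[of j]
    by (simp_all only:)
  moreover have "fact (2 * Suc j) / (2 ^ Suc j * fact (Suc j)) = real k * (fact (2 * j) / (2 ^ j * fact j) :: real)"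
  proof -
    have "fact (2 * Suc j) = (2 * real (Suc j)) * (real k * fact (2 * j) :: real)"
      unfolding j by (simp add: algebra_simps)
    moreover have "2 ^ Suc j * fact (Suc j) = (2 * real (Suc j)) * (2 ^ j * fact j :: real)"
      by (simp add: algebra_simps)
    ultimately show ?thesis by (simp only: mult_divide_mult_cancel_left_if) simp
  qed
  ultimately show ?thesis by simp
qed

section \<open>Integration by parts for finitely many independent Gaussian variables\<close>

locale iid_gaussian = prob_space +
  fixes X :: "'i \<Rightarrow> 'a \<Rightarrow> real" and I :: "'i set"
  assumes fin: "finite I"
    and indep: "indep_vars (\<lambda>_. borel) X I"
    and distr: "\<And>i. i \<in> I \<Longrightarrow> distributed M lborel (X i) std_normal_density"
begin

lemma moment:
  assumes "i \<in> I"
  shows "integrable M (\<lambda>\<omega>. X i \<omega> ^ k)"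
    and "expectation (\<lambda>\<omega>. X i \<omega> ^ k) = (LBINT x. std_normal_density x * x ^ k)"
  using distributed_integrable[OF distr[OF assms], of "\<lambda>x. x ^ k"]
    distributed_integral[OF distr[OF assms], of "\<lambda>x. x ^ k"] integrable_std_normal_moment[of k]
  by auto

lemma moment_rec:
  assumes "i \<in> I"
  shows "expectation (\<lambda>\<omega>. X i \<omega> ^ Suc k) = real k * expectation (\<lambda>\<omega>. X i \<omega> ^ (k - 1))"
  unfolding moment(2)[OF assms] by (rule std_normal_moment_rec)

lemma prod_moment:
  assumes "J \<subseteq> I"
  shows "integrable M (\<lambda>\<omega>. \<Prod>i\<in>J. X i \<omega> ^ k i)"
    and "expectation (\<lambda>\<omega>. \<Prod>i\<in>J. X i \<omega> ^ k i) = (\<Prod>i\<in>J. expectation (\<lambda>\<omega>. X i \<omega> ^ k i))"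
proof -
  have J: "finite J" using assms fin finite_subset by blast
  have ind: "indep_vars (\<lambda>_. borel) (\<lambda>i \<omega>. X i \<omega> ^ k i) J"
    by (rule indep_vars_compose2[OF indep_vars_subset[OF indep assms], of "\<lambda>i x. x ^ k i"]) auto
  show "integrable M (\<lambda>\<omega>. \<Prod>i\<in>J. X i \<omega> ^ k i)"
    by (rule indep_vars_integrable[OF J ind]) (use assms moment in auto)
  show "expectation (\<lambda>\<omega>. \<Prod>i\<in>J. X i \<omega> ^ k i) = (\<Prod>i\<in>J. expectation (\<lambda>\<omega>. X i \<omega> ^ k i))"
    by (rule indep_vars_lebesgue_integral[OF J ind]) (use assms moment in auto)
qed

lemma integrable_monomial:
  assumes "set l \<subseteq> I"
  shows "integrable M (\<lambda>\<omega>. prod_list (map (\<lambda>i. X i \<omega>) l))"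
proof (cases "I = {}")
  case False
  then obtain e where "e \<in> I" by blast
  then show ?thesis
    unfolding mon_deriv_count(2)[OF fin assms \<open>e \<in> I\<close>] using prod_moment(1)[of I] by simp
qed (use assms in auto)

text \<open>By independence the expectation splits into one-variable moments. Only the factor of
  \<open>e\<close> changes: its exponent drops from \<open>n + 1\<close> to \<open>n - 1\<close> at
  the price of a coefficient \<open>n\<close>, which is \<open>moment_rec\<close>.\<close>

lemma monomial_stein:
  assumes "set l \<subseteq> I" "e \<in> I"
  shows "integrable M (\<lambda>\<omega>. mon_deriv e l (\<lambda>i. X i \<omega>))"
    and "expectation (\<lambda>\<omega>. X e \<omega> * prod_list (map (\<lambda>i. X i \<omega>) l)) = expectation (\<lambda>\<omega>. mon_deriv e l (\<lambda>i. X i \<omega>))"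
proof -
  let ?n = "count_list l"
  let ?k = "\<lambda>i. if i = e then ?n e - 1 else ?n i"
  have I: "I = insert e (I - {e})" using assms by blast
  have I': "(\<Prod>i\<in>I. f i) = f e * (\<Prod>i\<in>I - {e}. f i)" for f :: "'i \<Rightarrow> real"
    using fin assms by (simp add: prod.remove)
  have cong: "(\<Prod>i\<in>I - {e}. f (?k i) i) = (\<Prod>i\<in>I - {e}. f (?n i) i)" for f :: "nat \<Rightarrow> 'i \<Rightarrow> real"
    by (intro prod.cong) auto
  have 1: "mon_deriv e l (\<lambda>i. X i \<omega>) = real (?n e) * (\<Prod>i\<in>I. X i \<omega> ^ ?k i)" for \<omega>
    unfolding I' mon_deriv_count(1)[OF fin assms] using cong[of "\<lambda>n i. X i \<omega> ^ n"] by simp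
  show "integrable M (\<lambda>\<omega>. mon_deriv e l (\<lambda>i. X i \<omega>))"
    unfolding 1 by (intro integrable_mult_right prod_moment) simp
  let ?m = "\<lambda>i. if i = e then Suc (?n e) else ?n i"
  have cong': "(\<Prod>i\<in>I - {e}. f (?m i) i) = (\<Prod>i\<in>I - {e}. f (?n i) i)" for f :: "nat \<Rightarrow> 'i \<Rightarrow> real"
    by (intro prod.cong) auto
  have 2: "X e \<omega> * prod_list (map (\<lambda>i. X i \<omega>) l) = (\<Prod>i\<in>I. X i \<omega> ^ ?m i)" for \<omega>
    unfolding mon_deriv_count(2)[OF fin assms] I' using cong'[of "\<lambda>n i. X i \<omega> ^ n"] by simp
  have "expectation (\<lambda>\<omega>. X e \<omega> * prod_list (map (\<lambda>i. X i \<omega>) l)) = (\<Prod>i\<in>I. expectation (\<lambda>\<omega>. X i \<omega> ^ ?m i))"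
    unfolding 2 by (rule prod_moment) simp
  also have "\<dots> = expectation (\<lambda>\<omega>. X e \<omega> ^ Suc (?n e)) * (\<Prod>i\<in>I - {e}. expectation (\<lambda>\<omega>. X i \<omega> ^ ?n i))"
    unfolding I' using cong'[of "\<lambda>n i. expectation (\<lambda>\<omega>. X i \<omega> ^ n)"] by simp
  also have "\<dots> = real (?n e) * (\<Prod>i\<in>I. expectation (\<lambda>\<omega>. X i \<omega> ^ ?k i))"
    unfolding I' moment_rec[OF assms(2)] using cong[of "\<lambda>n i. expectation (\<lambda>\<omega>. X i \<omega> ^ n)"] by simp
  also have "\<dots> = expectation (\<lambda>\<omega>. mon_deriv e l (\<lambda>i. X i \<omega>))"
    unfolding 1 by (subst prod_moment(2)[symmetric]) auto
  finally show "expectation (\<lambda>\<omega>. X e \<omega> * prod_list (map (\<lambda>i. X i \<omega>) l)) = expectation (\<lambda>\<omega>. mon_deriv e l (\<lambda>i. X i \<omega>))" .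
qed

lemma expectation_sum_list:
  assumes "\<And>p. p \<in> set ps \<Longrightarrow> integrable M (f p)"
  shows "integrable M (\<lambda>\<omega>. \<Sum>p\<leftarrow>ps. f p \<omega>)"
    "expectation (\<lambda>\<omega>. \<Sum>p\<leftarrow>ps. f p \<omega>) = (\<Sum>p\<leftarrow>ps. expectation (f p))"
  using assms by (induction ps) auto

lemma integrable_poly:
  assumes "poly_deriv e I F F'"
  shows "integrable M (\<lambda>\<omega>. F (\<lambda>i. X i \<omega>))"
proof -
  obtain ps where ps: "\<forall>(c, l) \<in> set ps. set l \<subseteq> I"
    "F = (\<lambda>x. \<Sum>(c, l)\<leftarrow>ps. c * prod_list (map x l))"
    using poly_deriv_monomials[OF assms] by metis
  have "integrable M (\<lambda>\<omega>. \<Sum>p\<leftarrow>ps. (case p of (c, l) \<Rightarrow> c * prod_list (map (\<lambda>i. X i \<omega>) l)))"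
    by (rule expectation_sum_list) (use ps(1) in \<open>auto intro!: integrable_monomial\<close>)
  then show ?thesis unfolding ps by simp
qed

theorem stein:
  assumes "poly_deriv e I F F'" "e \<in> I"
  shows "expectation (\<lambda>\<omega>. X e \<omega> * F (\<lambda>i. X i \<omega>)) = expectation (\<lambda>\<omega>. F' (\<lambda>i. X i \<omega>))"
proof -
  obtain ps where ps: "\<forall>(c, l) \<in> set ps. set l \<subseteq> I"
    "F = (\<lambda>x. \<Sum>(c, l)\<leftarrow>ps. c * prod_list (map x l))" "F' = (\<lambda>x. \<Sum>(c, l)\<leftarrow>ps. c * mon_deriv e l x)"
    using poly_deriv_monomials[OF assms(1)] by metis
  have *: "integrable M (\<lambda>\<omega>. X e \<omega> * prod_list (map (\<lambda>i. X i \<omega>) l))" if "set l \<subseteq> I" for l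
    using integrable_monomial[of "e # l"] that assms by simp
  have "expectation (\<lambda>\<omega>. X e \<omega> * F (\<lambda>i. X i \<omega>)) =
    expectation (\<lambda>\<omega>. \<Sum>p\<leftarrow>ps. fst p * (X e \<omega> * prod_list (map (\<lambda>i. X i \<omega>) (snd p))))"
    unfolding ps sum_list_const_mult[symmetric] by (simp add: case_prod_beta mult_ac)
  also have "\<dots> = (\<Sum>p\<leftarrow>ps. expectation (\<lambda>\<omega>. fst p * (X e \<omega> * prod_list (map (\<lambda>i. X i \<omega>) (snd p)))))"
    by (rule expectation_sum_list) (use ps(1) * in auto)
  also have "\<dots> = (\<Sum>p\<leftarrow>ps. expectation (\<lambda>\<omega>. fst p * mon_deriv e (snd p) (\<lambda>i. X i \<omega>)))"
    by (intro arg_cong[where f = sum_list] map_cong) (use ps(1) assms(2) monomial_stein in auto)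
  also have "\<dots> = expectation (\<lambda>\<omega>. \<Sum>p\<leftarrow>ps. fst p * mon_deriv e (snd p) (\<lambda>i. X i \<omega>))"
    by (rule expectation_sum_list(2)[symmetric]) (use ps(1) assms(2) monomial_stein(1) in auto)
  also have "\<dots> = expectation (\<lambda>\<omega>. F' (\<lambda>i. X i \<omega>))"
    unfolding ps(3) case_prod_beta ..
  finally show ?thesis .
qed

end

section \<open>Derivatives of powers of the Gram matrix\<close>

definition mtrace :: "'a::comm_monoid_add mat \<Rightarrow> 'a" where
  "mtrace A = (\<Sum>i<dim_row A. A $$ (i, i))"

lemma index_mult_sum:
  assumes "A \<in> carrier_mat n k" "B \<in> carrier_mat k m" "i < n" "j < m"
  shows "(A * B) $$ (i, j) = (\<Sum>l<k. A $$ (i, l) * B $$ (l, j))"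
  using assms by (simp add: scalar_prod_def lessThan_atLeast0)

lemma mtrace_comm:
  fixes A B :: "'a::comm_semiring_1 mat"
  assumes A: "A \<in> carrier_mat n m" and B: "B \<in> carrier_mat m n"
  shows "mtrace (A * B) = mtrace (B * A)"
proof -
  have "mtrace (A * B) = (\<Sum>i<n. \<Sum>l<m. A $$ (i, l) * B $$ (l, i))"
    unfolding mtrace_def using A index_mult_sum[OF A B] by (intro sum.cong) auto
  also have "\<dots> = (\<Sum>l<m. \<Sum>i<n. B $$ (l, i) * A $$ (i, l))"
    by (subst sum.swap) (simp add: mult.commute)
  also have "\<dots> = mtrace (B * A)"
    unfolding mtrace_def using B index_mult_sum[OF B A] by (intro sum.cong) auto
  finally show ?thesis .
qed

lemma mtrace_add:
  "A \<in> carrier_mat n n \<Longrightarrow> B \<in> carrier_mat n n \<Longrightarrow> mtrace (A + B) = mtrace A + mtrace B"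
  unfolding mtrace_def by (simp add: sum.distrib)

lemma mtrace_one: "mtrace (1\<^sub>m n) = of_nat n"
  unfolding mtrace_def by simp

lemma pow_mat_add:
  assumes A: "A \<in> carrier_mat n n"
  shows "A ^\<^sub>m (j + k) = A ^\<^sub>m j * A ^\<^sub>m k"
proof (induction k)
  case 0
  show ?case using A by simp
next
  case (Suc k)
  then show ?case
    using assoc_mult_mat[OF pow_carrier_mat[OF A, of j] pow_carrier_mat[OF A, of k] A] by (simp only: pow_mat.simps add_Suc_right)
qed

lemma pow_mat_Suc_left:
  assumes A: "A \<in> carrier_mat n n"
  shows "A ^\<^sub>m Suc k = A * A ^\<^sub>m k"
  using pow_mat_add[OF A, of 1 k] A by simp

lemma transpose_pow_mat:
  fixes A :: "'a::comm_semiring_1 mat"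
  assumes A: "A \<in> carrier_mat n n"
  shows "transpose_mat (A ^\<^sub>m k) = transpose_mat A ^\<^sub>m k"
proof (induction k)
  case 0
  show ?case using A by simp
next
  case (Suc k)
  have At: "transpose_mat A \<in> carrier_mat n n" using A by simp
  show ?case
    unfolding pow_mat_Suc_left[OF At] using transpose_mult[OF pow_carrier_mat[OF A, of k] A] Suc by simp
qed

section \<open>Formal derivatives of matrix products and powers\<close>

definition mat_deriv ::
    "'i \<Rightarrow> 'i set \<Rightarrow> nat \<Rightarrow> nat \<Rightarrow> (('i \<Rightarrow> real) \<Rightarrow> real mat) \<Rightarrow> (('i \<Rightarrow> real) \<Rightarrow> real mat) \<Rightarrow> bool" where
  "mat_deriv e I n m F D \<longleftrightarrow> (\<forall>x. F x \<in> carrier_mat n m \<and> D x \<in> carrier_mat n m) \<and>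
     (\<forall>k<n. \<forall>l<m. poly_deriv e I (\<lambda>x. F x $$ (k, l)) (\<lambda>x. D x $$ (k, l)))"

lemma mat_deriv_mult:
  assumes "mat_deriv e I n k F D" "mat_deriv e I k m H K"
  shows "mat_deriv e I n m (\<lambda>x. F x * H x) (\<lambda>x. D x * H x + F x * K x)"
  unfolding mat_deriv_def
proof (intro conjI allI impI)
  fix i j assume ij: "i < n" "j < m"
  have c: "F x \<in> carrier_mat n k" "D x \<in> carrier_mat n k" "H x \<in> carrier_mat k m" "K x \<in> carrier_mat k m" for x
    using assms by (auto simp: mat_deriv_def)
  have 1: "(F x * H x) $$ (i, j) = (\<Sum>l<k. F x $$ (i, l) * H x $$ (l, j))" for x
    by (rule index_mult_sum[OF c(1,3) ij])
  have 2: "(D x * H x + F x * K x) $$ (i, j) =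
      (\<Sum>l<k. D x $$ (i, l) * H x $$ (l, j) + F x $$ (i, l) * K x $$ (l, j))" for x
    using c[of x] ij by (simp add: index_mult_sum[of _ n k _ m] sum.distrib del: index_mult_mat(1))
  show "poly_deriv e I (\<lambda>x. (F x * H x) $$ (i, j)) (\<lambda>x. (D x * H x + F x * K x) $$ (i, j))"
    unfolding 1 2
    by (intro poly_deriv_sum poly_deriv.mult) (use assms ij in \<open>auto simp: mat_deriv_def\<close>)
qed (use assms in \<open>auto simp: mat_deriv_def intro!: mult_carrier_mat add_carrier_mat\<close>)

lemma mat_deriv_transpose:
  assumes "mat_deriv e I n m F D"
  shows "mat_deriv e I m n (\<lambda>x. transpose_mat (F x)) (\<lambda>x. transpose_mat (D x))"
proof -
  have c: "F x \<in> carrier_mat n m" "D x \<in> carrier_mat n m" for x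
    using assms by (simp_all add: mat_deriv_def)
  have "transpose_mat (F x) $$ (k, l) = F x $$ (l, k)" "transpose_mat (D x) $$ (k, l) = D x $$ (l, k)"
    if "k < m" "l < n" for x k l
    using that c[of x] by simp_all
  then show ?thesis
    using assms c by (simp add: mat_deriv_def)
qed

text \<open>The product rule along \<open>A ^\<^sub>m Suc q = A ^\<^sub>m q * A\<close>, with
  \<open>D\<close> the derivative of \<open>A\<close>. As \<open>A\<close> and \<open>D\<close> need
  not commute, this is a sum of \<open>q\<close> words with one letter \<open>D\<close> each, not
  \<open>q\<close> times one word.\<close>

fun pow_mat_deriv :: "real mat \<Rightarrow> real mat \<Rightarrow> nat \<Rightarrow> real mat" where
  "pow_mat_deriv A D 0 = 0\<^sub>m (dim_row A) (dim_row A)"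
| "pow_mat_deriv A D (Suc q) = pow_mat_deriv A D q * A + A ^\<^sub>m q * D"

lemma pow_mat_deriv_carrier:
  "A \<in> carrier_mat n n \<Longrightarrow> D \<in> carrier_mat n n \<Longrightarrow> pow_mat_deriv A D q \<in> carrier_mat n n"
  by (induction q) (auto intro!: mult_carrier_mat add_carrier_mat)

lemma mat_deriv_pow:
  assumes "mat_deriv e I n n F D"
  shows "mat_deriv e I n n (\<lambda>x. F x ^\<^sub>m q) (\<lambda>x. pow_mat_deriv (F x) (D x) q)"
proof (induction q)
  case 0
  have [simp]: "dim_row (F x) = n" for x using assms by (auto simp: mat_deriv_def)
  show ?case unfolding mat_deriv_def by (auto intro: poly_deriv.const)
next
  case (Suc q)
  show ?case using mat_deriv_mult[OF Suc assms] by simp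
qed

text \<open>Cyclicity of the trace rotates each of the \<open>q\<close> words to \<open>D\<close>
  times a power of \<open>A\<close>. The extra factor \<open>A ^\<^sub>m r\<close> is there for the
  induction: one step of \<open>pow_mat_deriv\<close> leaves an \<open>A\<close> on the
  right.\<close>

lemma mtrace_pow_mat_deriv:
  assumes A: "A \<in> carrier_mat n n" and D: "D \<in> carrier_mat n n"
  shows "mtrace (pow_mat_deriv A D q * A ^\<^sub>m r) = real q * mtrace (D * A ^\<^sub>m (q + r - 1))"
proof (induction q arbitrary: r)
  case 0
  show ?case using A by (simp add: mtrace_def)
next
  case (Suc q)
  let ?P = "pow_mat_deriv A D q"
  have P: "?P \<in> carrier_mat n n" and pw: "A ^\<^sub>m k \<in> carrier_mat n n" for k
    using pow_mat_deriv_carrier[OF A D] pow_carrier_mat[OF A] by auto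
  have "(?P * A + A ^\<^sub>m q * D) * A ^\<^sub>m r = ?P * A * A ^\<^sub>m r + A ^\<^sub>m q * D * A ^\<^sub>m r"
    by (rule add_mult_distrib_mat[OF mult_carrier_mat[OF P A] mult_carrier_mat[OF pw D] pw])
  also have "?P * A * A ^\<^sub>m r = ?P * A ^\<^sub>m Suc r"
    unfolding pow_mat_Suc_left[OF A] by (rule assoc_mult_mat[OF P A pw])
  also have "A ^\<^sub>m q * D * A ^\<^sub>m r = A ^\<^sub>m q * (D * A ^\<^sub>m r)"
    by (rule assoc_mult_mat[OF pw D pw])
  finally have "mtrace (pow_mat_deriv A D (Suc q) * A ^\<^sub>m r) =
      mtrace (?P * A ^\<^sub>m Suc r + A ^\<^sub>m q * (D * A ^\<^sub>m r))" by simp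
  also have "\<dots> = mtrace (?P * A ^\<^sub>m Suc r) + mtrace (A ^\<^sub>m q * (D * A ^\<^sub>m r))"
    by (rule mtrace_add[OF mult_carrier_mat[OF P pw] mult_carrier_mat[OF pw mult_carrier_mat[OF D pw]]])
  also have "mtrace (A ^\<^sub>m q * (D * A ^\<^sub>m r)) = mtrace (D * A ^\<^sub>m r * A ^\<^sub>m q)"
    by (rule mtrace_comm[OF pw mult_carrier_mat[OF D pw]])
  also have "D * A ^\<^sub>m r * A ^\<^sub>m q = D * A ^\<^sub>m (q + r)"
    unfolding assoc_mult_mat[OF D pw pw] pow_mat_add[OF A, symmetric] by (simp add: add.commute)
  finally show ?case unfolding Suc.IH by (simp add: algebra_simps del: pow_mat.simps)
qed

section \<open>The Gram matrix as a function of the entries\<close>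

context
  fixes n m :: nat
begin

abbreviation entry_matrix :: "(nat \<times> nat \<Rightarrow> real) \<Rightarrow> real mat" where "entry_matrix x \<equiv> mat n m x"
abbreviation index_set :: "(nat \<times> nat) set" where "index_set \<equiv> {..<n} \<times> {..<m}"
abbreviation unit_matrix :: "nat \<times> nat \<Rightarrow> real mat" where "unit_matrix e \<equiv> mat n m (\<lambda>i. if i = e then 1 else 0)"
definition gram :: "(nat \<times> nat \<Rightarrow> real) \<Rightarrow> real mat" where "gram x = entry_matrix x * transpose_mat (entry_matrix x)"
definition gram_deriv :: "nat \<times> nat \<Rightarrow> (nat \<times> nat \<Rightarrow> real) \<Rightarrow> real mat" where
  "gram_deriv e x = unit_matrix e * transpose_mat (entry_matrix x) + entry_matrix x * transpose_mat (unit_matrix e)"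

lemma gram_carrier [simp]: "gram x \<in> carrier_mat n n" "gram_deriv e x \<in> carrier_mat n n"
  unfolding gram_def gram_deriv_def by (auto intro!: mult_carrier_mat add_carrier_mat)

lemma gram_dim [simp]: "dim_row (gram x) = n" "dim_col (gram x) = n"
  using gram_carrier(1)[of x] by blast+

lemma gram_pow_carrier [simp]: "gram x ^\<^sub>m q \<in> carrier_mat n n" "pow_mat_deriv (gram x) (gram_deriv e x) q \<in> carrier_mat n n"
  by (intro pow_carrier_mat pow_mat_deriv_carrier gram_carrier)+

lemma mat_deriv_entry_matrix: "mat_deriv e index_set n m entry_matrix (\<lambda>_. unit_matrix e)"
  unfolding mat_deriv_def using poly_deriv.var[of _ index_set e] by auto

lemma mat_deriv_gram: "mat_deriv e index_set n n gram (gram_deriv e)"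
  using mat_deriv_mult[OF mat_deriv_entry_matrix mat_deriv_transpose[OF mat_deriv_entry_matrix]]
  unfolding gram_def[abs_def] gram_deriv_def[abs_def] .

lemma mat_deriv_gram_pow:
  "mat_deriv e index_set n n (\<lambda>x. gram x ^\<^sub>m q) (\<lambda>x. pow_mat_deriv (gram x) (gram_deriv e x) q)"
  by (rule mat_deriv_pow[OF mat_deriv_gram])

definition gram_trace :: "nat \<Rightarrow> (nat \<times> nat \<Rightarrow> real) \<Rightarrow> real" where "gram_trace q x = mtrace (gram x ^\<^sub>m q)"
text \<open>Writing \<open>W\<close> for the Gram matrix, \<open>W^q G\<close> is, up to the factor
  \<open>2 (q + 1)\<close>, the gradient of \<open>gram_trace (q + 1)\<close>. It is also the vector
  field whose divergence drives the loop equation.\<close>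

definition gram_pow_mult :: "nat \<Rightarrow> (nat \<times> nat \<Rightarrow> real) \<Rightarrow> real mat" where "gram_pow_mult q x = gram x ^\<^sub>m q * entry_matrix x"

lemma gram_pow_mult_carrier [simp]: "gram_pow_mult q x \<in> carrier_mat n m"
  unfolding gram_pow_mult_def by (auto intro!: mult_carrier_mat[of _ n n])

lemma gram_pow_mult_dim [simp]: "dim_row (gram_pow_mult q x) = n" "dim_col (gram_pow_mult q x) = m"
  using gram_pow_mult_carrier[of q x] by blast+

lemma gram_pow_mult_0: "gram_pow_mult 0 x = entry_matrix x"
  unfolding gram_pow_mult_def using left_mult_one_mat[of "entry_matrix x" n m] by simp

lemma transpose_gram: "transpose_mat (gram x) = gram x"
  unfolding gram_def by (simp add: transpose_mult[of _ n m _ n])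

lemma gram_trace_0: "gram_trace 0 x = real n"
  unfolding gram_trace_def gram_def by (simp add: mtrace_one)

lemma mult_unit_matrix_mult:
  assumes "A \<in> carrier_mat k n" "C \<in> carrier_mat m l" "i < n" "j < m" "a < k" "b < l"
  shows "(A * unit_matrix (i, j) * C) $$ (a, b) = A $$ (a, i) * C $$ (j, b)"
proof -
  have "(A * unit_matrix (i, j)) $$ (a, q) = (if q = j then A $$ (a, i) else 0)" if "q < m" for q
  proof -
    have "(A * unit_matrix (i, j)) $$ (a, q) = (\<Sum>p<n. if p = i then (if q = j then A $$ (a, i) else 0) else 0)"
      unfolding index_mult_sum[OF assms(1) mat_carrier assms(5) that]
      using that by (intro sum.cong) auto
    then show ?thesis using assms(3) by simp
  qed
  then have "(A * unit_matrix (i, j) * C) $$ (a, b) = (\<Sum>q<m. if q = j then A $$ (a, i) * C $$ (j, b) else 0)"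
    unfolding index_mult_sum[OF mult_carrier_mat[OF assms(1) mat_carrier] assms(2,5,6)]
    by (intro sum.cong) auto
  then show ?thesis using assms(4) by simp
qed

lemma mult_unit_matrix_transpose_mult:
  assumes "A \<in> carrier_mat k m" "C \<in> carrier_mat n l" "i < n" "j < m" "a < k" "b < l"
  shows "(A * transpose_mat (unit_matrix (i, j)) * C) $$ (a, b) = A $$ (a, j) * C $$ (i, b)"
proof -
  let ?E = "unit_matrix (i, j)"
  have E: "?E \<in> carrier_mat n m" and Et: "transpose_mat ?E \<in> carrier_mat m n"
    and At: "transpose_mat A \<in> carrier_mat m k" and Ct: "transpose_mat C \<in> carrier_mat l n"
    using assms by simp_all
  have "A * transpose_mat ?E * C = A * (transpose_mat ?E * C)"
    by (rule assoc_mult_mat[OF assms(1) Et assms(2)])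
  also have "\<dots> = transpose_mat (transpose_mat C * ?E * transpose_mat A)"
    using transpose_mult[OF mult_carrier_mat[OF Ct E] At] transpose_mult[OF Ct E]
    by simp
  finally have "A * transpose_mat ?E * C = transpose_mat (transpose_mat C * ?E * transpose_mat A)" .
  then show ?thesis
    using mult_unit_matrix_mult[of "transpose_mat C" l "transpose_mat A" k i j b a] assms by simp
qed

text \<open>The left side is the trace of \<open>W^a G\<close> times the transpose of
  \<open>W^b G\<close>. For \<open>a = 0\<close> it writes a trace as a sum of entries times
  polynomials, as integration by parts requires; for general \<open>a\<close> it evaluates the
  derivatives of the remaining traces.\<close>

lemma mtrace_gram_pow_mult_gram_pow_mult: "(\<Sum>(i, j)\<in>index_set. gram_pow_mult a x $$ (i, j) * gram_pow_mult b x $$ (i, j)) = gram_trace (a + b + 1) x"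
proof -
  let ?G = "entry_matrix x" and ?A = "gram x ^\<^sub>m a" and ?B = "gram x ^\<^sub>m b"
  have G: "?G \<in> carrier_mat n m" "transpose_mat ?G \<in> carrier_mat m n" by simp_all
  have A: "?A \<in> carrier_mat n n" and B: "?B \<in> carrier_mat n n" by simp_all
  have "transpose_mat (gram_pow_mult b x) = transpose_mat ?G * ?B"
    unfolding gram_pow_mult_def transpose_mult[OF B G(1)] transpose_pow_mat[OF gram_carrier(1)] transpose_gram ..
  then have "gram_pow_mult a x * transpose_mat (gram_pow_mult b x) = ?A * (?G * (transpose_mat ?G * ?B))"
    unfolding gram_pow_mult_def by (simp only: assoc_mult_mat[OF A G(1) mult_carrier_mat[OF G(2) B]])
  also have "?G * (transpose_mat ?G * ?B) = gram x * ?B"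
    unfolding gram_def using assoc_mult_mat[OF G B[unfolded gram_def]] by (rule sym)
  also have "gram x * ?B = gram x ^\<^sub>m Suc b"
    by (rule pow_mat_Suc_left[OF gram_carrier(1), symmetric])
  also have "?A * gram x ^\<^sub>m Suc b = gram x ^\<^sub>m (a + b + 1)"
    by (simp only: pow_mat_add[OF gram_carrier(1), symmetric]) simp
  finally have "gram_trace (a + b + 1) x = mtrace (gram_pow_mult a x * transpose_mat (gram_pow_mult b x))"
    unfolding gram_trace_def by simp
  also have "mtrace (gram_pow_mult a x * transpose_mat (gram_pow_mult b x)) = (\<Sum>i<n. \<Sum>j<m. gram_pow_mult a x $$ (i, j) * gram_pow_mult b x $$ (i, j))"
    unfolding mtrace_def
    using index_mult_sum[OF gram_pow_mult_carrier[of a x] transpose_carrier_mat[THEN iffD2, OF gram_pow_mult_carrier[of b x]]]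
    by (simp del: index_mult_mat(1))
  finally show ?thesis by (simp add: sum.cartesian_product)
qed


text \<open>The two summands of \<open>gram_deriv\<close> contribute equally because the Gram matrix
  is symmetric, hence the factor 2.\<close>

lemma mtrace_gram_deriv:
  assumes "i < n" "j < m"
  shows "mtrace (gram_deriv (i, j) x * gram x ^\<^sub>m p) = 2 * gram_pow_mult p x $$ (i, j)"
proof -
  let ?E = "unit_matrix (i, j)" and ?G = "entry_matrix x" and ?T = "gram x ^\<^sub>m p"
  have E: "?E \<in> carrier_mat n m" "transpose_mat ?E \<in> carrier_mat m n"
    and G: "?G \<in> carrier_mat n m" "transpose_mat ?G \<in> carrier_mat m n"
    and T: "?T \<in> carrier_mat n n" by simp_all
  have B: "gram_pow_mult p x \<in> carrier_mat n m" and Bt: "transpose_mat (gram_pow_mult p x) \<in> carrier_mat m n" by simp_all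
  have Bt': "transpose_mat (gram_pow_mult p x) = transpose_mat ?G * ?T"
    unfolding gram_pow_mult_def transpose_mult[OF T G(1)] transpose_pow_mat[OF gram_carrier(1)] transpose_gram ..
  have "gram_deriv (i, j) x * ?T = ?E * transpose_mat ?G * ?T + ?G * transpose_mat ?E * ?T"
    unfolding gram_deriv_def
    by (rule add_mult_distrib_mat[OF mult_carrier_mat[OF E(1) G(2)] mult_carrier_mat[OF G(1) E(2)] T])
  also have "?E * transpose_mat ?G * ?T = ?E * transpose_mat (gram_pow_mult p x)"
    unfolding Bt' by (rule assoc_mult_mat[OF E(1) G(2) T])
  also have "?G * transpose_mat ?E * ?T = ?G * (transpose_mat ?E * ?T)"
    by (rule assoc_mult_mat[OF G(1) E(2) T])
  also have "mtrace (?E * transpose_mat (gram_pow_mult p x) + ?G * (transpose_mat ?E * ?T)) =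
      mtrace (?E * transpose_mat (gram_pow_mult p x)) + mtrace (?G * (transpose_mat ?E * ?T))"
    by (rule mtrace_add[OF mult_carrier_mat[OF E(1) Bt] mult_carrier_mat[OF G(1) mult_carrier_mat[OF E(2) T]]])
  also have "mtrace (?G * (transpose_mat ?E * ?T)) = mtrace (transpose_mat ?E * gram_pow_mult p x)"
    unfolding gram_pow_mult_def mtrace_comm[OF G(1) mult_carrier_mat[OF E(2) T]] assoc_mult_mat[OF E(2) T G(1)] ..
  also have "\<dots> = (\<Sum>a<m. if a = j then gram_pow_mult p x $$ (i, j) else 0)"
    unfolding mtrace_def
  proof (rule sum.cong)
    fix a assume "a \<in> {..<m}"
    then show "(transpose_mat ?E * gram_pow_mult p x) $$ (a, a) = (if a = j then gram_pow_mult p x $$ (i, j) else 0)"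
      using mult_unit_matrix_transpose_mult[of "1\<^sub>m m" m "gram_pow_mult p x" m i j a a] assms E
      by (simp del: index_mult_mat(1) index_transpose_mat(1))
  qed simp
  also have "\<dots> = gram_pow_mult p x $$ (i, j)" using assms by simp
  also have "mtrace (?E * transpose_mat (gram_pow_mult p x)) = (\<Sum>a<n. if a = i then gram_pow_mult p x $$ (i, j) else 0)"
    unfolding mtrace_def
  proof (rule sum.cong)
    fix a assume a: "a \<in> {..<n}"
    have "(?E * transpose_mat (gram_pow_mult p x)) $$ (a, a) = 1\<^sub>m n $$ (a, i) * transpose_mat (gram_pow_mult p x) $$ (j, a)"
      using mult_unit_matrix_mult[of "1\<^sub>m n" n "transpose_mat (gram_pow_mult p x)" n i j a a] assms E a
      by (simp del: index_mult_mat(1) index_transpose_mat(1) index_one_mat(1))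
    then show "(?E * transpose_mat (gram_pow_mult p x)) $$ (a, a) = (if a = i then gram_pow_mult p x $$ (i, j) else 0)"
      using assms a by (simp del: index_mult_mat(1))
  qed simp
  also have "\<dots> = gram_pow_mult p x $$ (i, j)" using assms by simp
  finally show ?thesis by simp
qed

lemma poly_deriv_gram_trace:
  assumes "i < n" "j < m"
  shows "poly_deriv (i, j) index_set (gram_trace q) (\<lambda>x. 2 * real q * gram_pow_mult (q - 1) x $$ (i, j))"
proof -
  have "mtrace (pow_mat_deriv (gram x) (gram_deriv (i, j) x) q) = 2 * real q * gram_pow_mult (q - 1) x $$ (i, j)" for x
    using mtrace_pow_mat_deriv[OF gram_carrier, of x "(i, j)" x q 0]
      right_mult_one_mat[OF gram_pow_carrier(2), of x "(i, j)" q] mtrace_gram_deriv[OF assms]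
      carrier_matD(1)[OF gram_carrier(1)]
    by simp
  moreover have "mtrace (pow_mat_deriv (gram x) (gram_deriv (i, j) x) q) =
      (\<Sum>k<n. pow_mat_deriv (gram x) (gram_deriv (i, j) x) q $$ (k, k))" for x
    unfolding mtrace_def using carrier_matD(1)[OF gram_pow_carrier(2)] by simp
  moreover have "gram_trace q = (\<lambda>x. \<Sum>k<n. (gram x ^\<^sub>m q) $$ (k, k))"
    unfolding gram_trace_def[abs_def] mtrace_def using carrier_matD(1)[OF gram_pow_carrier(1)] by simp
  moreover have "poly_deriv (i, j) index_set (\<lambda>x. \<Sum>k<n. (gram x ^\<^sub>m q) $$ (k, k))
      (\<lambda>x. \<Sum>k<n. pow_mat_deriv (gram x) (gram_deriv (i, j) x) q $$ (k, k))"
    using mat_deriv_gram_pow[of "(i, j)" q] by (intro poly_deriv_sum) (auto simp: mat_deriv_def)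
  ultimately show ?thesis by simp
qed

lemma poly_deriv_gram_pow_mult:
  assumes "i < n" "j < m"
  shows "poly_deriv e index_set (\<lambda>x. gram_pow_mult q x $$ (i, j))
    (\<lambda>x. (pow_mat_deriv (gram x) (gram_deriv e x) q * entry_matrix x + gram x ^\<^sub>m q * unit_matrix e) $$ (i, j))"
  using mat_deriv_mult[OF mat_deriv_gram_pow mat_deriv_entry_matrix, of e q] assms
  unfolding mat_deriv_def gram_pow_mult_def by blast

lemma gram_mult_gram_pow_mult: "gram x * gram_pow_mult r x = gram_pow_mult (Suc r) x"
  unfolding gram_pow_mult_def pow_mat_Suc_left[OF gram_carrier(1)]
  using assoc_mult_mat[OF gram_carrier(1) gram_pow_carrier(1)[of x r] mat_carrier] by simp

lemma mtrace_entry_matrix_gram_pow_mult: "mtrace (transpose_mat (entry_matrix x) * gram_pow_mult r x) = gram_trace (Suc r) x"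
proof -
  have "mtrace (transpose_mat (entry_matrix x) * gram_pow_mult r x) = mtrace (gram_pow_mult r x * transpose_mat (entry_matrix x))"
    by (rule mtrace_comm[of _ m n]) simp_all
  also have "gram_pow_mult r x * transpose_mat (entry_matrix x) = gram x ^\<^sub>m r * (entry_matrix x * transpose_mat (entry_matrix x))"
    unfolding gram_pow_mult_def by (rule assoc_mult_mat[of _ n n _ m _ n]) simp_all
  finally show ?thesis by (simp add: gram_trace_def gram_def)
qed

text \<open>The summand \<open>E G^T\<close> of \<open>gram_deriv\<close> separates \<open>i\<close>
  from \<open>j\<close> and sums over all entries to a product of two traces, the leading
  contribution. The summand \<open>G E^T\<close> sums to a single trace and is of lower
  order.\<close>

lemma gram_deriv_sandwich:
  assumes "i < n" "j < m"
  shows "(gram x ^\<^sub>m q * gram_deriv (i, j) x * gram_pow_mult r x) $$ (i, j) =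
    (gram x ^\<^sub>m q) $$ (i, i) * (transpose_mat (entry_matrix x) * gram_pow_mult r x) $$ (j, j) + gram_pow_mult q x $$ (i, j) * gram_pow_mult r x $$ (i, j)"
proof -
  let ?E = "unit_matrix (i, j)" and ?G = "entry_matrix x" and ?T = "gram x ^\<^sub>m q" and ?B = "gram_pow_mult r x"
  have E: "?E \<in> carrier_mat n m" "transpose_mat ?E \<in> carrier_mat m n"
    and G: "?G \<in> carrier_mat n m" "transpose_mat ?G \<in> carrier_mat m n"
    and T: "?T \<in> carrier_mat n n" and B: "?B \<in> carrier_mat n m" by simp_all
  note EG = mult_carrier_mat[OF E(1) G(2)] and GE = mult_carrier_mat[OF G(1) E(2)]
  have "?T * gram_deriv (i, j) x * ?B = ?T * (?E * transpose_mat ?G) * ?B + ?T * (?G * transpose_mat ?E) * ?B"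
    unfolding gram_deriv_def mult_add_distrib_mat[OF T EG GE]
    by (rule add_mult_distrib_mat[OF mult_carrier_mat[OF T EG] mult_carrier_mat[OF T GE] B])
  also have "?T * (?E * transpose_mat ?G) * ?B = ?T * ?E * (transpose_mat ?G * ?B)"
    unfolding assoc_mult_mat[OF T E(1) G(2), symmetric] by (rule assoc_mult_mat[OF mult_carrier_mat[OF T E(1)] G(2) B])
  also have "?T * (?G * transpose_mat ?E) * ?B = gram_pow_mult q x * transpose_mat ?E * ?B"
    unfolding assoc_mult_mat[OF T G(1) E(2), symmetric] gram_pow_mult_def ..
  also have "(?T * ?E * (transpose_mat ?G * ?B) + gram_pow_mult q x * transpose_mat ?E * ?B) $$ (i, j) =
     (?T * ?E * (transpose_mat ?G * ?B)) $$ (i, j) + (gram_pow_mult q x * transpose_mat ?E * ?B) $$ (i, j)"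
    using assms by (intro index_add_mat(1)) simp_all
  also have "(?T * ?E * (transpose_mat ?G * ?B)) $$ (i, j) = ?T $$ (i, i) * (transpose_mat ?G * ?B) $$ (j, j)"
    by (rule mult_unit_matrix_mult[OF T mult_carrier_mat[OF G(2) B] assms assms])
  also have "(gram_pow_mult q x * transpose_mat ?E * ?B) $$ (i, j) = gram_pow_mult q x $$ (i, j) * ?B $$ (i, j)"
    by (rule mult_unit_matrix_transpose_mult[OF gram_pow_mult_carrier B assms assms])
  finally show ?thesis .
qed

text \<open>Generalised over \<open>r\<close> because the product rule moves one Gram factor out of
  the power into \<open>gram_pow_mult\<close>. On the right the last term stands inside the sum and
  so counts \<open>q\<close> times.\<close>

lemma divergence_pow:
  "(\<Sum>(i, j)\<in>index_set. (pow_mat_deriv (gram x) (gram_deriv (i, j) x) q * gram_pow_mult r x) $$ (i, j)) =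
    (\<Sum>a<q. gram_trace a x * gram_trace (q + r - a) x + gram_trace (q + r) x)"
proof (induction q arbitrary: r)
  case 0
  have "(0\<^sub>m n n * gram_pow_mult r x) $$ (i, j) = 0" if "i < n" "j < m" for i j
    using that left_mult_zero_mat[OF gram_pow_mult_carrier, of n r x] by simp
  then show ?case using carrier_matD(1)[OF gram_carrier(1)] by (auto intro!: sum.neutral simp del: index_mult_mat(1))
next
  case (Suc q)
  have entry: "(pow_mat_deriv (gram x) (gram_deriv (i, j) x) (Suc q) * gram_pow_mult r x) $$ (i, j) =
      (pow_mat_deriv (gram x) (gram_deriv (i, j) x) q * gram_pow_mult (Suc r) x) $$ (i, j) +
      ((gram x ^\<^sub>m q) $$ (i, i) * (transpose_mat (entry_matrix x) * gram_pow_mult r x) $$ (j, j) + gram_pow_mult q x $$ (i, j) * gram_pow_mult r x $$ (i, j))"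
    if ij: "i < n" "j < m" for i j
  proof -
    let ?P = "pow_mat_deriv (gram x) (gram_deriv (i, j) x) q"
    have P: "?P \<in> carrier_mat n n" and T: "gram x ^\<^sub>m q \<in> carrier_mat n n" by simp_all
    have "(?P * gram x + gram x ^\<^sub>m q * gram_deriv (i, j) x) * gram_pow_mult r x = ?P * gram x * gram_pow_mult r x + gram x ^\<^sub>m q * gram_deriv (i, j) x * gram_pow_mult r x"
      by (rule add_mult_distrib_mat[OF mult_carrier_mat[OF P gram_carrier(1)] mult_carrier_mat[OF T gram_carrier(2)] gram_pow_mult_carrier])
    also have "?P * gram x * gram_pow_mult r x = ?P * gram_pow_mult (Suc r) x"
      unfolding gram_mult_gram_pow_mult[symmetric] by (rule assoc_mult_mat[OF P gram_carrier(1) gram_pow_mult_carrier])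
    finally have *: "pow_mat_deriv (gram x) (gram_deriv (i, j) x) (Suc q) * gram_pow_mult r x = ?P * gram_pow_mult (Suc r) x + gram x ^\<^sub>m q * gram_deriv (i, j) x * gram_pow_mult r x"
      by simp
    show ?thesis
      unfolding * gram_deriv_sandwich[OF ij, symmetric] using ij
      by (intro index_add_mat(1)) simp_all
  qed
  have "(\<Sum>(i, j)\<in>index_set. (pow_mat_deriv (gram x) (gram_deriv (i, j) x) (Suc q) * gram_pow_mult r x) $$ (i, j)) =
      (\<Sum>(i, j)\<in>index_set. (pow_mat_deriv (gram x) (gram_deriv (i, j) x) q * gram_pow_mult (Suc r) x) $$ (i, j)) +
      (\<Sum>(i, j)\<in>index_set. (gram x ^\<^sub>m q) $$ (i, i) * (transpose_mat (entry_matrix x) * gram_pow_mult r x) $$ (j, j)) +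
      (\<Sum>(i, j)\<in>index_set. gram_pow_mult q x $$ (i, j) * gram_pow_mult r x $$ (i, j))"
    unfolding sum.distrib[symmetric] by (intro sum.cong) (use entry in \<open>auto simp del: pow_mat_deriv.simps index_mult_mat(1)\<close>)
  also have "(\<Sum>(i, j)\<in>index_set. (gram x ^\<^sub>m q) $$ (i, i) * (transpose_mat (entry_matrix x) * gram_pow_mult r x) $$ (j, j)) =
      gram_trace q x * mtrace (transpose_mat (entry_matrix x) * gram_pow_mult r x)"
    unfolding gram_trace_def mtrace_def sum.cartesian_product[symmetric] sum_product
    using carrier_matD(1)[OF gram_pow_carrier(1)] by (simp del: index_mult_mat(1))
  finally show ?case
    unfolding Suc.IH mtrace_gram_pow_mult_gram_pow_mult mtrace_entry_matrix_gram_pow_mult by simp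
qed

text \<open>Case \<open>r = 0\<close> of \<open>divergence_pow\<close> plus the derivative of the
  last factor \<open>G\<close>, which is a diagonal entry of \<open>W^q\<close> independent of
  \<open>j\<close> and therefore yields the factor \<open>m\<close>. The summand
  \<open>a = 0\<close> contributes \<open>n\<close> times a trace and becomes the term
  \<open>s \<mu>_0 \<mu>_q\<close> of the limit.\<close>

lemma divergence_gram_pow_mult:
  "(\<Sum>(i, j)\<in>index_set. (pow_mat_deriv (gram x) (gram_deriv (i, j) x) q * entry_matrix x + gram x ^\<^sub>m q * unit_matrix (i, j)) $$ (i, j)) =
    (real m + real q) * gram_trace q x + (\<Sum>a<q. gram_trace a x * gram_trace (q - a) x)"
proof -
  have entry: "(pow_mat_deriv (gram x) (gram_deriv (i, j) x) q * entry_matrix x + gram x ^\<^sub>m q * unit_matrix (i, j)) $$ (i, j) =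
      (pow_mat_deriv (gram x) (gram_deriv (i, j) x) q * gram_pow_mult 0 x) $$ (i, j) + (gram x ^\<^sub>m q) $$ (i, i)"
    if ij: "i < n" "j < m" for i j
  proof -
    have "(gram x ^\<^sub>m q * unit_matrix (i, j)) $$ (i, j) = (gram x ^\<^sub>m q) $$ (i, i)"
      using mult_unit_matrix_mult[OF gram_pow_carrier(1) one_carrier_mat, of i j i j x q] ij
        right_mult_one_mat[OF mult_carrier_mat[OF gram_pow_carrier(1) mat_carrier]]
      by (simp del: index_mult_mat(1))
    then show ?thesis using ij
      by (subst index_add_mat(1)) (simp_all del: index_mult_mat(1) add: gram_pow_mult_0)
  qed
  have "(\<Sum>(i, j)\<in>index_set. (gram x ^\<^sub>m q) $$ (i, i)) = real m * gram_trace q x"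
    unfolding gram_trace_def mtrace_def sum.cartesian_product[symmetric]
    using carrier_matD(1)[OF gram_pow_carrier(1)] by (simp add: sum_distrib_left)
  moreover have "(\<Sum>(i, j)\<in>index_set. (pow_mat_deriv (gram x) (gram_deriv (i, j) x) q * entry_matrix x + gram x ^\<^sub>m q * unit_matrix (i, j)) $$ (i, j)) =
    (\<Sum>(i, j)\<in>index_set. (pow_mat_deriv (gram x) (gram_deriv (i, j) x) q * gram_pow_mult 0 x) $$ (i, j)) + (\<Sum>(i, j)\<in>index_set. (gram x ^\<^sub>m q) $$ (i, i))"
    unfolding sum.distrib[symmetric] by (intro sum.cong) (use entry in \<open>auto simp del: index_mult_mat(1) index_add_mat(1)\<close>)
  ultimately show ?thesis
    unfolding divergence_pow by (simp add: sum.distrib algebra_simps)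
qed

text \<open>Multisets of exponents are closed under the two operations of the loop equation,
  splitting a trace into two and merging two into one. Exponent 0 is allowed and contributes a
  factor \<open>n\<close>.\<close>

definition trace_prod :: "nat multiset \<Rightarrow> (nat \<times> nat \<Rightarrow> real) \<Rightarrow> real" where
  "trace_prod R x = (\<Prod>r\<in>#R. gram_trace r x)"

lemma trace_prod_add_mset: "trace_prod (add_mset r R) x = gram_trace r x * trace_prod R x"
  by (simp add: trace_prod_def)

lemma poly_deriv_trace_prod:
  assumes "i < n" "j < m"
  shows "poly_deriv (i, j) index_set (trace_prod R)
    (\<lambda>x. \<Sum>r\<in>#R. 2 * real r * gram_pow_mult (r - 1) x $$ (i, j) * trace_prod (R - {#r#}) x)"
proof (induction R)
  case empty
  show ?case using poly_deriv.const[of "(i, j)" index_set 1] by (simp add: trace_prod_def[abs_def])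
next
  case (add r R)
  have "(\<Sum>r'\<in>#add_mset r R. 2 * real r' * gram_pow_mult (r' - 1) x $$ (i, j) * trace_prod (add_mset r R - {#r'#}) x) =
      2 * real r * gram_pow_mult (r - 1) x $$ (i, j) * trace_prod R x +
      gram_trace r x * (\<Sum>r'\<in>#R. 2 * real r' * gram_pow_mult (r' - 1) x $$ (i, j) * trace_prod (R - {#r'#}) x)" for x
  proof -
    have "(\<Sum>r'\<in>#R. 2 * real r' * gram_pow_mult (r' - 1) x $$ (i, j) * trace_prod (add_mset r R - {#r'#}) x) =
        (\<Sum>r'\<in>#R. gram_trace r x * (2 * real r' * gram_pow_mult (r' - 1) x $$ (i, j) * trace_prod (R - {#r'#}) x))"
    proof (intro arg_cong[where f = sum_mset] image_mset_cong)
      fix r' assume "r' \<in># R"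
      then have "add_mset r R - {#r'#} = add_mset r (R - {#r'#})" by simp
      then show "2 * real r' * gram_pow_mult (r' - 1) x $$ (i, j) * trace_prod (add_mset r R - {#r'#}) x =
          gram_trace r x * (2 * real r' * gram_pow_mult (r' - 1) x $$ (i, j) * trace_prod (R - {#r'#}) x)"
        by (simp add: trace_prod_add_mset)
    qed
    then show ?thesis by (simp add: sum_mset_distrib_left image_mset.compositionality o_def)
  qed
  then show ?case
    using poly_deriv.mult[OF poly_deriv_gram_trace[OF assms, of r] add] by (simp add: trace_prod_add_mset[abs_def])
qed

end

section \<open>The loop equation and its limit\<close>

text \<open>Serves integrability: a derivative is itself a polynomial, so
  \<open>integrable_poly\<close> applies to it.\<close>

lemma poly_deriv_again: "poly_deriv e I F F' \<Longrightarrow> \<exists>F''. poly_deriv e I F' F''"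
proof (induction rule: poly_deriv.induct)
  case (mult F F' H H')
  then obtain F'' H'' where "poly_deriv e I F' F''" "poly_deriv e I H' H''" by blast
  from poly_deriv.add[OF poly_deriv.mult[OF this(1) mult.hyps(2)] poly_deriv.mult[OF mult.hyps(1) this(2)]]
  show ?case by blast
next
  case (add F F' H H')
  then obtain F'' H'' where "poly_deriv e I F' F''" "poly_deriv e I H' H''" by blast
  from poly_deriv.add[OF this] show ?case by blast
qed (rule exI, rule poly_deriv.const)+

lemma sum_sum_mset_swap: "(\<Sum>e\<in>A. \<Sum>r\<in>#R. f e r) = (\<Sum>r\<in>#R. \<Sum>e\<in>A. f e r)"
  by (induction R) (simp_all add: sum.distrib)

lemma integral_sum_mset:
  fixes f :: "'b \<Rightarrow> 'a \<Rightarrow> real"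
  assumes "\<And>r. r \<in># R \<Longrightarrow> integrable M (f r)"
  shows "integrable M (\<lambda>\<omega>. \<Sum>r\<in>#R. f r \<omega>)"
    and "integral\<^sup>L M (\<lambda>\<omega>. \<Sum>r\<in>#R. f r \<omega>) = (\<Sum>r\<in>#R. integral\<^sup>L M (f r))"
proof -
  have "integrable M (\<lambda>\<omega>. \<Sum>r\<in>#R. f r \<omega>) \<and>
      integral\<^sup>L M (\<lambda>\<omega>. \<Sum>r\<in>#R. f r \<omega>) = (\<Sum>r\<in>#R. integral\<^sup>L M (f r))"
    using assms by (induction R) auto
  then show "integrable M (\<lambda>\<omega>. \<Sum>r\<in>#R. f r \<omega>)"
    "integral\<^sup>L M (\<lambda>\<omega>. \<Sum>r\<in>#R. f r \<omega>) = (\<Sum>r\<in>#R. integral\<^sup>L M (f r))" by auto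
qed

locale gaussian_matrix = iid_gaussian M X "{..<n} \<times> {..<m}"
  for M :: "'a measure" and X :: "nat \<times> nat \<Rightarrow> 'a \<Rightarrow> real" and n m :: nat +
  assumes n_pos: "0 < n" and m_pos: "0 < m"
begin

abbreviation "mean_trace_prod R \<equiv> expectation (\<lambda>\<omega>. trace_prod n m R (\<lambda>i. X i \<omega>))"

lemma integrable_trace_prod: "integrable M (\<lambda>\<omega>. trace_prod n m R (\<lambda>i. X i \<omega>))"
  using integrable_poly[OF poly_deriv_trace_prod] n_pos m_pos by blast

lemma stein_sum:
  assumes "\<And>i j. i < n \<Longrightarrow> j < m \<Longrightarrow> poly_deriv (i, j) ({..<n} \<times> {..<m}) (F i j) (F' i j)"
  shows "expectation (\<lambda>\<omega>. \<Sum>(i, j)\<in>{..<n} \<times> {..<m}. X (i, j) \<omega> * F i j (\<lambda>e. X e \<omega>)) =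
    expectation (\<lambda>\<omega>. \<Sum>(i, j)\<in>{..<n} \<times> {..<m}. F' i j (\<lambda>e. X e \<omega>))"
proof -
  have int: "integrable M (\<lambda>\<omega>. X (i, j) \<omega> * F i j (\<lambda>e. X e \<omega>))" "integrable M (\<lambda>\<omega>. F' i j (\<lambda>e. X e \<omega>))"
    if ij: "i < n" "j < m" for i j
  proof -
    show "integrable M (\<lambda>\<omega>. X (i, j) \<omega> * F i j (\<lambda>e. X e \<omega>))"
      using integrable_poly[OF poly_deriv.mult[OF poly_deriv.var assms[OF ij]], of "(i, j)"] ij by simp
    show "integrable M (\<lambda>\<omega>. F' i j (\<lambda>e. X e \<omega>))"
      using poly_deriv_again[OF assms[OF ij]] integrable_poly by blast
  qed
  have "expectation (\<lambda>\<omega>. \<Sum>(i, j)\<in>{..<n} \<times> {..<m}. X (i, j) \<omega> * F i j (\<lambda>e. X e \<omega>)) =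
      (\<Sum>(i, j)\<in>{..<n} \<times> {..<m}. expectation (\<lambda>\<omega>. X (i, j) \<omega> * F i j (\<lambda>e. X e \<omega>)))"
    unfolding case_prod_beta using int by (intro Bochner_Integration.integral_sum) auto
  also have "\<dots> = (\<Sum>(i, j)\<in>{..<n} \<times> {..<m}. expectation (\<lambda>\<omega>. F' i j (\<lambda>e. X e \<omega>)))"
    using stein[OF assms] by (intro sum.cong) auto
  also have "\<dots> = expectation (\<lambda>\<omega>. \<Sum>(i, j)\<in>{..<n} \<times> {..<m}. F' i j (\<lambda>e. X e \<omega>))"
    unfolding case_prod_beta using int by (intro Bochner_Integration.integral_sum[symmetric]) auto
  finally show ?thesis .
qed

text \<open>Stein's identity for the vector field \<open>W^q G\<close> weighted by the product of
  the remaining traces. Differentiating the field splits its trace into two; differentiating a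
  remaining trace of exponent \<open>r\<close> merges it with the field. Every multiset on the right
  has total one less than the one on the left.\<close>

theorem loop_equation:
  "mean_trace_prod (add_mset (Suc q) R) = (real m + real q) * mean_trace_prod (add_mset q R) +
    (\<Sum>a<q. mean_trace_prod (add_mset a (add_mset (q - a) R))) +
    (\<Sum>r\<in>#R. 2 * real r * mean_trace_prod (add_mset (q + r) (R - {#r#})))"
proof -
  let ?I = "{..<n} \<times> {..<m}"
  let ?dB = "\<lambda>i j x. (pow_mat_deriv (gram n m x) (gram_deriv n m (i, j) x) q * mat n m x +
    gram n m x ^\<^sub>m q * mat n m (\<lambda>i'. if i' = (i, j) then 1 else 0)) $$ (i, j)"
  let ?dR = "\<lambda>i j x. \<Sum>r\<in>#R. 2 * real r * gram_pow_mult n m (r - 1) x $$ (i, j) * trace_prod n m (R - {#r#}) x"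
  have "trace_prod n m (add_mset (Suc q) R) x = (\<Sum>(i, j)\<in>?I. x (i, j) * (gram_pow_mult n m q x $$ (i, j) * trace_prod n m R x))" for x
    unfolding trace_prod_add_mset using mtrace_gram_pow_mult_gram_pow_mult[of n m 0 x q, symmetric]
    by (auto simp: sum_distrib_right gram_pow_mult_0 intro!: sum.cong)
  then have "mean_trace_prod (add_mset (Suc q) R) =
      expectation (\<lambda>\<omega>. \<Sum>(i, j)\<in>?I. X (i, j) \<omega> * (gram_pow_mult n m q (\<lambda>e. X e \<omega>) $$ (i, j) * trace_prod n m R (\<lambda>e. X e \<omega>)))"
    by simp
  also have "\<dots> = expectation (\<lambda>\<omega>. \<Sum>(i, j)\<in>?I. ?dB i j (\<lambda>e. X e \<omega>) * trace_prod n m R (\<lambda>e. X e \<omega>) +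
      gram_pow_mult n m q (\<lambda>e. X e \<omega>) $$ (i, j) * ?dR i j (\<lambda>e. X e \<omega>))"
    by (rule stein_sum) (intro poly_deriv.mult poly_deriv_gram_pow_mult poly_deriv_trace_prod)
  also have "(\<lambda>\<omega>. \<Sum>(i, j)\<in>?I. ?dB i j (\<lambda>e. X e \<omega>) * trace_prod n m R (\<lambda>e. X e \<omega>) +
      gram_pow_mult n m q (\<lambda>e. X e \<omega>) $$ (i, j) * ?dR i j (\<lambda>e. X e \<omega>)) =
    (\<lambda>\<omega>. (real m + real q) * trace_prod n m (add_mset q R) (\<lambda>e. X e \<omega>) +
      (\<Sum>a<q. trace_prod n m (add_mset a (add_mset (q - a) R)) (\<lambda>e. X e \<omega>)) +
      (\<Sum>r\<in>#R. 2 * real r * trace_prod n m (add_mset (q + r) (R - {#r#})) (\<lambda>e. X e \<omega>)))" (is "?l = ?r")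
  proof
    fix \<omega>
    let ?x = "\<lambda>e. X e \<omega>"
    have 1: "(\<Sum>(i, j)\<in>?I. ?dB i j ?x * trace_prod n m R ?x) = ((real m + real q) * gram_trace n m q ?x +
        (\<Sum>a<q. gram_trace n m a ?x * gram_trace n m (q - a) ?x)) * trace_prod n m R ?x"
      unfolding divergence_gram_pow_mult[symmetric] sum_distrib_right by (simp add: case_prod_beta)
    have "(\<Sum>(i, j)\<in>?I. gram_pow_mult n m q ?x $$ (i, j) * ?dR i j ?x) =
        (\<Sum>e\<in>?I. \<Sum>r\<in>#R. 2 * real r * (gram_pow_mult n m q ?x $$ e * gram_pow_mult n m (r - 1) ?x $$ e) * trace_prod n m (R - {#r#}) ?x)"
      by (intro sum.cong) (auto simp: sum_mset_distrib_left image_mset.compositionality o_def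
        intro!: arg_cong[where f = sum_mset] image_mset_cong)
    also have "\<dots> = (\<Sum>r\<in>#R. \<Sum>e\<in>?I. 2 * real r * (gram_pow_mult n m q ?x $$ e * gram_pow_mult n m (r - 1) ?x $$ e) * trace_prod n m (R - {#r#}) ?x)"
      by (rule sum_sum_mset_swap)
    also have "\<dots> = (\<Sum>r\<in>#R. 2 * real r * (\<Sum>(i, j)\<in>?I. gram_pow_mult n m q ?x $$ (i, j) * gram_pow_mult n m (r - 1) ?x $$ (i, j)) * trace_prod n m (R - {#r#}) ?x)"
      by (simp add: sum_distrib_left sum_distrib_right case_prod_beta)
    also have "\<dots> = (\<Sum>r\<in>#R. 2 * real r * trace_prod n m (add_mset (q + r) (R - {#r#})) ?x)"
    proof (intro arg_cong[where f = sum_mset] image_mset_cong)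
      fix r
      \<comment> \<open>For \<open>r = 0\<close> the coefficient kills both sides; otherwise the
        exponents add up to \<open>q + (r - 1) + 1 = q + r\<close>.\<close>
      show "2 * real r * (\<Sum>(i, j)\<in>?I. gram_pow_mult n m q ?x $$ (i, j) * gram_pow_mult n m (r - 1) ?x $$ (i, j)) * trace_prod n m (R - {#r#}) ?x =
        2 * real r * trace_prod n m (add_mset (q + r) (R - {#r#})) ?x"
        unfolding mtrace_gram_pow_mult_gram_pow_mult trace_prod_add_mset by (cases r) simp_all
    qed
    finally have 2: "(\<Sum>(i, j)\<in>?I. gram_pow_mult n m q ?x $$ (i, j) * ?dR i j ?x) =
        (\<Sum>r\<in>#R. 2 * real r * trace_prod n m (add_mset (q + r) (R - {#r#})) ?x)" .
    have "?l \<omega> = (\<Sum>(i, j)\<in>?I. ?dB i j ?x * trace_prod n m R ?x) + (\<Sum>(i, j)\<in>?I. gram_pow_mult n m q ?x $$ (i, j) * ?dR i j ?x)"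
      unfolding sum.distrib[symmetric] by (simp add: case_prod_beta)
    also have "\<dots> = ?r \<omega>"
      unfolding 1 2 trace_prod_add_mset by (simp add: distrib_right sum_distrib_right mult.assoc)
    finally show "?l \<omega> = ?r \<omega>" .
  qed
  also have "expectation \<dots> = (real m + real q) * mean_trace_prod (add_mset q R) +
    (\<Sum>a<q. mean_trace_prod (add_mset a (add_mset (q - a) R))) +
    (\<Sum>r\<in>#R. 2 * real r * mean_trace_prod (add_mset (q + r) (R - {#r#})))"
  proof -
    have int: "integrable M (\<lambda>\<omega>. \<Sum>a<q. trace_prod n m (add_mset a (add_mset (q - a) R)) (\<lambda>e. X e \<omega>))"
      "integrable M (\<lambda>\<omega>. (real m + real q) * trace_prod n m (add_mset q R) (\<lambda>e. X e \<omega>))"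
      "\<And>r. integrable M (\<lambda>\<omega>. 2 * real r * trace_prod n m (add_mset (q + r) (R - {#r#})) (\<lambda>e. X e \<omega>))"
      by (intro Bochner_Integration.integrable_sum integrable_mult_right integrable_trace_prod)+
    have add3: "expectation (\<lambda>\<omega>. f \<omega> + g \<omega> + h \<omega>) = expectation f + expectation g + expectation h"
      if "integrable M f" "integrable M g" "integrable M h" for f g h :: "'a \<Rightarrow> real"
      using that by simp
    have sum: "expectation (\<lambda>\<omega>. \<Sum>a<q. trace_prod n m (add_mset a (add_mset (q - a) R)) (\<lambda>e. X e \<omega>)) =
        (\<Sum>a<q. mean_trace_prod (add_mset a (add_mset (q - a) R)))"
      by (rule Bochner_Integration.integral_sum[OF integrable_trace_prod])
    have mset: "expectation (\<lambda>\<omega>. \<Sum>r\<in>#R. 2 * real r * trace_prod n m (add_mset (q + r) (R - {#r#})) (\<lambda>e. X e \<omega>)) =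
        (\<Sum>r\<in>#R. 2 * real r * mean_trace_prod (add_mset (q + r) (R - {#r#})))"
      using integral_sum_mset(2)[of R M "\<lambda>r \<omega>. 2 * real r * trace_prod n m (add_mset (q + r) (R - {#r#})) (\<lambda>e. X e \<omega>)", OF int(3)]
      by (simp only: integral_mult_right_zero)
    have "integrable M (\<lambda>\<omega>. \<Sum>r\<in>#R. 2 * real r * trace_prod n m (add_mset (q + r) (R - {#r#})) (\<lambda>e. X e \<omega>))"
      by (rule integral_sum_mset(1)) (rule int)
    from add3[OF int(2,1) this] show ?thesis unfolding sum mset integral_mult_right_zero .
  qed
  finally show ?thesis .
qed

end

text \<open>The order of magnitude of a product of traces: \<open>n\<close> diagonal entries per
  trace, and size \<open>m\<close> per Gram factor.\<close>

definition normalizer :: "nat \<Rightarrow> nat \<Rightarrow> nat multiset \<Rightarrow> real" where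
  "normalizer n m R = (\<Prod>r\<in>#R. real n * real m ^ r)"

lemma tendsto_sum_mset:
  fixes f :: "'b \<Rightarrow> 'c \<Rightarrow> real"
  assumes "\<And>r. r \<in># R \<Longrightarrow> ((\<lambda>k. f r k) \<longlongrightarrow> l r) F"
  shows "((\<lambda>k. \<Sum>r\<in>#R. f r k) \<longlongrightarrow> (\<Sum>r\<in>#R. l r)) F"
  using assms by (induction R) (auto intro!: tendsto_add)

lemma sum_mset_divide: "(\<Sum>r\<in>#R. f r) / c = (\<Sum>r\<in>#R. f r / c :: real)"
  by (induction R) (simp_all add: add_divide_distrib)

lemma sum_mset_pos_obtain:
  fixes R :: "nat multiset"
  assumes "sum_mset R > 0"
  obtains q R' where "R = add_mset (Suc q) R'"
proof -
  obtain r where "r \<in># R" "r \<noteq> 0" using assms by (metis less_irrefl sum_mset_0_iff)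
  then show ?thesis using that by (metis insert_DiffM not0_implies_Suc)
qed

section \<open>Normalised trace moments\<close>

context gaussian_matrix
begin

definition "moment_prod R = mean_trace_prod R / normalizer n m R"

lemma normalizer_pos: "normalizer n m R > 0"
  unfolding normalizer_def using n_pos m_pos by (induction R) auto

lemma moment_prod_zero:
  assumes "sum_mset R = 0"
  shows "moment_prod R = 1"
proof -
  have "trace_prod n m R x = normalizer n m R" for x
    using assms unfolding trace_prod_def normalizer_def by (induction R) (auto simp: gram_trace_0)
  then show ?thesis unfolding moment_prod_def using normalizer_pos[of R] prob_space by simp
qed

text \<open>The normalisation decides what survives. Splitting creates a trace and has weight
  \<open>n / m\<close>; merging loses a trace and has weight \<open>1 / (n m)\<close>; the extra
  \<open>q\<close> of the divergence has weight \<open>1 / m\<close>. What remains is the recursion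
  of \<open>moment_sequence\<close> applied to one factor.\<close>

lemma moment_prod_Suc:
  "moment_prod (add_mset (Suc q) R) = (1 + real q / real m) * moment_prod (add_mset q R) +
    (real n / real m) * (\<Sum>a<q. moment_prod (add_mset a (add_mset (q - a) R))) +
    (\<Sum>r\<in>#R. 2 * real r / (real n * real m) * moment_prod (add_mset (q + r) (R - {#r#})))"
proof -
  let ?N = "normalizer n m"
  have N: "?N (add_mset r R) = real n * real m ^ r * ?N R" for r R
    by (simp add: normalizer_def)
  note nz = n_pos m_pos normalizer_pos[of R]
  have 1: "mean_trace_prod (add_mset q R) / ?N (add_mset (Suc q) R) = moment_prod (add_mset q R) / real m"
    unfolding moment_prod_def N using nz by (simp add: field_simps)
  have 2: "mean_trace_prod (add_mset a (add_mset (q - a) R)) / ?N (add_mset (Suc q) R) =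
      (real n / real m) * moment_prod (add_mset a (add_mset (q - a) R))" if "a < q" for a
  proof -
    have "real m ^ q = real m ^ a * real m ^ (q - a)" using that by (simp flip: power_add)
    then show ?thesis unfolding moment_prod_def N using nz by (simp add: field_simps)
  qed
  have 3: "2 * real r * mean_trace_prod (add_mset (q + r) (R - {#r#})) / ?N (add_mset (Suc q) R) =
      2 * real r / (real n * real m) * moment_prod (add_mset (q + r) (R - {#r#}))" if "r \<in># R" for r
  proof -
    have R: "?N R = real n * real m ^ r * ?N (R - {#r#})"
      unfolding N[symmetric] using that by simp
    show ?thesis unfolding moment_prod_def N R
      using nz normalizer_pos[of "R - {#r#}"] by (simp add: field_simps power_add)
  qed
  have "moment_prod (add_mset (Suc q) R) = (real m + real q) * (mean_trace_prod (add_mset q R) / ?N (add_mset (Suc q) R)) +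
     (\<Sum>a<q. mean_trace_prod (add_mset a (add_mset (q - a) R)) / ?N (add_mset (Suc q) R)) +
     (\<Sum>r\<in>#R. 2 * real r * mean_trace_prod (add_mset (q + r) (R - {#r#})) / ?N (add_mset (Suc q) R))"
    unfolding moment_prod_def[of "add_mset (Suc q) R"] loop_equation
    by (simp add: add_divide_distrib sum_divide_distrib sum_mset_divide)
  also have "(\<Sum>a<q. mean_trace_prod (add_mset a (add_mset (q - a) R)) / ?N (add_mset (Suc q) R)) =
      (real n / real m) * (\<Sum>a<q. moment_prod (add_mset a (add_mset (q - a) R)))"
    unfolding sum_distrib_left using 2 by (intro sum.cong) auto
  also have "(\<Sum>r\<in>#R. 2 * real r * mean_trace_prod (add_mset (q + r) (R - {#r#})) / ?N (add_mset (Suc q) R)) =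
      (\<Sum>r\<in>#R. 2 * real r / (real n * real m) * moment_prod (add_mset (q + r) (R - {#r#})))"
    using 3 by (intro arg_cong[where f = sum_mset] image_mset_cong) auto
  also have "(real m + real q) * (mean_trace_prod (add_mset q R) / ?N (add_mset (Suc q) R)) =
      (1 + real q / real m) * moment_prod (add_mset q R)"
    unfolding 1 using m_pos by (simp add: field_simps)
  finally show ?thesis .
qed

end

text \<open>Isolates the recursion from the integrals that satisfy it, so that the limit argument is
  independent of the Marchenko-Pastur density; \<open>mp_moment\<close> instantiates it
  below.\<close>

locale moment_sequence =
  fixes \<mu> :: "real \<Rightarrow> nat \<Rightarrow> real"
  assumes moment_0: "\<And>s. 0 < s \<Longrightarrow> s \<le> 1 \<Longrightarrow> \<mu> s 0 = 1"
    and moment_Suc: "\<And>s q. 0 < s \<Longrightarrow> s \<le> 1 \<Longrightarrow> \<mu> s (Suc q) = \<mu> s q + s * (\<Sum>a<q. \<mu> s a * \<mu> s (q - a))"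
begin

text \<open>The bound must not depend on \<open>s\<close>, because the ratios along the sequence
  need not converge. It comes from the recursion, whose coefficients are at most 1 for
  \<open>s \<le> 1\<close>.\<close>

lemma moment_bounded: "\<exists>B. \<forall>s. 0 < s \<and> s \<le> 1 \<longrightarrow> \<bar>\<mu> s q\<bar> \<le> B"
proof (induction q rule: less_induct)
  case (less q)
  show ?case
  proof (cases q)
    case 0
    then show ?thesis using moment_0 by (intro exI[of _ 1]) auto
  next
    case (Suc p)
    obtain B where B: "\<And>r s. r < q \<Longrightarrow> 0 < s \<Longrightarrow> s \<le> 1 \<Longrightarrow> \<bar>\<mu> s r\<bar> \<le> B r"
      using less by metis
    have "\<bar>\<mu> s q\<bar> \<le> B p + (\<Sum>a<p. B a * B (p - a))" if s: "0 < s" "s \<le> 1" for s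
    proof -
      have "\<bar>\<mu> s q\<bar> \<le> \<bar>\<mu> s p\<bar> + \<bar>s * (\<Sum>a<p. \<mu> s a * \<mu> s (p - a))\<bar>"
        unfolding Suc moment_Suc[OF s] by (rule abs_triangle_ineq)
      also have "\<bar>s * (\<Sum>a<p. \<mu> s a * \<mu> s (p - a))\<bar> \<le> 1 * \<bar>\<Sum>a<p. \<mu> s a * \<mu> s (p - a)\<bar>"
        unfolding abs_mult using s by (intro mult_right_mono) auto
      also have "\<bar>\<Sum>a<p. \<mu> s a * \<mu> s (p - a)\<bar> \<le> (\<Sum>a<p. \<bar>\<mu> s a\<bar> * \<bar>\<mu> s (p - a)\<bar>)"
        using sum_abs[of "\<lambda>a. \<mu> s a * \<mu> s (p - a)"] by (simp add: abs_mult)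
      also have "\<dots> \<le> (\<Sum>a<p. B a * B (p - a))"
      proof (intro sum_mono mult_mono)
        fix a assume "a \<in> {..<p}"
        then have "a < q" "p - a < q" using Suc by auto
        then show "\<bar>\<mu> s a\<bar> \<le> B a" "\<bar>\<mu> s (p - a)\<bar> \<le> B (p - a)" using B s by auto
        then show "0 \<le> B a" by linarith
      qed simp
      finally show ?thesis using B[of p s] s Suc by simp
    qed
    then show ?thesis by blast
  qed
qed

definition "moment_prod_limit s R = (\<Prod>r\<in>#R. \<mu> s r)"

lemma moment_prod_limit_bounded: "\<exists>B. \<forall>s. 0 < s \<and> s \<le> 1 \<longrightarrow> \<bar>moment_prod_limit s R\<bar> \<le> B"
proof (induction R)
  case empty
  then show ?case by (intro exI[of _ 1]) (auto simp: moment_prod_limit_def)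
next
  case (add r R)
  then obtain B where "\<And>s. 0 < s \<Longrightarrow> s \<le> 1 \<Longrightarrow> \<bar>moment_prod_limit s R\<bar> \<le> B" by blast
  moreover obtain C where "\<And>s. 0 < s \<Longrightarrow> s \<le> 1 \<Longrightarrow> \<bar>\<mu> s r\<bar> \<le> C" using moment_bounded by blast
  ultimately have "\<bar>moment_prod_limit s (add_mset r R)\<bar> \<le> C * B" if "0 < s" "s \<le> 1" for s
    using that unfolding moment_prod_limit_def image_mset_add_mset prod_mset.add_mset abs_mult
    by (intro mult_mono) (auto intro: order_trans[OF abs_ge_zero])
  then show ?case by blast
qed

text \<open>Stated as a difference because neither term need converge. Multiplying the recursion of
  one factor by the other factors shows that \<open>moment_prod_limit\<close> obeys the recursion of
  \<open>moment_prod\<close> without its corrections.\<close>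

theorem moment_prod_converges:
  fixes n m :: "nat \<Rightarrow> nat" and M :: "nat \<Rightarrow> 'a measure" and X :: "nat \<Rightarrow> nat \<times> nat \<Rightarrow> 'a \<Rightarrow> real"
  assumes gm: "\<And>k. gaussian_matrix (M k) (X k) (n k) (m k)"
    and n: "filterlim n at_top sequentially" and m: "filterlim m at_top sequentially"
    and ratio: "\<And>k. real (n k) / real (m k) \<in> {0<..1}"
  shows "(\<lambda>k. gaussian_matrix.moment_prod (M k) (X k) (n k) (m k) R -
    moment_prod_limit (real (n k) / real (m k)) R) \<longlonglongrightarrow> 0"
proof (induction "sum_mset R" arbitrary: R rule: less_induct)
  case less
  let ?y = "\<lambda>k. gaussian_matrix.moment_prod (M k) (X k) (n k) (m k)"
  let ?s = "\<lambda>k. real (n k) / real (m k)"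
  let ?l = "\<lambda>k. moment_prod_limit (?s k)"
  have s: "0 < ?s k" "?s k \<le> 1" for k using ratio[of k] by auto
  show ?case
  proof (cases "sum_mset R = 0")
    case True
    have "?l k R = 1" for k
      using True unfolding moment_prod_limit_def by (induction R) (auto simp: moment_0[OF s])
    then show ?thesis using gaussian_matrix.moment_prod_zero[OF gm True] by simp
  next
    case False
    then obtain q R' where R: "R = add_mset (Suc q) R'" using sum_mset_pos_obtain by blast
    have conv: "(\<lambda>k. ?y k R1 - ?l k R1) \<longlonglongrightarrow> 0" if "sum_mset R1 = q + sum_mset R'" for R1
      using less[of R1] that R by simp
    \<comment> \<open>Boundedness of the moments takes no estimate of its own: the difference tends
      to 0 by induction, and the limit moments are bounded uniformly in \<open>s\<close>.\<close>
    have bdd: "Bseq (\<lambda>k. ?y k R1)" if "sum_mset R1 = q + sum_mset R'" for R1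
    proof -
      obtain B where "\<And>s. 0 < s \<Longrightarrow> s \<le> 1 \<Longrightarrow> \<bar>moment_prod_limit s R1\<bar> \<le> B"
        using moment_prod_limit_bounded by blast
      then have B: "\<bar>?l k R1\<bar> \<le> B" for k using s by blast
      have "Bseq (\<lambda>k. ?y k R1 - ?l k R1)"
        using conv[OF that] by (intro convergent_imp_Bseq) (auto simp: convergent_def)
      then obtain K where K: "\<And>k. \<bar>?y k R1 - ?l k R1\<bar> \<le> K" by (auto simp: Bseq_def)
      have "\<bar>?y k R1\<bar> \<le> K + B" for k
        using B[of k] K[of k] by linarith
      then show ?thesis by (intro BseqI'[of _ "K + B"]) simp
    qed
    have inv_n: "(\<lambda>k. inverse (real (n k))) \<longlonglongrightarrow> 0" and inv_m: "(\<lambda>k. inverse (real (m k))) \<longlonglongrightarrow> 0"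
      using n m by (auto intro!: tendsto_inverse_0_at_top filterlim_compose[OF filterlim_real_sequentially])
    have Bs: "Bseq ?s" using s by (intro BseqI'[of _ 1]) (auto simp: abs_of_pos)
    \<comment> \<open>Four contributions to the error: the lowered multiset, the
      \<open>q / m\<close> correction, the split terms, and the merged terms with their factor
      \<open>1 / (n m)\<close>.\<close>
    let ?d = "\<lambda>k. (?y k (add_mset q R') - ?l k (add_mset q R')) +
      real q * (inverse (real (m k)) * ?y k (add_mset q R')) +
      ?s k * (\<Sum>a<q. ?y k (add_mset a (add_mset (q - a) R')) - ?l k (add_mset a (add_mset (q - a) R'))) +
      (\<Sum>r\<in>#R'. 2 * real r * (inverse (real (n k)) * (inverse (real (m k)) * ?y k (add_mset (q + r) (R' - {#r#})))))"
    have eq: "?y k R - ?l k R = ?d k" for k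
    proof -
      have "?l k R = ?l k (add_mset q R') + ?s k * (\<Sum>a<q. ?l k (add_mset a (add_mset (q - a) R')))"
        unfolding R moment_prod_limit_def
        by (simp add: moment_Suc[OF s] algebra_simps sum_distrib_left)
      then show ?thesis
        unfolding R gaussian_matrix.moment_prod_Suc[OF gm]
        by (simp add: algebra_simps divide_inverse sum_subtractf)
    qed
    have mult0: "(\<lambda>k. a k * b k) \<longlonglongrightarrow> 0" if "a \<longlonglongrightarrow> 0" "Bseq b" for a b :: "nat \<Rightarrow> real"
      using that bounded_bilinear.Zfun_prod_Bfun[OF bounded_bilinear_mult, of a sequentially b] by (simp add: tendsto_Zfun_iff)
    have "?d \<longlonglongrightarrow> 0 + real q * 0 + 0 + (\<Sum>r\<in>#R'. 2 * real r * 0)"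
    proof (intro tendsto_add tendsto_sum_mset)
      show "(\<lambda>k. ?y k (add_mset q R') - ?l k (add_mset q R')) \<longlonglongrightarrow> 0" by (rule conv) simp
      show "(\<lambda>k. real q * (inverse (real (m k)) * ?y k (add_mset q R'))) \<longlonglongrightarrow> real q * 0"
        by (intro tendsto_mult_left mult0 inv_m bdd) simp
      have "(\<lambda>k. \<Sum>a<q. ?y k (add_mset a (add_mset (q - a) R')) - ?l k (add_mset a (add_mset (q - a) R'))) \<longlonglongrightarrow> (\<Sum>a<q. 0)"
        by (intro tendsto_sum conv) simp
      then show "(\<lambda>k. ?s k * (\<Sum>a<q. ?y k (add_mset a (add_mset (q - a) R')) - ?l k (add_mset a (add_mset (q - a) R')))) \<longlonglongrightarrow> 0"
        using mult0[OF _ Bs] by (subst mult.commute) simp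
      fix r assume r: "r \<in># R'"
      have "sum_mset R' = r + sum_mset (R' - {#r#})" using r by (metis insert_DiffM sum_mset.add_mset)
      then have "Bseq (\<lambda>k. ?y k (add_mset (q + r) (R' - {#r#})))" by (intro bdd) simp
      then have "(\<lambda>k. inverse (real (m k)) * ?y k (add_mset (q + r) (R' - {#r#}))) \<longlonglongrightarrow> 0"
        by (rule mult0[OF inv_m])
      from tendsto_mult[OF inv_n this]
      show "(\<lambda>k. 2 * real r * (inverse (real (n k)) * (inverse (real (m k)) * ?y k (add_mset (q + r) (R' - {#r#}))))) \<longlonglongrightarrow> 2 * real r * 0"
        by (intro tendsto_mult_left) simp
    qed
    then show ?thesis unfolding eq by simp
  qed
qed

end

section \<open>Moments of the Marchenko-Pastur law\<close>

definition mp_weight :: "real \<Rightarrow> real \<Rightarrow> real" where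
  "mp_weight s v = ((u_b s)\<^sup>2 - v\<^sup>2) * (v\<^sup>2 - (l_b s)\<^sup>2)"

text \<open>The factor \<open>1 / u\<close> of the density is absorbed into the power, so this is
  \<open>pi * s\<close> times moment \<open>p + 1\<close> of the law in the variable
  \<open>x = u^2\<close>.\<close>

definition mp_integral :: "real \<Rightarrow> nat \<Rightarrow> real" where
  "mp_integral s p = integral {l_b s..u_b s} (\<lambda>v. v ^ (2 * p + 1) * sqrt (mp_weight s v))"

context
  fixes s :: real
  assumes s: "0 < s" "s \<le> 1"
begin

lemma edges: "0 \<le> l_b s" "l_b s < u_b s" "u_b s \<le> 2" "l_b s < 1"
  using s by (auto simp: l_b_def u_b_def)

lemma sqrt_s_sq: "sqrt s * sqrt s = s" using s by simp

text \<open>In the variable \<open>y = v^2 - (1 + s)\<close> the root of the weight is a semicircle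
  of radius \<open>2 * sqrt s\<close>.\<close>

lemma mp_weight_alt: "mp_weight s v = 4 * s - (v\<^sup>2 - (1 + s))\<^sup>2"
proof -
  have "(u_b s)\<^sup>2 = (1 + s) + 2 * sqrt s" "(l_b s)\<^sup>2 = (1 + s) - 2 * sqrt s"
    using sqrt_s_sq by (simp_all add: u_b_def l_b_def power2_eq_square algebra_simps)
  moreover have "(A + 2 * C - V) * (V - (A - 2 * C)) = 4 * (C * C) - (V - A)\<^sup>2" for A C V :: real
    by (simp add: power2_eq_square algebra_simps)
  ultimately show ?thesis unfolding mp_weight_def by (simp only: sqrt_s_sq)
qed

lemma mp_weight_nonneg: "v \<in> {l_b s..u_b s} \<Longrightarrow> 0 \<le> mp_weight s v"
  unfolding mp_weight_def using edges by (intro mult_nonneg_nonneg) (auto intro!: power_mono)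

lemma mp_weight_pos: "v \<in> {l_b s<..<u_b s} \<Longrightarrow> 0 < mp_weight s v"
  unfolding mp_weight_def using edges by (intro mult_pos_pos) (auto intro!: power_strict_mono)

lemma mp_weight_edges: "mp_weight s (l_b s) = 0" "mp_weight s (u_b s) = 0"
  by (simp_all add: mp_weight_def)

lemma continuous_mp_weight [continuous_intros]: "continuous_on A (mp_weight s)"
  unfolding mp_weight_def[abs_def] by (intro continuous_intros)

lemma has_derivative_mp_weight:
  "(mp_weight s has_real_derivative (4 * (1 + s) * v - 4 * v ^ 3)) (at v)"
  unfolding mp_weight_alt[abs_def]
  by (auto intro!: derivative_eq_intros simp: power2_eq_square power3_eq_cube algebra_simps)

lemma has_derivative_sqrt_mp_weight:
  assumes "0 < mp_weight s v"
  shows "((\<lambda>v. sqrt (mp_weight s v)) has_real_derivative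
    inverse (sqrt (mp_weight s v)) / 2 * (4 * (1 + s) * v - 4 * v ^ 3)) (at v)"
  by (rule DERIV_chain2[of sqrt _ "mp_weight s" v, OF DERIV_real_sqrt[OF assms] has_derivative_mp_weight])

lemma mp_integral_has_integral:
  "((\<lambda>v. v ^ (2 * p + 1) * sqrt (mp_weight s v)) has_integral mp_integral s p) {l_b s..u_b s}"
  unfolding mp_integral_def
  by (intro integrable_integral integrable_continuous_interval continuous_intros)

text \<open>The exponent 3/2 is chosen for partial integration: this power vanishes at both edges,
  and its derivative is again a polynomial times the root, without a singular denominator.\<close>

lemma has_derivative_mp_weight_power:
  assumes "0 < mp_weight s v"
  shows "((\<lambda>v. mp_weight s v * sqrt (mp_weight s v)) has_real_derivative
    (6 * (1 + s) * v - 6 * v ^ 3) * sqrt (mp_weight s v)) (at v)"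
proof -
  let ?d = "4 * (1 + s) * v - 4 * v ^ 3"
  have "inverse (sqrt w) / 2 * d * w = d / 2 * sqrt w" if "w > 0" for w d :: real
  proof -
    have "inverse r / 2 * d * (r * r) = d / 2 * r" if "r > 0" for r :: real
      using that by (simp add: field_simps)
    from this[of "sqrt w"] show ?thesis using that by simp
  qed
  then have "?d * sqrt (mp_weight s v) + inverse (sqrt (mp_weight s v)) / 2 * ?d * mp_weight s v =
      ?d * sqrt (mp_weight s v) + ?d / 2 * sqrt (mp_weight s v)"
    using assms by (simp only:)
  also have "?d / 2 = 2 * (1 + s) * v - 2 * v ^ 3" by simp
  also have "?d * sqrt (mp_weight s v) + (2 * (1 + s) * v - 2 * v ^ 3) * sqrt (mp_weight s v) =
      (6 * (1 + s) * v - 6 * v ^ 3) * sqrt (mp_weight s v)"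
    by (simp add: algebra_simps)
  finally have "?d * sqrt (mp_weight s v) + inverse (sqrt (mp_weight s v)) / 2 * ?d * mp_weight s v =
      (6 * (1 + s) * v - 6 * v ^ 3) * sqrt (mp_weight s v)" .
  with DERIV_mult[OF has_derivative_mp_weight[of v] has_derivative_sqrt_mp_weight[OF assms]]
  show ?thesis by simp
qed

lemma mp_rec_algebra_0:
  "(6 * a * v - 6 * v ^ 3) * R = 2 * ((3 * a) * (v * R) - 3 * (v ^ 3 * R))" for a v R :: real
  by (simp add: algebra_simps)

lemma mp_rec_algebra_Suc:
  "2 * (Q + 1) * (P * v) * ((2 * a * v\<^sup>2 - b - v ^ 4) * R) + (6 * a * v - 6 * v ^ 3) * R * (P * v\<^sup>2) =
    2 * (((2 * (Q + 1) + 3) * a) * ((P * v ^ 3) * R) - (Q + 1) * b * (P * v * R) - (Q + 1 + 3) * (P * v ^ 5 * R))"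
  for P Q R a b v :: real
  by (simp add: algebra_simps eval_nat_numeral)

text \<open>With \<open>R\<close> the root of the weight, the left side is the derivative of
  \<open>v^(2p)\<close> times the weight to the power 3/2. One weight factor is expanded, so that
  only odd powers of \<open>v\<close> times \<open>R\<close> remain. The case \<open>p = 0\<close>
  is separate because \<open>2 p - 1\<close> and \<open>p - 1\<close> truncate there.\<close>

lemma mp_rec_algebra:
  "real (2 * p) * v ^ (2 * p - Suc 0) * (mp_weight s v * R) + (6 * (1 + s) * v - 6 * v ^ 3) * R * v ^ (2 * p) =
    2 * (((2 * real p + 3) * (1 + s)) * (v ^ (2 * p + 1) * R) - real p * (1 - s)\<^sup>2 * (v ^ (2 * (p - 1) + 1) * R) -
      (real p + 3) * (v ^ (2 * Suc p + 1) * R))"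
proof (cases p)
  case 0
  have "v ^ (2 * p) = 1" "v ^ (2 * p + 1) = v" "v ^ (2 * Suc p + 1) = v ^ 3" "real p = 0" "real (2 * p) = 0"
    using 0 by (simp_all add: eval_nat_numeral)
  then show ?thesis
    by (simp only: mult_zero_left mult_zero_right add_0_left mult_1_right diff_0_right mp_rec_algebra_0)
next
  case (Suc q)
  have e: "v ^ (2 * p - Suc 0) = v ^ (2 * q) * v" "v ^ (2 * p) = v ^ (2 * q) * v\<^sup>2" "v ^ (2 * p + 1) = v ^ (2 * q) * v ^ 3"
     "v ^ (2 * (p - 1) + 1) = v ^ (2 * q) * v" "v ^ (2 * Suc p + 1) = v ^ (2 * q) * v ^ 5"
     "real (2 * p) = 2 * (real q + 1)" "real p = real q + 1"
    using Suc by (auto simp: eval_nat_numeral)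
  have w: "mp_weight s v = 2 * (1 + s) * v\<^sup>2 - (1 - s)\<^sup>2 - v ^ 4"
    unfolding mp_weight_alt by (simp add: power2_eq_square power4_eq_xxxx algebra_simps)
  show ?thesis
    unfolding e w by (rule mp_rec_algebra_Suc)
qed

text \<open>Integrates the derivative of \<open>v^(2p)\<close> times the weight to the power 3/2
  over the support, where the boundary terms vanish. At \<open>p = 0\<close> the truncated index
  \<open>p - 1\<close> carries the coefficient 0.\<close>

lemma mp_integral_rec:
  "(real p + 3) * mp_integral s (Suc p) =
    (2 * real p + 3) * (1 + s) * mp_integral s p - real p * (1 - s)\<^sup>2 * mp_integral s (p - 1)"
proof -
  let ?W = "mp_weight s"
  let ?f = "\<lambda>v. v ^ (2 * p) * (?W v * sqrt (?W v))"
  let ?k = "\<lambda>p v. v ^ (2 * p + 1) * sqrt (?W v)"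
  let ?g = "\<lambda>v. 2 * (((2 * real p + 3) * (1 + s)) * ?k p v - real p * (1 - s)\<^sup>2 * ?k (p - 1) v - (real p + 3) * ?k (Suc p) v)"
  have "(?g has_integral (?f (u_b s) - ?f (l_b s))) {l_b s..u_b s}"
  proof (rule fundamental_theorem_of_calculus_interior)
    show "l_b s \<le> u_b s" using edges by simp
    show "continuous_on {l_b s..u_b s} ?f" by (intro continuous_intros)
    fix v assume "v \<in> {l_b s<..<u_b s}"
    then have W: "0 < ?W v" by (rule mp_weight_pos)
    have "(?f has_real_derivative ?g v) (at v)"
      by (rule DERIV_cong[OF DERIV_mult[OF DERIV_pow[of "2 * p" v] has_derivative_mp_weight_power[OF W]] mp_rec_algebra])
    then show "(?f has_vector_derivative ?g v) (at v)"
      by (simp only: has_real_derivative_iff_has_vector_derivative)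
  qed
  then have 1: "(?g has_integral 0) {l_b s..u_b s}" by (simp only: mp_weight_edges mult_zero_left mult_zero_right diff_self)
  have k: "((\<lambda>v. c * ?k q v) has_integral c * mp_integral s q) {l_b s..u_b s}" for c q
    by (rule has_integral_mult_right) (rule mp_integral_has_integral)
  have "(?g has_integral 2 * (((2 * real p + 3) * (1 + s)) * mp_integral s p
      - real p * (1 - s)\<^sup>2 * mp_integral s (p - 1) - (real p + 3) * mp_integral s (Suc p))) {l_b s..u_b s}"
    by (rule has_integral_mult_right, rule has_integral_diff, rule has_integral_diff; rule k)
  note eq = has_integral_unique[OF 1 this]
  have "C = A - B" if "0 = 2 * (A - B - C)" for A B C :: real using that by simp
  from this[OF eq] show ?thesis .
qed

lemma mp_integral_0: "mp_integral s 0 = pi * s"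
proof -
  let ?W = "mp_weight s" and ?c = "2 * sqrt s"
  let ?y = "\<lambda>v. v\<^sup>2 - (1 + s)"
  \<comment> \<open>Substituting \<open>y = v^2 - (1 + s)\<close> leaves half the integral of
    \<open>sqrt (4 s - y^2)\<close>, that is, half the area of a half disc of radius
    \<open>2 * sqrt s\<close>. This is the classical antiderivative of that integrand.\<close>
  let ?f = "\<lambda>v. ?y v * sqrt (?W v) / 4 + s * arcsin (?y v / ?c)"
  have c: "?c > 0" "?c * ?c = 4 * s" using s by auto
  have y: "\<bar>?y v\<bar> \<le> ?c" if "0 \<le> ?W v" for v
  proof -
    have "(?y v)\<^sup>2 \<le> ?c\<^sup>2" using that c unfolding mp_weight_alt by (simp add: power2_eq_square)
    then have "\<bar>?y v\<bar> \<le> \<bar>?c\<bar>" by (simp only: abs_le_square_iff)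
    then show ?thesis using c by simp
  qed
  have "((\<lambda>v. v ^ (2 * 0 + 1) * sqrt (?W v)) has_integral (?f (u_b s) - ?f (l_b s))) {l_b s..u_b s}"
  proof (rule fundamental_theorem_of_calculus_interior)
    show "l_b s \<le> u_b s" using edges by simp
    show "continuous_on {l_b s..u_b s} ?f"
    proof (intro continuous_intros ballI)
      fix v assume "v \<in> {l_b s..u_b s}"
      from y[OF mp_weight_nonneg[OF this]] have "\<bar>?y v / ?c\<bar> \<le> 1"
        using c by (simp add: divide_simps abs_divide)
      then show "- 1 \<le> ?y v / ?c \<and> ?y v / ?c \<le> 1" by linarith
    qed (use c in auto)
    fix v assume v: "v \<in> {l_b s<..<u_b s}"
    have W: "0 < ?W v" by (rule mp_weight_pos[OF v])
    have Wc: "?W v = ?c\<^sup>2 - (?y v)\<^sup>2" unfolding mp_weight_alt using s by (simp add: power_mult_distrib)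
    have "(?y v)\<^sup>2 < ?c\<^sup>2" using W by (simp only: Wc diff_gt_0_iff_gt)
    then have "\<not> \<bar>?c\<bar> \<le> \<bar>?y v\<bar>" by (simp only: abs_le_square_iff not_le)
    then have "\<bar>?y v\<bar> < ?c" using c by linarith
    then have arg: "- 1 < ?y v / ?c" "?y v / ?c < 1" using c by (auto simp: field_simps abs_less_iff)
    have "1 - (?y v / ?c)\<^sup>2 = ?W v / ?c\<^sup>2"
      using c unfolding Wc by (simp add: field_simps power_divide)
    then have root: "sqrt (1 - (?y v / ?c)\<^sup>2) = sqrt (?W v) / ?c"
      using s by (simp add: real_sqrt_divide real_sqrt_mult)
    have "(?f has_real_derivative ((2 * v) * sqrt (?W v) + ?y v * ((4 * (1 + s) * v - 4 * v ^ 3) * (inverse (sqrt (?W v)) / 2))) / 4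
        + s * ((2 * v / ?c) * inverse (sqrt (1 - (?y v / ?c)\<^sup>2)))) (at v)"
    proof -
      have dy: "(?y has_real_derivative 2 * v) (at v)" by (auto intro!: derivative_eq_intros)
      from DERIV_cdivide[OF this, of ?c]
      have "((\<lambda>v. arcsin (?y v / ?c)) has_real_derivative inverse (sqrt (1 - (?y v / ?c)\<^sup>2)) * (2 * v / ?c)) (at v)"
        by (rule DERIV_chain2[of arcsin _ "\<lambda>v. ?y v / ?c" v, OF DERIV_arcsin[OF arg]])
      from DERIV_add[OF DERIV_cdivide[OF DERIV_mult[OF dy has_derivative_sqrt_mp_weight[OF W]], of 4] DERIV_cmult[OF this, of s]]
      show ?thesis by (simp add: mult_ac)
    qed
    also have "((2 * v) * sqrt (?W v) + ?y v * ((4 * (1 + s) * v - 4 * v ^ 3) * (inverse (sqrt (?W v)) / 2))) / 4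
        + s * ((2 * v / ?c) * inverse (sqrt (1 - (?y v / ?c)\<^sup>2))) = v * sqrt (?W v)"
    proof -
      have R: "sqrt (?W v) > 0" "sqrt (?W v) * sqrt (?W v) = 4 * s - ?y v * ?y v"
        using W unfolding mp_weight_alt by (auto simp: power2_eq_square)
      have d: "4 * (1 + s) * v - 4 * v ^ 3 = - 4 * v * ?y v"
        by (simp add: power2_eq_square power3_eq_cube algebra_simps)
      have e1: "?y v * ((4 * (1 + s) * v - 4 * v ^ 3) * (inverse (sqrt (?W v)) / 2)) = - 2 * v * (?y v * ?y v) / sqrt (?W v)"
        unfolding d using R by (simp add: field_simps)
      have e2: "s * ((2 * v / ?c) * inverse (sqrt (1 - (?y v / ?c)\<^sup>2))) = 2 * v * s / sqrt (?W v)"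
        unfolding root using R c by (simp add: field_simps)
      have gen: "(2 * v * R + - 2 * v * (Y * Y) / R) / 4 + 2 * v * s / R = v * R"
        if "R > 0" "R * R = 4 * s - Y * Y" for R Y :: real
      proof -
        have "((2 * v * R + - 2 * v * (Y * Y) / R) / 4 + 2 * v * s / R) * R = v / 2 * (R * R - Y * Y + 4 * s)"
          using that(1) by (simp add: field_simps)
        also have "\<dots> = (v * R) * R" unfolding mult.assoc that(2) by (simp add: algebra_simps)
        finally show ?thesis using that(1) by simp
      qed
      show ?thesis unfolding e1 e2 by (rule gen[OF R])
    qed
    finally show "(?f has_vector_derivative v ^ (2 * 0 + 1) * sqrt (?W v)) (at v)"
      by (simp add: has_real_derivative_iff_has_vector_derivative)
  qed
  moreover have "?y (u_b s) = ?c" "?y (l_b s) = - ?c"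
    using sqrt_s_sq by (simp_all add: u_b_def l_b_def power2_eq_square algebra_simps)
  ultimately have "((\<lambda>v. v ^ (2 * 0 + 1) * sqrt (?W v)) has_integral (s * arcsin 1 - s * arcsin (- 1))) {l_b s..u_b s}"
    using c by (simp add: mp_weight_edges)
  from has_integral_unique[OF this mp_integral_has_integral[of 0]]
  show ?thesis by simp
qed

end

text \<open>By the quotient rule the derivative of \<open>R * R / D\<close> is
  \<open>R / D^2\<close> times the difference of the two sides of \<open>ode\<close>, hence zero.
  The quotient is therefore constant, with value 1 read off at 0.\<close>

lemma fps_square_from_ode:
  fixes R D :: "real fps"
  assumes ode: "2 * D * fps_deriv R = fps_deriv D * R" and D0: "fps_nth D 0 = 1" and R0: "fps_nth R 0 = 1"
  shows "R * R = D"
proof -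
  have unit: "D * inverse D = 1" by (rule inverse_mult_eq_1') (simp add: D0)
  have alg: "R * R * (- d * i\<^sup>2) + (R * r + r * R) * i = (2 * R * r) * i - R * R * d * (i * i)" for r d i :: "real fps"
    by (simp add: power2_eq_square algebra_simps)
  have "fps_deriv (inverse D) = - fps_deriv D * (inverse D)\<^sup>2"
    by (rule fps_inverse_deriv) (simp add: D0)
  then have "fps_deriv (R * R * inverse D) = (2 * R * fps_deriv R) * inverse D - R * R * fps_deriv D * (inverse D * inverse D)"
    by (simp only: fps_deriv_mult alg)
  also have "(2 * R * fps_deriv R) * inverse D = (2 * R * fps_deriv R) * inverse D * (D * inverse D)"
    unfolding unit by simp
  also have "\<dots> = R * (2 * D * fps_deriv R) * (inverse D * inverse D)"
    by (simp only: mult_ac)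
  also have "\<dots> = R * R * fps_deriv D * (inverse D * inverse D)"
    unfolding ode by (simp only: mult_ac)
  finally have "R * R * inverse D = fps_const (fps_nth (R * R * inverse D) 0)"
    by (simp only: diff_self fps_deriv_eq_0_iff)
  also have "fps_nth (R * R * inverse D) 0 = 1" by (simp add: D0 R0)
  finally have "R * R * (inverse D * D) = D" by (simp add: mult.assoc[symmetric])
  then show ?thesis using unit by (simp add: mult.commute[of "inverse D"])
qed

section \<open>From the linear to the quadratic recursion\<close>

context
  fixes s :: real
  assumes s: "0 < s" "s \<le> 1"
begin

definition "mp_ratio p = mp_integral s p / (pi * s)"

text \<open>With \<open>m(x)\<close> the generating series of \<open>mp_ratio\<close>, these are the
  coefficients of \<open>1 - (1 + s) x - 2 s x^2 m(x)\<close>. Solving the desired quadratic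
  equation for \<open>m\<close> would make this series the square root of
  \<open>1 - 2 (1 + s) x + (1 - s)^2 x^2\<close>.\<close>

fun sqrt_coeff :: "nat \<Rightarrow> real" where
  "sqrt_coeff 0 = 1"
| "sqrt_coeff (Suc 0) = - (1 + s)"
| "sqrt_coeff (Suc (Suc p)) = - 2 * s * mp_ratio p"

lemma mp_ratio_rec:
  "(real p + 3) * mp_ratio (Suc p) =
    (2 * real p + 3) * (1 + s) * mp_ratio p - real p * (1 - s)\<^sup>2 * mp_ratio (p - 1)"
  using arg_cong[OF mp_integral_rec[OF s, of p], of "\<lambda>x. x / (pi * s)"] by (simp add: mp_ratio_def diff_divide_distrib)

lemma mp_ratio_0: "mp_ratio 0 = 1"
  using s by (simp add: mp_ratio_def mp_integral_0[OF s])

text \<open>Coefficient form of \<open>2 D R' = D' R\<close>. From \<open>p = 2\<close> on it is the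
  recursion of the integrals shifted by two; the cases \<open>p = 0\<close> and \<open>p = 1\<close>
  rest on the choice of the first two coefficients. \<open>real p - 1\<close> is a real difference,
  equal to -1 at \<open>p = 0\<close>.\<close>

lemma sqrt_coeff_rec:
  "(real p + 2) * sqrt_coeff (Suc (Suc p)) =
    (1 + s) * (2 * real p + 1) * sqrt_coeff (Suc p) - (1 - s)\<^sup>2 * (real p - 1) * sqrt_coeff p"
proof -
  consider "p = 0" | "p = 1" | q where "p = Suc (Suc q)" by (metis One_nat_def not0_implies_Suc)
  then show ?thesis
  proof cases
    case 1
    then show ?thesis by (simp add: mp_ratio_0 power2_eq_square algebra_simps)
  next
    case 2
    then show ?thesis using mp_ratio_rec[of 0] by (simp add: mp_ratio_0)
  next
    case (3 q)
    then show ?thesis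
      using arg_cong[OF mp_ratio_rec[of "Suc q"], of "\<lambda>x. - 2 * s * x"] by (simp add: algebra_simps)
  qed
qed

text \<open>The three-term recursion of the integrals says that the generating series \<open>R\<close> below solves
  \<open>2 D R' = D' R\<close>; hence \<open>R\<^sup>2 = D\<close>, which is the quadratic recursion of the moments.\<close>

lemma sqrt_coeff_convolution:
  assumes "p \<ge> 3"
  shows "(\<Sum>i=0..p. sqrt_coeff i * sqrt_coeff (p - i)) = 0"
proof -
  let ?R = "Abs_fps sqrt_coeff"
  let ?D = "1 - fps_const (2 * (1 + s)) * fps_X + fps_const ((1 - s)\<^sup>2) * fps_X\<^sup>2 :: real fps"
  have D': "fps_deriv ?D = - fps_const (2 * (1 + s)) + fps_const (2 * (1 - s)\<^sup>2) * fps_X"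
    by (simp add: power2_eq_square algebra_simps flip: fps_const_mult)
  have ode: "2 * ?D * fps_deriv ?R = fps_deriv ?D * ?R"
  proof (rule fps_ext)
    fix k
    have "2 * ?D * fps_deriv ?R = fps_const 2 * (fps_deriv ?R - fps_const (2 * (1 + s)) * (fps_X * fps_deriv ?R) +
        fps_const ((1 - s)\<^sup>2) * (fps_X ^ 2 * fps_deriv ?R))"
      unfolding fps_numeral_fps_const by (simp only: algebra_simps mult_1_left mult_1_right)
    then have l: "fps_nth (2 * ?D * fps_deriv ?R) k = 2 * (fps_nth (fps_deriv ?R) k -
        2 * (1 + s) * (if k = 0 then 0 else fps_nth (fps_deriv ?R) (k - 1)) +
        (1 - s)\<^sup>2 * (if k < 2 then 0 else fps_nth (fps_deriv ?R) (k - 2)))"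
      by (simp only: fps_mult_left_const_nth fps_add_nth fps_sub_nth fps_X_mult_nth fps_X_power_mult_nth)
    have "fps_deriv ?D * ?R = - (fps_const (2 * (1 + s)) * ?R) + fps_const (2 * (1 - s)\<^sup>2) * (fps_X * ?R)"
      unfolding D' by (simp only: algebra_simps mult_minus_right)
    then have r: "fps_nth (fps_deriv ?D * ?R) k = - 2 * (1 + s) * fps_nth ?R k +
        2 * (1 - s)\<^sup>2 * (if k = 0 then 0 else fps_nth ?R (k - 1))"
      by (simp only: fps_mult_left_const_nth fps_add_nth fps_neg_nth fps_X_mult_nth)
    consider "k = 0" | "k = 1" | q where "k = Suc (Suc q)" by (metis One_nat_def not0_implies_Suc)
    then show "fps_nth (2 * ?D * fps_deriv ?R) k = fps_nth (fps_deriv ?D * ?R) k"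
    proof cases
      case 1
      then show ?thesis unfolding l r by simp
    next
      case 2
      then show ?thesis unfolding l r using sqrt_coeff_rec[of 0] by (simp add: algebra_simps)
    next
      case (3 q)
      then show ?thesis unfolding l r using sqrt_coeff_rec[of "Suc q"]
        by (simp add: algebra_simps del: sqrt_coeff.simps)
    qed
  qed
  have "?R * ?R = ?D"
  proof (rule fps_square_from_ode[OF ode])
    show "fps_nth ?R 0 = 1" by (simp only: fps_nth_Abs_fps sqrt_coeff.simps)
    show "fps_nth ?D 0 = 1"
      by (simp only: fps_add_nth fps_sub_nth fps_mult_left_const_nth fps_X_nth fps_X_power_nth fps_one_nth) simp
  qed
  then have "fps_nth (?R * ?R) p = fps_nth ?D p" by (simp only:)
  also have "fps_nth ?D p = 0"
    using assms by (simp only: fps_add_nth fps_sub_nth fps_mult_left_const_nth fps_X_nth fps_X_power_nth fps_one_nth) simp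
  finally show ?thesis by (simp only: fps_mult_nth fps_nth_Abs_fps)
qed

text \<open>Serves to separate the terms of the convolution that contain one of the first two
  coefficients, which are not multiples of some \<open>mp_ratio\<close>.\<close>

lemma sum_four_ends:
  fixes f :: "nat \<Rightarrow> real"
  shows "(\<Sum>i=0..Suc (Suc (Suc p)). f i) = f 0 + f 1 + (\<Sum>i<p. f (Suc (Suc i))) + f (Suc (Suc p)) + f (Suc (Suc (Suc p)))"
  by (induction p) simp_all

text \<open>The coefficient of \<open>x^(p+3)\<close> in \<open>R^2 = D\<close> vanishes; cancelling
  \<open>4 s\<close> in it leaves this recursion.\<close>

lemma mp_ratio_quadratic:
  "mp_ratio (Suc p) = (1 + s) * mp_ratio p + s * (\<Sum>i<p. mp_ratio i * mp_ratio (p - 1 - i))"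
proof -
  let ?f = "\<lambda>i. sqrt_coeff i * sqrt_coeff (Suc (Suc (Suc p)) - i)"
  have "(\<Sum>i<p. ?f (Suc (Suc i))) = (\<Sum>i<p. 4 * s\<^sup>2 * (mp_ratio i * mp_ratio (p - 1 - i)))"
  proof (rule sum.cong)
    fix i assume "i \<in> {..<p}"
    then have "Suc (Suc (Suc p)) - Suc (Suc i) = Suc (Suc (p - 1 - i))" by auto
    then show "?f (Suc (Suc i)) = 4 * s\<^sup>2 * (mp_ratio i * mp_ratio (p - 1 - i))"
      by (simp only: sqrt_coeff.simps) (simp add: power2_eq_square)
  qed simp
  moreover have "(\<Sum>i=0..Suc (Suc (Suc p)). ?f i) =
      ?f 0 + ?f 1 + (\<Sum>i<p. ?f (Suc (Suc i))) + ?f (Suc (Suc p)) + ?f (Suc (Suc (Suc p)))"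
    by (rule sum_four_ends)
  ultimately have "?f 0 + ?f 1 + 4 * s\<^sup>2 * (\<Sum>i<p. mp_ratio i * mp_ratio (p - 1 - i)) + ?f (Suc (Suc p)) + ?f (Suc (Suc (Suc p))) = 0"
    using sqrt_coeff_convolution[of "Suc (Suc (Suc p))"] by (simp only: sum_distrib_left)
  then have "4 * s * (s * (\<Sum>i<p. mp_ratio i * mp_ratio (p - 1 - i)) + (1 + s) * mp_ratio p - mp_ratio (Suc p)) = 0"
    by (simp add: power2_eq_square algebra_simps)
  then show ?thesis using s by simp
qed

end

text \<open>Moment \<open>p\<close> of the law in the variable \<open>x = u^2\<close>; the shift by
  one matches \<open>mp_integral\<close>. The value at 0 is the mass 1, fixed here by definition and
  not computed from an integral.\<close>

definition mp_moment :: "real \<Rightarrow> nat \<Rightarrow> real" where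
  "mp_moment s p = (case p of 0 \<Rightarrow> 1 | Suc q \<Rightarrow> mp_integral s q / (pi * s))"

text \<open>The summand \<open>a = 0\<close> supplies the \<open>s\<close> in the coefficient
  \<open>1 + s\<close> of \<open>mp_ratio_quadratic\<close>; the other summands agree after shifting
  the index by one.\<close>

lemma mp_moment_Suc:
  assumes s: "0 < s" "s \<le> 1"
  shows "mp_moment s (Suc q) = mp_moment s q + s * (\<Sum>a<q. mp_moment s a * mp_moment s (q - a))"
proof (cases q)
  case 0
  then show ?thesis using mp_integral_0[OF s] s by (simp add: mp_moment_def)
next
  case (Suc p)
  have m: "mp_moment s (Suc i) = mp_ratio s i" for i by (simp add: mp_moment_def mp_ratio_def[OF s])
  have "(\<Sum>a<q. mp_moment s a * mp_moment s (q - a)) = mp_ratio s p + (\<Sum>i<p. mp_ratio s i * mp_ratio s (p - 1 - i))"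
  proof -
    have "(\<Sum>i<p. mp_moment s (Suc i) * mp_moment s (Suc p - Suc i)) = (\<Sum>i<p. mp_ratio s i * mp_ratio s (p - 1 - i))"
    proof (rule sum.cong)
      fix i assume "i \<in> {..<p}"
      then have "Suc p - Suc i = Suc (p - 1 - i)" by auto
      then show "mp_moment s (Suc i) * mp_moment s (Suc p - Suc i) = mp_ratio s i * mp_ratio s (p - 1 - i)"
        by (simp only: m)
    qed simp
    moreover have "mp_moment s 0 = 1" by (simp add: mp_moment_def)
    ultimately show ?thesis
      unfolding Suc sum.lessThan_Suc_shift by (simp only: diff_zero m mult_1_left)
  qed
  then show ?thesis
    unfolding Suc m mp_ratio_quadratic[OF s] by (simp add: algebra_simps)
qed

interpretation mp: moment_sequence mp_moment
  by standard (simp_all add: mp_moment_Suc, simp add: mp_moment_def)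

section \<open>Singular values\<close>

lemma pow_mat_upper_triangular_diag:
  fixes B :: "'a::comm_semiring_1 mat"
  assumes B: "B \<in> carrier_mat n n" and ut: "upper_triangular B" and i: "i < n"
  shows "(B ^\<^sub>m k) $$ (i, i) = (B $$ (i, i)) ^ k"
proof -
  have lower: "B $$ (i, j) = 0" if "j < i" "i < n" for i j
    using ut that B by (auto simp: upper_triangular_def)
  have "(\<forall>i<n. \<forall>j<i. (B ^\<^sub>m k) $$ (i, j) = 0) \<and> (\<forall>i<n. (B ^\<^sub>m k) $$ (i, i) = (B $$ (i, i)) ^ k)"
  proof (induction k)
    case 0
    show ?case using B by auto
  next
    case (Suc k)
    have e: "(B ^\<^sub>m Suc k) $$ (i, j) = (\<Sum>l<n. (B ^\<^sub>m k) $$ (i, l) * B $$ (l, j))" if "i < n" "j < n" for i j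
      using index_mult_sum[OF pow_carrier_mat[OF B] B that] by simp
    have z: "(B ^\<^sub>m k) $$ (i, l) * B $$ (l, j) = 0" if "i < n" "l < n" "j \<le> i" "l \<noteq> i \<or> j \<noteq> i" for i j l
      using Suc lower[of j l] that by (cases "l < i") auto
    have "(B ^\<^sub>m Suc k) $$ (i, j) = 0" if "i < n" "j < i" for i j
      unfolding e[OF that(1) less_trans[OF that(2,1)]]
      using that z by (intro sum.neutral) auto
    moreover have "(B ^\<^sub>m Suc k) $$ (i, i) = (B $$ (i, i)) ^ Suc k" if "i < n" for i
    proof -
      have "(\<Sum>l<n. (B ^\<^sub>m k) $$ (i, l) * B $$ (l, i)) = (\<Sum>l\<in>{i}. (B ^\<^sub>m k) $$ (i, l) * B $$ (l, i))"
        using that z by (intro sum.mono_neutral_right) auto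
      then show ?thesis unfolding e[OF that that] using Suc that by (simp add: mult.commute)
    qed
    ultimately show ?case by blast
  qed
  then show ?thesis using i by blast
qed

lemma mtrace_similar_mat_wit:
  fixes A B :: "'a::comm_ring_1 mat"
  assumes A: "A \<in> carrier_mat n n" and sim: "similar_mat_wit A B P Q"
  shows "mtrace A = mtrace B"
proof -
  from similar_mat_witD2[OF A sim]
  have eq: "Q * P = 1\<^sub>m n" "A = P * B * Q" and c: "B \<in> carrier_mat n n" "P \<in> carrier_mat n n" "Q \<in> carrier_mat n n"
    by auto
  have "mtrace A = mtrace (P * (B * Q))"
    unfolding eq(2) by (simp only: assoc_mult_mat[OF c(2,1,3)])
  also have "\<dots> = mtrace (B * Q * P)"
    by (rule mtrace_comm[OF c(2) mult_carrier_mat[OF c(1,3)]])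
  also have "B * Q * P = B"
    unfolding assoc_mult_mat[OF c(1,3,2)] eq(1) by (rule right_mult_one_mat[OF c(1)])
  finally show ?thesis .
qed

text \<open>Schur triangularisation: similarity passes to powers and preserves traces, and a power
  of a triangular matrix has the powers of the diagonal on its diagonal. Multiplicities are thus
  those of the characteristic polynomial, without diagonalising \<open>A\<close>.\<close>

lemma mtrace_pow_eigenvalues:
  fixes A :: "real mat"
  assumes A: "A \<in> carrier_mat n n" and es: "char_poly A = (\<Prod>e\<leftarrow>es. [:- e, 1:])"
  shows "mtrace (A ^\<^sub>m k) = (\<Sum>e\<leftarrow>es. e ^ k)"
proof -
  obtain B P Q where "schur_decomposition A es = (B, P, Q)" by (metis prod_cases3)
  from schur_decomposition[OF A es this]
  have sim: "similar_mat_wit A B P Q" and ut: "upper_triangular B" and d: "diag_mat B = es" by auto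
  have B: "B \<in> carrier_mat n n" using similar_mat_witD2[OF A sim] by auto
  have "mtrace (A ^\<^sub>m k) = mtrace (B ^\<^sub>m k)"
    by (rule mtrace_similar_mat_wit[OF pow_carrier_mat[OF A] similar_mat_wit_pow[OF sim]])
  also have "\<dots> = (\<Sum>i<n. (B $$ (i, i)) ^ k)"
    unfolding mtrace_def using pow_mat_upper_triangular_diag[OF B ut] B by simp
  also have "\<dots> = (\<Sum>e\<leftarrow>es. e ^ k)"
    unfolding d[symmetric] diag_mat_def using B by (simp add: interv_sum_list_conv_sum_set_nat o_def lessThan_atLeast0)
  finally show ?thesis .
qed

text \<open>For an eigenvector \<open>v\<close> and \<open>w = G^T v\<close>, pairing the eigenvalue
  equation with \<open>v\<close> gives \<open>a |v|^2 = |w|^2\<close>. The computation is complex,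
  since roots are first available there, and yields reality and sign together.\<close>

lemma gram_eigenvalue_nonneg:
  fixes G :: "real mat" and a :: complex
  assumes G: "G \<in> carrier_mat n m"
    and ev: "eigenvalue (map_mat of_real (G * transpose_mat G)) a"
  shows "a \<in> \<real>" "0 \<le> Re a"
proof -
  let ?A = "G * transpose_mat G"
  have A: "?A \<in> carrier_mat n n" using G by (intro mult_carrier_mat) auto
  obtain v where v: "v \<in> carrier_vec n" "v \<noteq> 0\<^sub>v n" "map_mat of_real ?A *\<^sub>v v = a \<cdot>\<^sub>v v"
    using ev A by (auto simp: eigenvalue_def eigenvector_def)
  define w where "w l = (\<Sum>j<n. of_real (G $$ (j, l)) * v $ j)" for l
  have Av: "(\<Sum>l<m. of_real (G $$ (i, l)) * w l) = a * v $ i" if i: "i < n" for i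
  proof -
    have "(a \<cdot>\<^sub>v v) $ i = (\<Sum>j<n. of_real (?A $$ (i, j)) * v $ j)"
      unfolding v(3)[symmetric] using i v(1) G
      by (simp add: scalar_prod_def lessThan_atLeast0 del: index_mult_mat(1))
    also have "\<dots> = (\<Sum>j<n. \<Sum>l<m. of_real (G $$ (i, l)) * of_real (G $$ (j, l)) * v $ j)"
    proof (intro sum.cong refl)
      fix j assume "j \<in> {..<n}"
      then show "of_real (?A $$ (i, j)) * v $ j = (\<Sum>l<m. of_real (G $$ (i, l)) * of_real (G $$ (j, l)) * v $ j)"
        using index_mult_sum[OF G transpose_carrier_mat[THEN iffD2, OF G] i, of j] G
        by (simp add: sum_distrib_right del: index_mult_mat(1))
    qed
    also have "\<dots> = (\<Sum>l<m. of_real (G $$ (i, l)) * w l)"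
      unfolding w_def sum_distrib_left by (subst sum.swap) (simp add: mult.assoc)
    finally show ?thesis using i v(1) by simp
  qed
  have "a * (\<Sum>i<n. v $ i * cnj (v $ i)) = (\<Sum>i<n. cnj (v $ i) * (\<Sum>l<m. of_real (G $$ (i, l)) * w l))"
    unfolding sum_distrib_left[of a] by (intro sum.cong refl) (subst Av, auto simp: mult_ac)
  also have "\<dots> = (\<Sum>l<m. w l * cnj (w l))"
    unfolding w_def cnj_sum sum_distrib_left
    by (subst sum.swap) (simp add: sum_distrib_left sum_distrib_right mult_ac)
  also have "\<dots> = of_real (\<Sum>l<m. (cmod (w l))\<^sup>2)"
    by (simp only: of_real_sum complex_norm_square)
  also have "(\<Sum>i<n. v $ i * cnj (v $ i)) = of_real (\<Sum>i<n. (cmod (v $ i))\<^sup>2)"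
    by (simp only: of_real_sum complex_norm_square)
  finally have eq: "a * of_real (\<Sum>i<n. (cmod (v $ i))\<^sup>2) = of_real (\<Sum>l<m. (cmod (w l))\<^sup>2)" .
  obtain i where i: "i < n" "v $ i \<noteq> 0"
    using v(1,2) by (metis carrier_vecD eq_vecI index_zero_vec(1) index_zero_vec(2))
  have "0 < (cmod (v $ i))\<^sup>2" using i by simp
  also have "\<dots> \<le> (\<Sum>i<n. (cmod (v $ i))\<^sup>2)"
    by (rule member_le_sum) (use i in auto)
  finally have pos: "0 < (\<Sum>i<n. (cmod (v $ i))\<^sup>2)" .
  have "z = complex_of_real (k / n)" if "z * of_real n = of_real k" "0 < n" for z k n
    using that by (simp add: field_simps)
  from this[OF eq pos] have "a = of_real ((\<Sum>l<m. (cmod (w l))\<^sup>2) / (\<Sum>i<n. (cmod (v $ i))\<^sup>2))" .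
  then obtain r where r: "a = of_real r" "r = (\<Sum>l<m. (cmod (w l))\<^sup>2) / (\<Sum>i<n. (cmod (v $ i))\<^sup>2)" by blast
  then show "a \<in> \<real>" by simp
  have "0 \<le> r" unfolding r(2) by (intro divide_nonneg_nonneg sum_nonneg) auto
  then show "0 \<le> Re a" using r(1) by simp
qed

lemma map_poly_linear_factors:
  "map_poly complex_of_real (\<Prod>e\<leftarrow>es. [:- e, 1:]) = (\<Prod>e\<leftarrow>es. [:- complex_of_real e, 1:])"
proof -
  interpret h: map_poly_comm_ring_hom complex_of_real ..
  show ?thesis by (induction es) (simp_all add: h.hom_mult del: mult_pCons_left)
qed

text \<open>The characteristic polynomial splits over the complex numbers with real roots; comparing
  coefficients under the injective embedding brings the factorisation back to the reals.\<close>

lemma gram_eigenvalues: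
  fixes G :: "real mat"
  assumes G: "G \<in> carrier_mat n m"
  obtains es where "char_poly (G * transpose_mat G) = (\<Prod>e\<leftarrow>es. [:- e, 1:])" "length es = n" "\<forall>e\<in>set es. 0 \<le> e"
proof -
  let ?A = "G * transpose_mat G"
  have A: "?A \<in> carrier_mat n n" using G by (intro mult_carrier_mat) auto
  have cA: "map_mat complex_of_real ?A \<in> carrier_mat n n" using A by simp
  obtain as where as: "char_poly (map_mat complex_of_real ?A) = (\<Prod>a\<leftarrow>as. [:- a, 1:])" "length as = n"
    using char_poly_factorized[OF cA] by blast
  have real: "a \<in> \<real> \<and> 0 \<le> Re a" if "a \<in> set as" for a
  proof -
    have "poly (char_poly (map_mat complex_of_real ?A)) a = 0"
      unfolding as(1) using that by (induction as) auto
    then have "eigenvalue (map_mat of_real ?A) a" using eigenvalue_root_char_poly[OF cA] by simp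
    then show ?thesis using gram_eigenvalue_nonneg[OF G] by blast
  qed
  have as': "map complex_of_real (map Re as) = as"
    using real by (auto intro!: map_idI simp: of_real_Re)
  have "map_poly complex_of_real (\<Prod>e\<leftarrow>map Re as. [:- e, 1:]) = (\<Prod>a\<leftarrow>map complex_of_real (map Re as). [:- a, 1:])"
    unfolding map_poly_linear_factors by (simp add: o_def)
  also have "\<dots> = map_poly complex_of_real (char_poly ?A)"
    unfolding as' of_real_hom.char_poly_hom[OF A, symmetric] as(1) ..
  finally have eq: "map_poly complex_of_real (\<Prod>e\<leftarrow>map Re as. [:- e, 1:]) = map_poly complex_of_real (char_poly ?A)" .
  have "char_poly ?A = (\<Prod>e\<leftarrow>map Re as. [:- e, 1:])"
  proof (rule poly_eqI)
    fix i
    show "coeff (char_poly ?A) i = coeff (\<Prod>e\<leftarrow>map Re as. [:- e, 1:]) i"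
      using arg_cong[OF eq, of "\<lambda>p. coeff p i"] by (simp only: coeff_map_poly of_real_0 of_real_eq_iff)
  qed
  then show ?thesis using that[of "map Re as"] as(2) real by auto
qed

lemma proots_linear_factors: "proots (\<Prod>e\<leftarrow>es. [:- e, 1:]) = mset es" for es :: "'a::idom list"
proof (induction es)
  case (Cons e es)
  have "(\<Prod>e\<leftarrow>es. [:- e, 1:]) \<noteq> 0" by (auto simp: prod_list_zero_iff)
  then have "proots ([:- e, 1:] * (\<Prod>e\<leftarrow>es. [:- e, 1:])) = proots [:- e, 1:] + proots (\<Prod>e\<leftarrow>es. [:- e, 1:])"
    by (intro proots_mult) auto
  then show ?case using Cons by (simp del: mult_pCons_left)
qed simp

text \<open>Trades the sorted definition for an unordered list of eigenvalues: symmetric sums do not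
  see the order, which survives only as monotonicity, for the rearrangement.\<close>

lemma singular_values:
  assumes "A \<in> carrier_mat n m"
  obtains es where "length es = n" "\<forall>e\<in>set es. 0 \<le> e"
    "\<And>g :: real \<Rightarrow> real. (\<Sum>i<n. g (singular_value A i)) = (\<Sum>e\<leftarrow>es. g (sqrt e))"
    "\<And>k. mtrace ((A * transpose_mat A) ^\<^sub>m k) = (\<Sum>e\<leftarrow>es. e ^ k)"
    "\<And>i j. i \<le> j \<Longrightarrow> j < n \<Longrightarrow> singular_value A j \<le> singular_value A i"
proof -
  obtain es where es: "char_poly (A * transpose_mat A) = (\<Prod>e\<leftarrow>es. [:- e, 1:])" "length es = n" "\<forall>e\<in>set es. 0 \<le> e"
    using gram_eigenvalues[OF assms] .
  have AA: "A * transpose_mat A \<in> carrier_mat n n" using assms by (intro mult_carrier_mat) auto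
  let ?L = "rev (sort (map sqrt es))"
  have s: "singular_value A i = ?L ! i" for i
    unfolding singular_value_def es(1) proots_linear_factors by (simp flip: mset_map)
  show ?thesis
  proof (rule that[OF es(2,3)])
    fix g :: "real \<Rightarrow> real"
    have "(\<Sum>i<n. g (singular_value A i)) = (\<Sum>x\<leftarrow>?L. g x)"
      unfolding s using es(2) by (simp add: sum_list_sum_nth lessThan_atLeast0)
    also have "\<dots> = (\<Sum>x\<in>#mset ?L. g x)" by (simp only: sum_mset_sum_list[symmetric] mset_map)
    also have "mset ?L = mset (map sqrt es)" by simp
    also have "(\<Sum>x\<in>#mset (map sqrt es). g x) = (\<Sum>e\<leftarrow>es. g (sqrt e))"
      by (simp only: mset_map[symmetric] sum_mset_sum_list map_map o_def)
    finally show "(\<Sum>i<n. g (singular_value A i)) = (\<Sum>e\<leftarrow>es. g (sqrt e))" .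
  next
    show "mtrace ((A * transpose_mat A) ^\<^sub>m k) = (\<Sum>e\<leftarrow>es. e ^ k)" for k
      by (rule mtrace_pow_eigenvalues[OF AA es(1)])
  next
    fix i j assume "i \<le> j" "j < n"
    then show "singular_value A j \<le> singular_value A i"
      unfolding s using sorted_nth_mono[OF sorted_sort, of "length es - Suc j" "length es - Suc i" "map sqrt es"] es(2)
      by (simp add: rev_nth)
  qed
qed

lemma desc_entry_antimono:
  fixes f :: "real vec"
  assumes "f \<in> carrier_vec n" "i \<le> j" "j < n"
  shows "desc_entry f j \<le> desc_entry f i"
  unfolding desc_entry_def
  using assms sorted_nth_mono[OF sorted_sort, of "n - Suc j" "n - Suc i" "list_of_vec f"]
  by (auto simp: rev_nth)

lemma desc_entry_nonneg:
  fixes f :: "real vec"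
  assumes "f \<in> carrier_vec n" "\<And>i. i < n \<Longrightarrow> 0 \<le> f $ i" "i < n"
  shows "0 \<le> desc_entry f i"
proof -
  have "desc_entry f i \<in> set (rev (sort (list_of_vec f)))"
    unfolding desc_entry_def using assms by (intro nth_mem) auto
  then obtain j where "j < n" "desc_entry f i = f $ j"
    using assms(1) by (auto simp: in_set_conv_nth list_of_vec_index)
  then show ?thesis using assms(2) by simp
qed

section \<open>Rearrangement and one-sided polynomial approximation\<close>

definition sq_excess :: "real \<Rightarrow> real" where
  "sq_excess x = (pos_part x)\<^sup>2"

lemma sq_excess_mono: "x \<le> y \<Longrightarrow> sq_excess x \<le> sq_excess y"
  unfolding sq_excess_def pos_part_def by (intro power_mono) auto

lemma sq_excess_nonneg: "0 \<le> sq_excess x"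
  by (simp add: sq_excess_def)

text \<open>Convexity of the positive part gives \<open>?B \<le> ?C + ?X - ?A\<close>. After
  squaring, the remaining defect is \<open>2 (?C - ?A) (?A - ?X)\<close>, whose factors are
  nonnegative by monotonicity.\<close>

lemma sq_excess_exchange:
  assumes "0 \<le> d" "0 \<le> e"
  shows "sq_excess (x + d) + sq_excess (x + e) \<le> sq_excess (x + d + e) + sq_excess x"
proof -
  let ?A = "pos_part (x + d)" and ?B = "pos_part (x + e)" and ?C = "pos_part (x + d + e)" and ?X = "pos_part x"
  have le: "?X \<le> ?A" "?A \<le> ?C" "?B \<le> ?C + ?X - ?A" "0 \<le> ?B"
    using assms by (auto simp: pos_part_def)
  have "?B\<^sup>2 \<le> (?C + ?X - ?A)\<^sup>2" using le by (intro power_mono) auto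
  moreover have "0 \<le> (?C - ?A) * (?A - ?X)" using le by (intro mult_nonneg_nonneg) auto
  moreover have "?C\<^sup>2 + ?X\<^sup>2 - ?A\<^sup>2 - (?C + ?X - ?A)\<^sup>2 = 2 * ((?C - ?A) * (?A - ?X))"
    by (simp add: power2_eq_square algebra_simps)
  ultimately show ?thesis unfolding sq_excess_def by linarith
qed

text \<open>The argument of Chebyshev's sum inequality: for each pair of indices the sorted pairing
  is compared with the crossed one, and both are summed over all \<open>n^2\<close> pairs. The
  exchange inequality is used with \<open>x = a j - b i\<close>, \<open>d = a i - a j\<close> and
  \<open>e = b i - b j\<close>.\<close>

lemma sum_sq_excess_sorted_le:
  fixes a b :: "nat \<Rightarrow> real"
  assumes a: "\<And>i j. i \<le> j \<Longrightarrow> j < n \<Longrightarrow> a j \<le> a i" and b: "\<And>i j. i \<le> j \<Longrightarrow> j < n \<Longrightarrow> b j \<le> b i"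
  shows "real n * (\<Sum>i<n. sq_excess (a i - b i)) \<le> (\<Sum>i<n. \<Sum>j<n. sq_excess (a j - b i))"
proof -
  have swap: "sq_excess (a i - b i) + sq_excess (a j - b j) \<le> sq_excess (a i - b j) + sq_excess (a j - b i)"
    if "i \<le> j" "j < n" for i j
    using sq_excess_exchange[of "a i - a j" "b i - b j" "a j - b i"] a[OF that] b[OF that] by simp
  have swap': "sq_excess (a i - b i) + sq_excess (a j - b j) \<le> sq_excess (a i - b j) + sq_excess (a j - b i)"
    if "i < n" "j < n" for i j
    using swap[of i j] swap[of j i] that by (cases "i \<le> j") auto
  have "(\<Sum>i<n. \<Sum>j<n. sq_excess (a i - b i) + sq_excess (a j - b j)) \<le>
      (\<Sum>i<n. \<Sum>j<n. sq_excess (a i - b j) + sq_excess (a j - b i))"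
    by (intro sum_mono swap') auto
  moreover have "(\<Sum>i<n. \<Sum>j<n. sq_excess (a i - b j)) = (\<Sum>i<n. \<Sum>j<n. sq_excess (a j - b i))"
    by (rule sum.swap)
  ultimately show ?thesis by (simp add: sum.distrib sum_distrib_left[symmetric])
qed

section \<open>One-sided polynomial approximation on the half-line\<close>

lemma polynomial_dominated:
  fixes a :: "nat \<Rightarrow> real"
  assumes "1 \<le> x"
  shows "1 + (\<Sum>i\<le>n. \<bar>a i\<bar> * x ^ i) \<le> (1 + (\<Sum>i\<le>n. \<bar>a i\<bar>)) * x ^ n"
proof -
  have "(\<Sum>i\<le>n. \<bar>a i\<bar> * x ^ i) \<le> (\<Sum>i\<le>n. \<bar>a i\<bar> * x ^ n)"
    using assms by (intro sum_mono mult_left_mono power_increasing) auto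
  moreover have "1 \<le> x ^ n" using assms by simp
  ultimately show ?thesis by (simp add: distrib_right sum_distrib_right)
qed

text \<open>The power \<open>(2 x / 9) ^ M\<close> is negligible on \<open>[0, 4]\<close> and beats the approximating
  polynomial beyond \<open>5\<close>; this makes the Weierstrass approximation on \<open>[0, 5]\<close> one-sided on \<open>[0, \<infinity>)\<close>.\<close>

lemma one_sided_polynomial_approx:
  fixes k :: "real \<Rightarrow> real"
  assumes cont: "continuous_on {0..5} k" and k1: "\<And>x. k x \<le> 1" and \<epsilon>: "0 < \<epsilon>"
  obtains a :: "nat \<Rightarrow> real" and N where
    "\<And>x. 0 \<le> x \<Longrightarrow> k x \<le> (\<Sum>i\<le>N. a i * x ^ i)"
    "\<And>x. 0 \<le> x \<Longrightarrow> x \<le> 4 \<Longrightarrow> (\<Sum>i\<le>N. a i * x ^ i) \<le> k x + \<epsilon>"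
proof -
  obtain g where g: "real_polynomial_function g" "\<And>x. x \<in> {0..5} \<Longrightarrow> \<bar>k x - g x\<bar> < \<epsilon> / 4"
    using Stone_Weierstrass_real_polynomial_function[OF compact_Icc cont, of "\<epsilon> / 4"] \<epsilon> by auto
  obtain b n where b: "g = (\<lambda>x. \<Sum>i\<le>n. b i * x ^ i)"
    using g(1) unfolding real_polynomial_function_iff_sum by blast
  define C where "C = 1 + (\<Sum>i\<le>n. \<bar>b i\<bar>)"
  have C: "C \<ge> 1" unfolding C_def by (simp add: sum_nonneg)
  \<comment> \<open>Beyond 5 the base \<open>2 / 9 * x\<close> is at least \<open>10 / 9\<close>,
    and \<open>(9 / 2) ^ n\<close> turns \<open>(2 / 9 * x) ^ n\<close> back into
    \<open>x ^ n\<close>; up to 4 the base is at most \<open>8 / 9\<close>. The budget is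
    \<epsilon>/4 for the approximation, \<epsilon>/4 for the upward shift and \<epsilon>/2 for the
    power.\<close>
  obtain j1 where j1: "C * (9 / 2) ^ n < (10 / 9) ^ j1" using real_arch_pow[of "10 / 9"] by auto
  obtain j2 where j2: "(8 / 9) ^ j2 < \<epsilon> / 2" using real_arch_pow_inv[of "\<epsilon> / 2" "8 / 9"] \<epsilon> by auto
  define j where "j = j1 + j2"
  have j: "C * (9 / 2) ^ n \<le> (10 / 9) ^ j" "(8 / 9) ^ (n + j) \<le> \<epsilon> / 2"
  proof -
    have "(10 / 9) ^ j1 \<le> (10 / 9 :: real) ^ j" unfolding j_def by (intro power_increasing) auto
    with j1 show "C * (9 / 2) ^ n \<le> (10 / 9) ^ j" by linarith
    have "(8 / 9 :: real) ^ (n + j) \<le> (8 / 9) ^ j2" unfolding j_def by (intro power_decreasing) auto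
    with j2 show "(8 / 9) ^ (n + j) \<le> \<epsilon> / 2" by linarith
  qed
  define Q where "Q = (\<lambda>x. g x + \<epsilon> / 4 + (2 / 9 * x) ^ (n + j))"
  have "real_polynomial_function Q"
    unfolding Q_def by (intro real_polynomial_function.intros real_polynomial_function_power g bounded_linear_ident)
  then obtain a N where Q: "Q = (\<lambda>x. \<Sum>i\<le>N. a i * x ^ i)"
    unfolding real_polynomial_function_iff_sum by blast
  show ?thesis
  proof (rule that[of a N]; unfold fun_cong[OF Q, symmetric])
    fix x :: real assume x: "0 \<le> x"
    show "k x \<le> Q x"
    proof (cases "x \<le> 5")
      case True
      then have "\<bar>k x - g x\<bar> < \<epsilon> / 4" using x by (intro g(2)) auto
      then have "k x \<le> g x + \<epsilon> / 4" by linarith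
      moreover have "0 \<le> (2 / 9 * x) ^ (n + j)" using x by simp
      ultimately show ?thesis unfolding Q_def by linarith
    next
      case False
      have "(10 / 9) ^ j \<le> (2 / 9 * x) ^ j" using False by (intro power_mono) auto
      then have "C * (9 / 2) ^ n \<le> (2 / 9 * x) ^ j" using j(1) by linarith
      then have "C * (9 / 2) ^ n * (2 / 9 * x) ^ n \<le> (2 / 9 * x) ^ j * (2 / 9 * x) ^ n"
        using False by (intro mult_right_mono) auto
      moreover have "(9 / 2) ^ n * (2 / 9 * x) ^ n = x ^ n"
        by (simp flip: power_mult_distrib)
      ultimately have "C * x ^ n \<le> (2 / 9 * x) ^ (n + j)"
        by (simp only: mult.assoc power_add mult.commute[of "(2 / 9 * x) ^ n"])
      moreover have "1 + (\<Sum>i\<le>n. \<bar>b i\<bar> * x ^ i) \<le> C * x ^ n"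
        unfolding C_def using False by (intro polynomial_dominated) auto
      moreover have "- (\<Sum>i\<le>n. \<bar>b i\<bar> * x ^ i) \<le> g x"
        unfolding b sum_negf[symmetric]
      proof (rule sum_mono)
        fix i
        have "- (\<bar>b i\<bar> * x ^ i) = - \<bar>b i * x ^ i\<bar>" using x by (simp add: abs_mult)
        then show "- (\<bar>b i\<bar> * x ^ i) \<le> b i * x ^ i" by linarith
      qed
      ultimately show ?thesis unfolding Q_def using k1[of x] \<epsilon> by linarith
    qed
    assume x4: "x \<le> 4"
    have "(2 / 9 * x) ^ (n + j) \<le> (8 / 9) ^ (n + j)" using x x4 by (intro power_mono) auto
    moreover have "\<bar>k x - g x\<bar> < \<epsilon> / 4" using x x4 by (intro g(2)) auto
    ultimately show "Q x \<le> k x + \<epsilon>" unfolding Q_def using j(2) by linarith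
  qed
qed

lemma sq_excess_sqrt_polynomial_approx:
  assumes "0 \<le> c" "0 < \<epsilon>"
  obtains a :: "nat \<Rightarrow> real" and N where
    "\<And>x. 0 \<le> x \<Longrightarrow> sq_excess (sqrt x - c) \<le> (\<Sum>i\<le>N. a i * x ^ Suc i)"
    "\<And>x. 0 \<le> x \<Longrightarrow> x \<le> 4 \<Longrightarrow> (\<Sum>i\<le>N. a i * x ^ Suc i) \<le> sq_excess (sqrt x - c) + \<epsilon> * x"
proof (cases "c = 0")
  case True
  show ?thesis
    by (rule that[of "\<lambda>_. 1" 0]) (use True assms in \<open>auto simp: sq_excess_def pos_part_def\<close>)
next
  case False
  then have c: "0 < c" using assms by simp
  \<comment> \<open>The quotient of \<open>sq_excess (sqrt x - c)\<close> by \<open>x\<close>: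
    beyond \<open>c^2\<close> it is \<open>(1 - c / sqrt x)^2\<close>, and the maximum makes it 0
    before, so it is continuous at 0 as well and never exceeds 1.\<close>
  define k where "k x = (1 - c / sqrt (max x (c\<^sup>2)))\<^sup>2" for x
  have root: "c \<le> sqrt (max x (c\<^sup>2))" for x
    using c by (intro real_le_rsqrt) auto
  have "0 \<le> 1 - c / sqrt (max x (c\<^sup>2))" "1 - c / sqrt (max x (c\<^sup>2)) \<le> 1" for x
    using c root[of x] by (auto simp: divide_simps)
  then have k1: "k x \<le> 1" for x unfolding k_def by (intro power_le_one)
  have "sqrt (max x (c\<^sup>2)) \<noteq> 0" for x using c root[of x] by linarith
  then have cont: "continuous_on {0..5} k"
    unfolding k_def by (intro continuous_intros) auto
  have k: "x * k x = sq_excess (sqrt x - c)" if x: "0 \<le> x" for x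
  proof (cases "x \<le> c\<^sup>2")
    case True
    then have "sqrt x \<le> c" using c by (simp add: real_le_lsqrt)
    then show ?thesis using True c by (simp add: k_def sq_excess_def pos_part_def max_def)
  next
    case False
    then have r: "sqrt x > c" "max x (c\<^sup>2) = x" using c by (auto intro: real_less_rsqrt)
    have "x * k x = (sqrt x * (1 - c / sqrt x))\<^sup>2"
      unfolding k_def r(2) using x by (simp add: power_mult_distrib)
    also have "sqrt x * (1 - c / sqrt x) = sqrt x - c"
    proof -
      have "sqrt x \<noteq> 0" using r c by linarith
      then show ?thesis by (simp add: right_diff_distrib del: real_sqrt_eq_zero_cancel_iff)
    qed
    finally show ?thesis using r by (simp add: sq_excess_def pos_part_def)
  qed
  obtain a N where a: "\<And>x. 0 \<le> x \<Longrightarrow> k x \<le> (\<Sum>i\<le>N. a i * x ^ i)"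
    "\<And>x. 0 \<le> x \<Longrightarrow> x \<le> 4 \<Longrightarrow> (\<Sum>i\<le>N. a i * x ^ i) \<le> k x + \<epsilon>"
    by (rule one_sided_polynomial_approx[OF cont k1 assms(2)]) blast
  have eq: "(\<Sum>i\<le>N. a i * x ^ Suc i) = x * (\<Sum>i\<le>N. a i * x ^ i)" for x
    unfolding sum_distrib_left by (intro sum.cong) auto
  show ?thesis
  proof (rule that[of a N]; unfold eq)
    fix x :: real assume x: "0 \<le> x"
    show "sq_excess (sqrt x - c) \<le> x * (\<Sum>i\<le>N. a i * x ^ i)"
      unfolding k[OF x, symmetric] using a(1)[OF x] x by (intro mult_left_mono)
    assume x4: "x \<le> 4"
    show "x * (\<Sum>i\<le>N. a i * x ^ i) \<le> sq_excess (sqrt x - c) + \<epsilon> * x"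
      unfolding k[OF x, symmetric] using mult_left_mono[OF a(2)[OF x x4] x] by (simp add: algebra_simps)
  qed
qed

section \<open>Averages with respect to the Marchenko-Pastur law\<close>

definition mp_density :: "real \<Rightarrow> real \<Rightarrow> real" where
  "mp_density s u = sqrt (mp_weight s u) / (pi * u * s)"

definition mp_mean :: "real \<Rightarrow> (real \<Rightarrow> real) \<Rightarrow> real" where
  "mp_mean s \<phi> = (LBINT u:{l_b s..u_b s}. \<phi> u * mp_density s u)"

context
  fixes s :: real
  assumes s: "0 < s" "s \<le> 1"
begin

text \<open>The second bound covers \<open>s = 1\<close>, where the support reaches the zero of the
  denominator: the weight is at most \<open>4 u^2\<close>. The third compares the weight with
  \<open>4 s\<close>; together with the interval length \<open>2 * sqrt s\<close> it bounds the mean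
  of \<open>u\<close> independently of \<open>s\<close>.\<close>

lemma mp_density_bounds:
  assumes u: "u \<in> {l_b s..u_b s}"
  shows "0 \<le> mp_density s u" "mp_density s u \<le> 2 / (pi * s)" "u * mp_density s u \<le> 2 * sqrt s / (pi * s)"
proof -
  have u0: "0 \<le> u" "u \<le> 2" using u edges[OF s] by auto
  have W: "0 \<le> mp_weight s u" by (rule mp_weight_nonneg[OF s u])
  show "0 \<le> mp_density s u" unfolding mp_density_def using W u0 s by simp
  have "mp_weight s u \<le> 2\<^sup>2 * u\<^sup>2"
    unfolding mp_weight_def
  proof (rule mult_mono)
    have "(u_b s)\<^sup>2 \<le> 2\<^sup>2" using edges[OF s] by (intro power_mono) auto
    then show "(u_b s)\<^sup>2 - u\<^sup>2 \<le> 2\<^sup>2" using zero_le_power2[of u] by linarith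
    show "0 \<le> u\<^sup>2 - (l_b s)\<^sup>2" using u edges[OF s] by (auto intro!: power_mono)
  qed auto
  then have "mp_weight s u \<le> (2 * u)\<^sup>2" by (simp add: power_mult_distrib)
  then have "sqrt (mp_weight s u) \<le> 2 * u" using u0 by (intro real_le_lsqrt W) auto
  then show "mp_density s u \<le> 2 / (pi * s)"
    unfolding mp_density_def using u0 s by (cases "u = 0") (auto simp: divide_simps)
  have "mp_weight s u \<le> (2 * sqrt s)\<^sup>2"
    unfolding mp_weight_alt[OF s] using s by (simp add: power_mult_distrib)
  then have "sqrt (mp_weight s u) \<le> 2 * sqrt s" using s by (intro real_le_lsqrt W) auto
  then show "u * mp_density s u \<le> 2 * sqrt s / (pi * s)"
    unfolding mp_density_def using u0 s by (cases "u = 0") (auto simp: divide_simps)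
qed

lemma mp_density_measurable [measurable]: "mp_density s \<in> borel_measurable borel"
  unfolding mp_density_def[abs_def] mp_weight_def[abs_def] by measurable

lemma set_integrable_mp_density:
  assumes [measurable]: "\<phi> \<in> borel_measurable borel" and B: "\<And>u. u \<in> {0..2} \<Longrightarrow> \<bar>\<phi> u\<bar> \<le> B"
  shows "set_integrable lborel {l_b s..u_b s} (\<lambda>u. \<phi> u * mp_density s u)"
proof (rule set_integrable_bound)
  show "set_integrable lborel {l_b s..u_b s} (\<lambda>_. B * (2 / (pi * s)))"
    by (rule borel_integrable_atLeastAtMost') (rule continuous_on_const)
  show "set_borel_measurable lborel {l_b s..u_b s} (\<lambda>u. \<phi> u * mp_density s u)"
    unfolding set_borel_measurable_def by measurable
  show "AE u in lborel. u \<in> {l_b s..u_b s} \<longrightarrow> norm (\<phi> u * mp_density s u) \<le> norm (B * (2 / (pi * s)))"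
  proof (intro AE_I2 impI)
    fix u assume u: "u \<in> {l_b s..u_b s}"
    then have "\<bar>\<phi> u\<bar> \<le> B" using B edges[OF s] by auto
    then have "\<bar>\<phi> u\<bar> * \<bar>mp_density s u\<bar> \<le> B * (2 / (pi * s))"
      using mp_density_bounds[OF u] by (intro mult_mono) auto
    also have "\<dots> \<le> \<bar>B * (2 / (pi * s))\<bar>" by (rule abs_ge_self)
    finally show "norm (\<phi> u * mp_density s u) \<le> norm (B * (2 / (pi * s)))"
      by (simp only: real_norm_def abs_mult)
  qed
qed

lemma mp_mean_mono:
  assumes "\<phi> \<in> borel_measurable borel" "\<And>u. u \<in> {0..2} \<Longrightarrow> \<bar>\<phi> u\<bar> \<le> B"
    and "\<psi> \<in> borel_measurable borel" "\<And>u. u \<in> {0..2} \<Longrightarrow> \<bar>\<psi> u\<bar> \<le> C"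
    and le: "\<And>u. u \<in> {0..2} \<Longrightarrow> \<phi> u \<le> \<psi> u"
  shows "mp_mean s \<phi> \<le> mp_mean s \<psi>"
  unfolding mp_mean_def
proof (rule set_integral_mono)
  fix u assume u: "u \<in> {l_b s..u_b s}"
  then show "\<phi> u * mp_density s u \<le> \<psi> u * mp_density s u"
    using mp_density_bounds(1)[OF u] edges[OF s] by (intro mult_right_mono le) auto
qed (rule set_integrable_mp_density[OF assms(1,2)] set_integrable_mp_density[OF assms(3,4)]; assumption)+

lemma mp_mean_add_cmult:
  assumes "\<phi> \<in> borel_measurable borel" "\<And>u. u \<in> {0..2} \<Longrightarrow> \<bar>\<phi> u\<bar> \<le> B"
    and "\<psi> \<in> borel_measurable borel" "\<And>u. u \<in> {0..2} \<Longrightarrow> \<bar>\<psi> u\<bar> \<le> C"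
  shows "mp_mean s (\<lambda>u. \<phi> u + c * \<psi> u) = mp_mean s \<phi> + c * mp_mean s \<psi>"
proof -
  have 1: "set_integrable lborel {l_b s..u_b s} (\<lambda>u. \<phi> u * mp_density s u)"
    and 2: "set_integrable lborel {l_b s..u_b s} (\<lambda>u. \<psi> u * mp_density s u)"
    by (rule set_integrable_mp_density[OF assms(1,2)] set_integrable_mp_density[OF assms(3,4)]; assumption)+
  have "mp_mean s (\<lambda>u. \<phi> u + c * \<psi> u) = (LBINT u:{l_b s..u_b s}. \<phi> u * mp_density s u + c * (\<psi> u * mp_density s u))"
    unfolding mp_mean_def by (simp add: algebra_simps)
  also have "\<dots> = mp_mean s \<phi> + c * mp_mean s \<psi>"
    unfolding mp_mean_def using 1 2 by simp
  finally show ?thesis .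
qed

lemma mp_mean_ident_le: "mp_mean s (\<lambda>u. u) \<le> 2"
proof -
  have "mp_mean s (\<lambda>u. u) \<le> (LBINT u:{l_b s..u_b s}. 2 * sqrt s / (pi * s))"
    unfolding mp_mean_def
  proof (rule set_integral_mono)
    show "set_integrable lborel {l_b s..u_b s} (\<lambda>u. u * mp_density s u)"
      by (rule set_integrable_mp_density[of _ 2]) auto
    show "set_integrable lborel {l_b s..u_b s} (\<lambda>_. 2 * sqrt s / (pi * s))"
      by (rule borel_integrable_atLeastAtMost') (rule continuous_on_const)
  qed (rule mp_density_bounds)
  also have "\<dots> = (u_b s - l_b s) * (2 * sqrt s / (pi * s))"
    using edges[OF s] by (simp add: set_lebesgue_integral_def)
  also have "\<dots> = 4 / pi"
    using s by (simp add: u_b_def l_b_def field_simps)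
  also have "\<dots> \<le> 2" using pi_gt3 by (simp add: divide_simps)
  finally show ?thesis .
qed

lemma set_integrable_power_mp_density:
  "set_integrable lborel {l_b s..u_b s} (\<lambda>u. u ^ p * mp_density s u)"
proof (rule set_integrable_mp_density)
  fix u :: real assume "u \<in> {0..2}"
  then show "\<bar>u ^ p\<bar> \<le> 2 ^ p" unfolding power_abs by (intro power_mono) auto
qed simp

lemma mp_mean_power: "mp_mean s (\<lambda>u. u ^ (2 * Suc p)) = mp_moment s (Suc p)"
proof -
  have "u ^ (2 * Suc p) * mp_density s u = 1 / (pi * s) * (u ^ (2 * p + 1) * sqrt (mp_weight s u))" for u
    unfolding mp_density_def by (cases "u = 0") (auto simp: field_simps)
  then have "mp_mean s (\<lambda>u. u ^ (2 * Suc p)) = integral {l_b s..u_b s} (\<lambda>u. 1 / (pi * s) * (u ^ (2 * p + 1) * sqrt (mp_weight s u)))"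
    unfolding mp_mean_def set_borel_integral_eq_integral(2)[OF set_integrable_power_mp_density] by simp
  also have "\<dots> = 1 / (pi * s) * mp_integral s p"
    unfolding mp_integral_def by (rule integral_mult_right)
  finally show ?thesis by (simp add: mp_moment_def)
qed

lemma mp_mean_polynomial:
  "mp_mean s (\<lambda>u. \<Sum>i\<le>N. a i * (u\<^sup>2) ^ Suc i) = (\<Sum>i\<le>N. a i * mp_moment s (Suc i))"
proof -
  have "mp_mean s (\<lambda>u. \<Sum>i\<le>N. a i * (u\<^sup>2) ^ Suc i) =
      (LBINT u:{l_b s..u_b s}. \<Sum>i\<le>N. a i * (u ^ (2 * Suc i) * mp_density s u))"
    unfolding mp_mean_def sum_distrib_right power_mult by (simp add: mult.assoc)
  also have "\<dots> = (\<Sum>i\<le>N. LBINT u:{l_b s..u_b s}. a i * (u ^ (2 * Suc i) * mp_density s u))"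
    unfolding set_lebesgue_integral_def scaleR_sum_right
    by (rule Bochner_Integration.integral_sum)
      (use set_integrable_mult_right[OF set_integrable_power_mp_density] in \<open>simp only: set_integrable_def\<close>)
  also have "\<dots> = (\<Sum>i\<le>N. a i * mp_mean s (\<lambda>u. u ^ (2 * Suc i)))"
    unfolding mp_mean_def by (simp del: power_Suc mult_Suc_right)
  finally show ?thesis unfolding mp_mean_power .
qed

end

text \<open>Rounding the threshold down costs a multiple of \<open>u\<close> rather than a constant,
  so its mean is controlled by that of \<open>u\<close>. Capping at 2 is possible because
  \<open>sq_excess (u - f)\<close> vanishes for \<open>u \<le> 2 \<le> f\<close>.\<close>

lemma sq_excess_le_grid:
  assumes c: "0 \<le> c" "c \<le> f" "min f 2 \<le> c + d" and u: "0 \<le> u" "u \<le> 2" and d: "0 \<le> d"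
  shows "sq_excess (u - c) \<le> sq_excess (u - f) + 2 * d * u"
proof -
  let ?t = "pos_part (u - c)" and ?r = "pos_part (u - f)"
  have le: "?t \<le> ?r + d" "0 \<le> ?t" "?t \<le> u" "0 \<le> ?r" "?r \<le> u"
    using assms by (auto simp: pos_part_def min_def split: if_splits)
  have "?t * ?t \<le> (?r + d) * ?t" using le by (intro mult_right_mono)
  also have "\<dots> = ?r * ?t + d * ?t" by (simp add: algebra_simps)
  also have "?r * ?t \<le> ?r * (?r + d)" using le by (intro mult_left_mono)
  also have "\<dots> = ?r * ?r + d * ?r" by (simp add: algebra_simps)
  also have "d * ?r \<le> d * u" using le d by (intro mult_left_mono)
  also have "d * ?t \<le> d * u" using le d by (intro mult_left_mono)
  finally show ?thesis by (simp add: sq_excess_def power2_eq_square)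
qed

lemma sq_excess_measurable [measurable]: "(\<lambda>u. sq_excess (u - c)) \<in> borel_measurable borel"
  unfolding sq_excess_def pos_part_def by measurable

lemma sq_excess_le_4:
  assumes "0 \<le> c" "u \<in> {0..2}"
  shows "\<bar>sq_excess (u - c)\<bar> \<le> 4"
proof -
  have "pos_part (u - c) \<le> 2" using assms by (auto simp: pos_part_def)
  then have "sq_excess (u - c) \<le> 2\<^sup>2" unfolding sq_excess_def by (intro power_mono) (auto simp: pos_part_def)
  then show ?thesis using sq_excess_nonneg[of "u - c"] by simp
qed

lemma mp_mean_sq_excess_le_grid:
  assumes s: "0 < s" "s \<le> 1" and c: "0 \<le> c" "c \<le> f" "min f 2 \<le> c + d" and d: "0 \<le> d"
  shows "mp_mean s (\<lambda>u. sq_excess (u - c)) \<le> mp_mean s (\<lambda>u. sq_excess (u - f)) + 4 * d"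
proof -
  have f: "0 \<le> f" using c by simp
  have "mp_mean s (\<lambda>u. sq_excess (u - c)) \<le> mp_mean s (\<lambda>u. sq_excess (u - f) + 2 * d * u)"
  proof (rule mp_mean_mono[OF s])
    fix u :: real assume u: "u \<in> {0..2}"
    show "\<bar>sq_excess (u - c)\<bar> \<le> 4" by (rule sq_excess_le_4[OF c(1) u])
    show "sq_excess (u - c) \<le> sq_excess (u - f) + 2 * d * u"
      by (rule sq_excess_le_grid[OF c _ _ d]) (use u in auto)
    have "2 * d * u \<le> 2 * d * 2" using u d by (intro mult_left_mono) auto
    moreover have "0 \<le> 2 * d * u" using u d by auto
    ultimately show "\<bar>sq_excess (u - f) + 2 * d * u\<bar> \<le> 4 + 2 * d * 2"
      using sq_excess_le_4[OF f u] by linarith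
  qed measurable
  also have "\<dots> = mp_mean s (\<lambda>u. sq_excess (u - f)) + 2 * d * mp_mean s (\<lambda>u. u)"
    by (rule mp_mean_add_cmult[OF s sq_excess_measurable sq_excess_le_4[OF f], of _ 2]) auto
  also have "2 * d * mp_mean s (\<lambda>u. u) \<le> 2 * d * 2"
    using mp_mean_ident_le[OF s] d by (intro mult_left_mono) auto
  finally show ?thesis by simp
qed

text \<open>The error \<open>\<epsilon> * x\<close> averages to \<epsilon>, because the law has
  first moment 1 in \<open>x = u^2\<close>.\<close>

lemma mp_moment_polynomial_le:
  assumes s: "0 < s" "s \<le> 1" and c: "0 \<le> c"
    and a: "\<And>x. 0 \<le> x \<Longrightarrow> x \<le> 4 \<Longrightarrow> (\<Sum>i\<le>N. a i * x ^ Suc i) \<le> sq_excess (sqrt x - c) + \<epsilon> * x"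
  shows "(\<Sum>i\<le>N. a i * mp_moment s (Suc i)) \<le> mp_mean s (\<lambda>u. sq_excess (u - c)) + \<epsilon>"
proof -
  have four: "u\<^sup>2 \<le> 4" if "u \<in> {0..2}" for u :: real
    using power_mono[of u 2 2] that by simp
  have "mp_mean s (\<lambda>u. \<Sum>i\<le>N. a i * (u\<^sup>2) ^ Suc i) \<le> mp_mean s (\<lambda>u. sq_excess (u - c) + \<epsilon> * u\<^sup>2)"
  proof (rule mp_mean_mono[OF s])
    fix u :: real assume u: "u \<in> {0..2}"
    then have "\<bar>\<Sum>i\<le>N. a i * (u\<^sup>2) ^ Suc i\<bar> \<le> (\<Sum>i\<le>N. \<bar>a i\<bar> * (u\<^sup>2) ^ Suc i)"
      using sum_abs[of "\<lambda>i. a i * (u\<^sup>2) ^ Suc i" "{..N}"] by (simp add: abs_mult)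
    also have "\<dots> \<le> (\<Sum>i\<le>N. \<bar>a i\<bar> * 4 ^ Suc i)"
      using four[OF u] by (intro sum_mono mult_left_mono power_mono) auto
    finally show "\<bar>\<Sum>i\<le>N. a i * (u\<^sup>2) ^ Suc i\<bar> \<le> (\<Sum>i\<le>N. \<bar>a i\<bar> * 4 ^ Suc i)" .
    show "(\<Sum>i\<le>N. a i * (u\<^sup>2) ^ Suc i) \<le> sq_excess (u - c) + \<epsilon> * u\<^sup>2"
      using a[of "u\<^sup>2"] u four[OF u] by simp
    have "\<bar>\<epsilon> * u\<^sup>2\<bar> \<le> \<bar>\<epsilon>\<bar> * 4" unfolding abs_mult using four[OF u] by (intro mult_left_mono) auto
    then show "\<bar>sq_excess (u - c) + \<epsilon> * u\<^sup>2\<bar> \<le> 4 + \<bar>\<epsilon>\<bar> * 4"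
      using sq_excess_le_4[OF c u] by linarith
  qed measurable
  also have "mp_mean s (\<lambda>u. sq_excess (u - c) + \<epsilon> * u\<^sup>2) = mp_mean s (\<lambda>u. sq_excess (u - c)) + \<epsilon> * mp_mean s (\<lambda>u. u\<^sup>2)"
    by (rule mp_mean_add_cmult[OF s sq_excess_measurable sq_excess_le_4[OF c], of _ 4]) (use four in auto)
  also have "mp_mean s (\<lambda>u. u\<^sup>2) = 1"
    using mp_mean_power[OF s, of 0] mp_integral_0[OF s] s by (simp add: mp_moment_def power2_eq_square)
  finally show ?thesis unfolding mp_mean_polynomial[OF s] by simp
qed

text \<open>A pathwise bound with a separate polynomial for each threshold. After rearrangement
  every threshold meets the whole spectrum, so the polynomials sum to traces; the pairing of
  \<open>i\<close> with \<open>i\<close> would leave individual singular values.\<close>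

lemma singular_value_trace_bound:
  fixes f :: "nat \<Rightarrow> real"
  assumes A: "A \<in> carrier_mat n m" and n: "0 < n"
    and f: "\<And>i j. i \<le> j \<Longrightarrow> j < n \<Longrightarrow> f j \<le> f i"
    and a: "\<And>i x. i < n \<Longrightarrow> 0 \<le> x \<Longrightarrow> sq_excess (sqrt x - f i) \<le> (\<Sum>p\<le>N i. a i p * x ^ Suc p)"
  shows "(\<Sum>i<n. sq_excess (singular_value A i - f i)) \<le>
    (\<Sum>i<n. \<Sum>p\<le>N i. a i p * (mtrace ((A * transpose_mat A) ^\<^sub>m Suc p) / real n))"
proof (rule singular_values[OF A])
  fix es assume es: "length es = n" "\<forall>e\<in>set es. 0 \<le> e"
    "\<And>g :: real \<Rightarrow> real. (\<Sum>i<n. g (singular_value A i)) = (\<Sum>e\<leftarrow>es. g (sqrt e))"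
    "\<And>k. mtrace ((A * transpose_mat A) ^\<^sub>m k) = (\<Sum>e\<leftarrow>es. e ^ k)"
    "\<And>i j. i \<le> j \<Longrightarrow> j < n \<Longrightarrow> singular_value A j \<le> singular_value A i"
  have "real n * (\<Sum>i<n. sq_excess (singular_value A i - f i)) \<le>
      (\<Sum>i<n. \<Sum>j<n. sq_excess (singular_value A j - f i))"
    by (rule sum_sq_excess_sorted_le[OF es(5) f])
  also have "\<dots> = (\<Sum>i<n. \<Sum>e\<leftarrow>es. sq_excess (sqrt e - f i))"
    by (intro sum.cong es(3)) simp
  also have "\<dots> \<le> (\<Sum>i<n. \<Sum>e\<leftarrow>es. \<Sum>p\<le>N i. a i p * e ^ Suc p)"
    using es(2) by (intro sum_mono sum_list_mono a) auto
  also have "\<dots> = (\<Sum>i<n. \<Sum>p\<le>N i. a i p * mtrace ((A * transpose_mat A) ^\<^sub>m Suc p))"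
  proof (intro sum.cong refl)
    fix i
    have "(\<Sum>e\<leftarrow>l. \<Sum>p\<le>N i. a i p * e ^ Suc p) = (\<Sum>p\<le>N i. a i p * (\<Sum>e\<leftarrow>l. e ^ Suc p))" for l
      by (induction l) (simp_all add: distrib_left sum.distrib)
    then show "(\<Sum>e\<leftarrow>es. \<Sum>p\<le>N i. a i p * e ^ Suc p) = (\<Sum>p\<le>N i. a i p * mtrace ((A * transpose_mat A) ^\<^sub>m Suc p))"
      unfolding es(4) .
  qed
  finally show ?thesis using n by (simp add: field_simps flip: sum_divide_distrib)
qed

section \<open>Transfer to the scaled Gaussian matrix, and conclusion\<close>

lemma smult_gram:
  fixes A :: "real mat"
  assumes "A \<in> carrier_mat n m"
  shows "(c \<cdot>\<^sub>m A) * transpose_mat (c \<cdot>\<^sub>m A) = (c * c) \<cdot>\<^sub>m (A * transpose_mat A)"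
proof (rule eq_matI)
  have t: "transpose_mat (c \<cdot>\<^sub>m A) \<in> carrier_mat m n" "transpose_mat A \<in> carrier_mat m n" "c \<cdot>\<^sub>m A \<in> carrier_mat n m"
    using assms by auto
  fix i j assume "i < dim_row ((c * c) \<cdot>\<^sub>m (A * transpose_mat A))" "j < dim_col ((c * c) \<cdot>\<^sub>m (A * transpose_mat A))"
  then have ij: "i < n" "j < n" using assms by auto
  have "((c \<cdot>\<^sub>m A) * transpose_mat (c \<cdot>\<^sub>m A)) $$ (i, j) = (\<Sum>l<m. (c * c) * (A $$ (i, l) * A $$ (j, l)))"
    unfolding index_mult_sum[OF t(3,1) ij] using ij assms by (intro sum.cong) auto
  also have "\<dots> = (c * c) * (A * transpose_mat A) $$ (i, j)"
    unfolding index_mult_sum[OF assms t(2) ij] sum_distrib_left using ij assms by (intro sum.cong) auto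
  also have "\<dots> = ((c * c) \<cdot>\<^sub>m (A * transpose_mat A)) $$ (i, j)" using ij assms by simp
  finally show "((c \<cdot>\<^sub>m A) * transpose_mat (c \<cdot>\<^sub>m A)) $$ (i, j) = ((c * c) \<cdot>\<^sub>m (A * transpose_mat A)) $$ (i, j)" .
qed (use assms in auto)

lemma mtrace_smult_pow:
  fixes A :: "real mat"
  assumes A: "A \<in> carrier_mat n n"
  shows "mtrace ((c \<cdot>\<^sub>m A) ^\<^sub>m k) = c ^ k * mtrace (A ^\<^sub>m k)"
proof -
  have "(c \<cdot>\<^sub>m A) ^\<^sub>m k = c ^ k \<cdot>\<^sub>m A ^\<^sub>m k"
  proof (induction k)
    case 0
    show ?case using A by (intro eq_matI) auto
  next
    case (Suc k)
    have P: "A ^\<^sub>m k \<in> carrier_mat n n" using A by simp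
    have "(c ^ k \<cdot>\<^sub>m A ^\<^sub>m k) * (c \<cdot>\<^sub>m A) = c \<cdot>\<^sub>m ((c ^ k \<cdot>\<^sub>m A ^\<^sub>m k) * A)"
      by (rule mult_smult_distrib[OF smult_carrier_mat[OF P] A])
    also have "(c ^ k \<cdot>\<^sub>m A ^\<^sub>m k) * A = c ^ k \<cdot>\<^sub>m (A ^\<^sub>m k * A)"
      by (rule mult_smult_assoc_mat[OF P A])
    also have "c \<cdot>\<^sub>m (c ^ k \<cdot>\<^sub>m (A ^\<^sub>m k * A)) = c ^ Suc k \<cdot>\<^sub>m (A ^\<^sub>m k * A)"
      by (intro eq_matI) auto
    finally show ?case using Suc by simp
  qed
  then show ?thesis unfolding mtrace_def using A by (simp add: sum_distrib_left)
qed

lemma std_gaussian_matrix_imp: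
  assumes "std_gaussian_matrix M n m G" "0 < n" "0 < m"
  shows "gaussian_matrix M (\<lambda>e \<omega>. G \<omega> $$ e) n m"
proof -
  interpret prob_space M using assms(1) by (simp add: std_gaussian_matrix_def)
  have "(\<lambda>(i, j) \<omega>. G \<omega> $$ (i, j)) = (\<lambda>e \<omega>. G \<omega> $$ e)" by auto
  then show ?thesis
    using assms by unfold_locales (auto simp: std_gaussian_matrix_def)
qed

lemma S_ap_eq:
  "S_ap n m f = 1 / real n * (\<Sum>i<n. mp_mean (real n / real m) (\<lambda>u. sq_excess (u - desc_entry f i)))"
  unfolding S_ap_def Let_def mp_mean_def sq_excess_def mp_density_def mp_weight_def ..

lemma mp_mean_sq_excess_nonneg:
  assumes s: "0 < s" "s \<le> 1"
  shows "0 \<le> mp_mean s (\<lambda>u. sq_excess (u - c))"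
  unfolding mp_mean_def set_lebesgue_integral_def
  using mp_density_bounds(1)[OF s] sq_excess_nonneg
  by (intro integral_nonneg_AE AE_I2) (auto simp: indicator_def)

text \<open>The comparison at fixed dimensions: each threshold has its polynomial majorant, and
  \<open>b\<close> collects all asymptotic errors. Taking expectations of the pathwise bound turns
  its traces into \<open>moment_prod\<close> of one-element multisets.\<close>

lemma S_exact_le:
  assumes gauss: "std_gaussian_matrix M n m G" and n: "0 < n" and m: "0 < m" and nm: "real n / real m \<le> 1"
    and f: "f \<in> carrier_vec n" "\<And>i. i < n \<Longrightarrow> 0 \<le> vec_index f i"
    and a: "\<And>i x. i < n \<Longrightarrow> 0 \<le> x \<Longrightarrow> sq_excess (sqrt x - desc_entry f i) \<le> (\<Sum>p\<le>N i. a i p * x ^ Suc p)"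
    and B: "\<And>i. i < n \<Longrightarrow> (\<Sum>p\<le>N i. a i p * gaussian_matrix.moment_prod M (\<lambda>e \<omega>. G \<omega> $$ e) n m {#Suc p#}) \<le>
      mp_mean (real n / real m) (\<lambda>u. sq_excess (u - desc_entry f i)) + b" and b: "0 \<le> b"
  shows "S_exact M n m G f \<le> S_ap n m f + b"
proof -
  interpret gaussian_matrix M "\<lambda>e \<omega>. G \<omega> $$ e" n m
    by (rule std_gaussian_matrix_imp[OF gauss n m])
  let ?A = "\<lambda>\<omega>. (1 / sqrt (real m)) \<cdot>\<^sub>m G \<omega>"
  let ?X = "\<lambda>\<omega>. 1 / real n * (\<Sum>i<n. sq_excess (singular_value (?A \<omega>) i - desc_entry f i))"
  let ?\<tau> = "\<lambda>p \<omega>. trace_prod n m {#Suc p#} (\<lambda>e. G \<omega> $$ e) / normalizer n m {#Suc p#}"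
  let ?Y = "\<lambda>\<omega>. 1 / real n * (\<Sum>i<n. \<Sum>p\<le>N i. a i p * ?\<tau> p \<omega>)"
  have S: "S_exact M n m G f = expectation ?X"
    unfolding S_exact_def sq_excess_def ..
  have s: "0 < real n / real m" using n m by simp
  have ap: "0 \<le> S_ap n m f"
    unfolding S_ap_eq by (intro mult_nonneg_nonneg sum_nonneg mp_mean_sq_excess_nonneg s nm) simp
  \<comment> \<open>Measurability of the singular values is not needed: a non-integrable integrand has the junk expectation \<open>0\<close>.\<close>
  show ?thesis
  proof (cases "integrable M ?X")
    case False
    show ?thesis unfolding S not_integrable_integral_eq[OF False] using ap b by simp
  next
    case True
    have XY: "?X \<omega> \<le> ?Y \<omega>" if \<omega>: "\<omega> \<in> space M" for \<omega>
    proof -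
      have G: "G \<omega> \<in> carrier_mat n m" using gauss \<omega> by (simp add: std_gaussian_matrix_def)
      then have A: "?A \<omega> \<in> carrier_mat n m" by simp
      have entry_matrix: "mat n m (\<lambda>e. G \<omega> $$ e) = G \<omega>" using G by (intro eq_matI) auto
      have GG: "G \<omega> * transpose_mat (G \<omega>) \<in> carrier_mat n n" using G by (intro mult_carrier_mat) auto
      have gram_trace: "mtrace ((?A \<omega> * transpose_mat (?A \<omega>)) ^\<^sub>m Suc p) / real n = ?\<tau> p \<omega>" for p
      proof -
        have "1 / sqrt (real m) * (1 / sqrt (real m)) = 1 / real m" by simp
        then have "mtrace ((?A \<omega> * transpose_mat (?A \<omega>)) ^\<^sub>m Suc p) =
            (1 / real m) ^ Suc p * mtrace ((G \<omega> * transpose_mat (G \<omega>)) ^\<^sub>m Suc p)"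
          by (simp only: smult_gram[OF G] mtrace_smult_pow[OF GG])
        also have "mtrace ((G \<omega> * transpose_mat (G \<omega>)) ^\<^sub>m Suc p) = trace_prod n m {#Suc p#} (\<lambda>e. G \<omega> $$ e)"
          by (simp only: trace_prod_def gram_trace_def gram_def entry_matrix image_mset_single prod_mset_singleton)
        finally show ?thesis using n m by (simp add: normalizer_def power_divide field_simps)
      qed
      have "(\<Sum>i<n. sq_excess (singular_value (?A \<omega>) i - desc_entry f i)) \<le> (\<Sum>i<n. \<Sum>p\<le>N i. a i p * ?\<tau> p \<omega>)"
        using singular_value_trace_bound[OF A n desc_entry_antimono[OF f(1)] a] unfolding gram_trace .
      then show ?thesis by (intro mult_left_mono) auto
    qed
    have int: "integrable M (?\<tau> p)" for p
      by (rule integrable_divide) (rule integrable_trace_prod)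
    have E\<tau>: "expectation (?\<tau> p) = moment_prod {#Suc p#}" for p
      unfolding moment_prod_def by simp
    have "expectation ?X \<le> expectation ?Y"
      by (rule integral_mono[OF True _ XY]) (intro integrable_mult_right Bochner_Integration.integrable_sum int)
    also have "expectation ?Y = 1 / real n * (\<Sum>i<n. \<Sum>p\<le>N i. a i p * moment_prod {#Suc p#})"
    proof -
      have "expectation ?Y = 1 / real n * expectation (\<lambda>\<omega>. \<Sum>i<n. \<Sum>p\<le>N i. a i p * ?\<tau> p \<omega>)"
        by (rule integral_mult_right_zero)
      also have "expectation (\<lambda>\<omega>. \<Sum>i<n. \<Sum>p\<le>N i. a i p * ?\<tau> p \<omega>) = (\<Sum>i<n. expectation (\<lambda>\<omega>. \<Sum>p\<le>N i. a i p * ?\<tau> p \<omega>))"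
        by (intro Bochner_Integration.integral_sum Bochner_Integration.integrable_sum integrable_mult_right int)
      also have "\<dots> = (\<Sum>i<n. \<Sum>p\<le>N i. expectation (\<lambda>\<omega>. a i p * ?\<tau> p \<omega>))"
        by (intro sum.cong refl Bochner_Integration.integral_sum integrable_mult_right int)
      also have "\<dots> = (\<Sum>i<n. \<Sum>p\<le>N i. a i p * moment_prod {#Suc p#})"
        by (simp only: integral_mult_right_zero E\<tau>)
      finally show ?thesis .
    qed
    also have "\<dots> \<le> 1 / real n * (\<Sum>i<n. mp_mean (real n / real m) (\<lambda>u. sq_excess (u - desc_entry f i)) + b)"
      by (intro mult_left_mono sum_mono B) auto
    also have "\<dots> = S_ap n m f + b"
      unfolding S_ap_eq using n by (simp add: sum.distrib algebra_simps)
    finally show ?thesis unfolding S .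
  qed
qed

text \<open>The regime of growing dimensions is read along sequences in which the ratio and
  \<open>f\<close> may vary. Neither side need converge, so the inequality takes the form of a
  limsup of differences.\<close>

theorem lemma6:
  fixes n1 n2 :: "nat \<Rightarrow> nat"
    and M :: "nat \<Rightarrow> 'a measure"
    and G :: "nat \<Rightarrow> 'a \<Rightarrow> real mat"
    and f :: "nat \<Rightarrow> real vec"
  assumes n1_infty: "filterlim n1 at_top sequentially"
    and n2_infty: "filterlim n2 at_top sequentially"
    and ratio: "\<And>k. real (n1 k) / real (n2 k) \<in> {0<..1}"
    and gauss: "\<And>k. std_gaussian_matrix (M k) (n1 k) (n2 k) (G k)"
    and f_dim: "\<And>k. f k \<in> carrier_vec (n1 k)"
    and f_nonneg: "\<And>k i. i < n1 k \<Longrightarrow> f k $ i \<ge> 0"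
  shows "limsup (\<lambda>k. ereal (S_exact (M k) (n1 k) (n2 k) (G k) (f k) - S_ap (n1 k) (n2 k) (f k))) \<le> 0"
proof (rule ereal_le_epsilon2)
  fix \<epsilon> :: real assume "0 < \<epsilon>"
  \<comment> \<open>Six shares: one for the convergence of the moments, one for the polynomial
    majorant, and four for rounding the thresholds, where \<open>2 * d\<close> meets the bound 2 on
    the mean of \<open>u\<close>.\<close>
  define d where "d = \<epsilon> / 6"
  have d: "0 < d" using \<open>0 < \<epsilon>\<close> by (simp add: d_def)
  have pos: "0 < n1 k" "0 < n2 k" for k using ratio[of k] by (auto simp: zero_less_divide_iff)
  have s: "0 < real (n1 k) / real (n2 k)" "real (n1 k) / real (n2 k) \<le> 1" for k
    using ratio[of k] by auto
  have gm: "gaussian_matrix (M k) (\<lambda>e \<omega>. G k \<omega> $$ e) (n1 k) (n2 k)" for k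
    by (rule std_gaussian_matrix_imp[OF gauss pos])
  define approx where "approx j a N \<longleftrightarrow> (\<forall>x\<ge>0. sq_excess (sqrt x - real j * d) \<le> (\<Sum>i\<le>N. a i * x ^ Suc i)) \<and>
      (\<forall>x. 0 \<le> x \<and> x \<le> 4 \<longrightarrow> (\<Sum>i\<le>N. a i * x ^ Suc i) \<le> sq_excess (sqrt x - real j * d) + d * x)"
    for j N :: nat and a
  have "\<exists>a N. approx j a N" for j
  proof -
    obtain a N where "\<And>x. 0 \<le> x \<Longrightarrow> sq_excess (sqrt x - real j * d) \<le> (\<Sum>i\<le>N. a i * x ^ Suc i)"
      "\<And>x. 0 \<le> x \<Longrightarrow> x \<le> 4 \<Longrightarrow> (\<Sum>i\<le>N. a i * x ^ Suc i) \<le> sq_excess (sqrt x - real j * d) + d * x"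
      by (rule sq_excess_sqrt_polynomial_approx[of "real j * d" d]) (use d in auto)
    then show ?thesis unfolding approx_def by blast
  qed
  then obtain a N where "\<And>j. approx j (a j) (N j)" by metis
  then have a: "\<And>j x. 0 \<le> x \<Longrightarrow> sq_excess (sqrt x - real j * d) \<le> (\<Sum>i\<le>N j. a j i * x ^ Suc i)"
    "\<And>j x. 0 \<le> x \<Longrightarrow> x \<le> 4 \<Longrightarrow> (\<Sum>i\<le>N j. a j i * x ^ Suc i) \<le> sq_excess (sqrt x - real j * d) + d * x"
    unfolding approx_def by simp_all
  let ?y = "\<lambda>k p. gaussian_matrix.moment_prod (M k) (\<lambda>e \<omega>. G k \<omega> $$ e) (n1 k) (n2 k) {#Suc p#}"
  let ?\<mu> = "\<lambda>k p. mp_moment (real (n1 k) / real (n2 k)) (Suc p)"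
  \<comment> \<open>Grid points up to 2 have index at most \<open>K\<close>, so the convergence
    below is needed uniformly over finitely many polynomials only, however large \<open>n1 k\<close>
    becomes.\<close>
  define K where "K = nat \<lfloor>2 / d\<rfloor>"
  have conv: "(\<lambda>k. \<Sum>p\<le>N j. a j p * (?y k p - ?\<mu> k p)) \<longlonglongrightarrow> (\<Sum>p\<le>N j. a j p * 0)" for j
    using mp.moment_prod_converges[OF gm n1_infty n2_infty ratio, of "{#Suc _#}"]
    by (intro tendsto_sum tendsto_mult_left) (simp add: mp.moment_prod_limit_def)
  have "\<forall>\<^sub>F k in sequentially. (\<Sum>p\<le>N j. a j p * (?y k p - ?\<mu> k p)) < d" for j
    using order_tendstoD(2)[OF conv[of j], of d] d by simp
  then have "\<forall>\<^sub>F k in sequentially. \<forall>j\<in>{..K}. (\<Sum>p\<le>N j. a j p * (?y k p - ?\<mu> k p)) < d"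
    by (intro eventually_ball_finite) auto
  then have "\<forall>\<^sub>F k in sequentially. S_exact (M k) (n1 k) (n2 k) (G k) (f k) - S_ap (n1 k) (n2 k) (f k) \<le> \<epsilon>"
  proof eventually_elim
    case (elim k)
    let ?f = "\<lambda>i. desc_entry (f k) i"
    \<comment> \<open>Index of the largest grid point not exceeding
      \<open>min (?f i) 2\<close>.\<close>
    define j where "j i = nat \<lfloor>min (?f i) 2 / d\<rfloor>" for i
    have f0: "0 \<le> ?f i" if "i < n1 k" for i
      by (rule desc_entry_nonneg[OF f_dim f_nonneg that])
    have j: "real (j i) * d \<le> ?f i" "min (?f i) 2 \<le> real (j i) * d + d" "j i \<le> K" if i: "i < n1 k" for i
    proof -
      let ?q = "min (?f i) 2 / d"
      have q: "0 \<le> ?q" "?q \<le> 2 / d" using f0[OF i] d by (auto simp: divide_right_mono)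
      then have r: "real (j i) \<le> ?q" "?q \<le> real (j i) + 1" unfolding j_def by linarith+
      have "real (j i) * d \<le> min (?f i) 2" using r(1) d by (simp add: pos_le_divide_eq)
      then show "real (j i) * d \<le> ?f i" by linarith
      have "min (?f i) 2 \<le> (real (j i) + 1) * d" using r(2) d by (simp only: pos_divide_le_eq)
      then show "min (?f i) 2 \<le> real (j i) * d + d" by (simp add: algebra_simps)
      show "j i \<le> K" unfolding j_def K_def using q(2) by (intro nat_mono floor_mono)
    qed
    have "S_exact (M k) (n1 k) (n2 k) (G k) (f k) \<le> S_ap (n1 k) (n2 k) (f k) + 6 * d"
    proof (rule S_exact_le[OF gauss pos s(2) f_dim, where N = "\<lambda>i. N (j i)" and a = "\<lambda>i. a (j i)"])
      show "0 \<le> vec_index (f k) i" if "i < n1 k" for i by (rule f_nonneg[OF that])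
      \<comment> \<open>Lowering a threshold only raises the excess, so the majorant of the grid
        point also serves \<open>?f i\<close>.\<close>
      show "sq_excess (sqrt x - ?f i) \<le> (\<Sum>p\<le>N (j i). a (j i) p * x ^ Suc p)" if "i < n1 k" "0 \<le> x" for i x
        using a(1)[OF that(2), of "j i"] sq_excess_mono[of "sqrt x - ?f i" "sqrt x - real (j i) * d"] j(1)[OF that(1)]
        by linarith
      show "(\<Sum>p\<le>N (j i). a (j i) p * ?y k p) \<le> mp_mean (real (n1 k) / real (n2 k)) (\<lambda>u. sq_excess (u - ?f i)) + 6 * d"
        if i: "i < n1 k" for i
      proof -
        have "(\<Sum>p\<le>N (j i). a (j i) p * ?y k p) = (\<Sum>p\<le>N (j i). a (j i) p * (?y k p - ?\<mu> k p)) + (\<Sum>p\<le>N (j i). a (j i) p * ?\<mu> k p)"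
          unfolding sum.distrib[symmetric] by (simp add: algebra_simps)
        also have "(\<Sum>p\<le>N (j i). a (j i) p * (?y k p - ?\<mu> k p)) < d" using elim j(3)[OF i] by simp
        also have "(\<Sum>p\<le>N (j i). a (j i) p * ?\<mu> k p) \<le>
            mp_mean (real (n1 k) / real (n2 k)) (\<lambda>u. sq_excess (u - real (j i) * d)) + d"
          by (rule mp_moment_polynomial_le[OF s _ a(2)]) (use d in auto)
        also have "mp_mean (real (n1 k) / real (n2 k)) (\<lambda>u. sq_excess (u - real (j i) * d)) \<le>
            mp_mean (real (n1 k) / real (n2 k)) (\<lambda>u. sq_excess (u - ?f i)) + 4 * d"
          by (rule mp_mean_sq_excess_le_grid[OF s _ j(1,2)[OF i]]) (use d in auto)
        finally show ?thesis by simp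
      qed
    qed (use d in auto)
    then show ?case by (simp add: d_def)
  qed
  then show "limsup (\<lambda>k. ereal (S_exact (M k) (n1 k) (n2 k) (G k) (f k) - S_ap (n1 k) (n2 k) (f k))) \<le> 0 + ereal \<epsilon>"
    by (intro Limsup_bounded) (auto elim: eventually_mono)
qed

end
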